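(* For $\lambda$ in the Leech lattice $\Lambda$, let $v(\lambda)=e^{\lambda}+e^{-\lambda}$, considered as an element of the Moonshine module $V^\natural$. Then $v(\lambda)$ is a highest weight vector (for the Virasoro algebra) of weight $k=\frac{\langle\lambda,\lambda\rangle}{2}$, and if $0\neq\lambda\in 2\Lambda$ then $$Z(v(\lambda),\tau)=\eta(\tau)^{12}\left\{\left(\frac{\Theta_1(\tau)}{2}\right)^{\langle\lambda,\lambda\rangle-12}+\left(\frac{\Theta_2(\tau)}{2}\right)^{\langle\lambda,\lambda\rangle-12}-\left(\frac{\Theta_3(\tau)}{2}\right)^{\langle\lambda,\lambda\rangle-12}\right\}.$$
   Context: $\eta$ is the Dedekind eta function, $q=e^{2\pi i\tau}$, and the Jacobi theta functions are $\Theta_1(\tau)=2q^{1/8}\prod_{n\ge1}(1-q^n)(1+q^n)^2=2\frac{\eta(2\tau)^2}{\eta(\tau)}$, $\Theta_2(\tau)=\prod_{n\ge1}(1-q^n)(1-q^{n-1/2})^2=\frac{\eta(\tau/2)^2}{\eta(\tau)}$, $\Theta_3(\tau)=\prod_{n\ge1}(1-q^n)(1+q^{n-1/2})^2=\frac{\eta(\tau)^5}{\eta(\tau/2)^2\eta(2\tau)^2}$. $\Lambda$ is the Leech lattice, $\mathfrak h=\mathbb C\otimes_{\mathbb Z}\Lambda$. The lattice vertex operator algebra is $V_\Lambda=M(1)\otimes\mathbb C[\Lambda]$ (Frenkel-Lepowsky-Meurman), where $M(1)=S(\hat{\mathfrak h}^-)$ is the Fock space of the Heisenberg algebra (level 1),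 with $Y(e^\alpha,z)=E^-(-\alpha,z)E^+(-\alpha,z)e_\alpha z^\alpha$, $E^{\pm}(\alpha,z)=\exp\big(\sum_{n>0}\frac{\alpha(\pm n)}{\pm n}z^{\mp n}\big)$, $e_\alpha e^\beta=\epsilon(\alpha,\beta)e^{\alpha+\beta}$, with $\epsilon$ a bilinear 2-cocycle on $\Lambda$ with values in $\{\pm1\}$ (and $\epsilon(\alpha,\beta)\epsilon(\beta,\alpha)=(-1)^{\langle\alpha,\beta\rangle}$). $t$ is the order 2 automorphism of $V_\Lambda$ with $te^\alpha=e^{-\alpha}$ acting on $M(1)$ by $t(\beta_1(-n_1)\cdots\beta_k(-n_k))=(-1)^k\beta_1(-n_1)\cdots\beta_k(-n_k)$. $V_\Lambda^T=S(\hat{\mathfrak h}[-1]^-)\otimes T$ is the $t$-twisted $V_\Lambda$-module, where $S(\hat{\mathfrak h}[-1]^-)$ is generated by $\beta(-n)$, $\beta\in\mathfrak h$, $0<n\in\frac12+\mathbb Z$, and $T$ is the $2^{12}$-dimensional projective representation of $\Lambda$ on which $2\Lambda$ acts trivially; the grading is the natural one shifted by $3/2$; $t$ acts on $T$ as $-1$ and on $S(\hat{\mathfrak h}[-1]^-)$ by $(-1)^k$ on products of $k$ generators; on $V_\Lambda^T$, $Y(e^\beta,z)=2^{-\langle\beta,\beta\rangle}E^-_{1/2}(-\beta,z)E^+_{1/2}(-\beta,z)e_\beta z^{-\langle\beta,\beta\rangle/2}$ with $E^\pm_{1/2}(h,z)=\exp\big(\sum_{n\ge0}\frac{h(\pm(n+1/2))}{\pm(n+1/2)}z^{\mp(n+1/2)}\big)$.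 Superscript $+$ denotes $t$-fixed points. The Moonshine module is $V^\natural=V_\Lambda^+\oplus(V_\Lambda^T)^+$, of central charge 24; $v(\lambda)\in V_\Lambda^+\subset V^\natural$. For a homogeneous vector $v$ of weight $\mathrm{wt}\,v$ in $V^\natural=\bigoplus_nV^\natural_n$, with $Y(v,z)=\sum_nv(n)z^{-n-1}$, the zero mode is $o(v)=v(\mathrm{wt}\,v-1)$ and $Z(v,\tau)=q^{-1}\sum_{n}(\mathrm{tr}_{V^\natural_n}o(v))q^n$. A highest weight vector of weight $k$ is a vector $v$ with $L(n)v=0$ for $n>0$ and $L(0)v=kv$. *)

theory Defs
  imports "HOL-Analysis.Analysis" "HOL-Library.Numeral_Type" "HOL-Library.Poly_Mapping"
begin

section \<open>The Leech lattice\<close>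

definition full_lattice :: "(real^24) set \<Rightarrow> bool" where
  "full_lattice \<Lambda> \<longleftrightarrow> (\<exists>B :: 24 \<Rightarrow> real^24. inj B \<and> independent (range B) \<and>
     \<Lambda> = {x. \<exists>c :: 24 \<Rightarrow> int. x = (\<Sum>i\<in>UNIV. of_int (c i) *\<^sub>R B i)})"

text \<open>By Conway's theorem these conditions determine the lattice up to isometry.\<close>

definition leech_lattice :: "(real^24) set \<Rightarrow> bool" where
  "leech_lattice \<Lambda> \<longleftrightarrow> full_lattice \<Lambda>
     \<and> (\<forall>x\<in>\<Lambda>. \<exists>k::int. x \<bullet> x = 2 * of_int k)
     \<and> {y. \<forall>x\<in>\<Lambda>. x \<bullet> y \<in> \<int>} = \<Lambda>
     \<and> (\<forall>x\<in>\<Lambda>. x \<bullet> x \<noteq> 2)"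

definition bilinear_cocycle :: "(real^24) set \<Rightarrow> (real^24 \<Rightarrow> real^24 \<Rightarrow> complex) \<Rightarrow> bool" where
  "bilinear_cocycle \<Lambda> \<epsilon> \<longleftrightarrow>
     (\<forall>\<alpha>\<in>\<Lambda>. \<forall>\<beta>\<in>\<Lambda>. \<epsilon> \<alpha> \<beta> \<in> {1, -1} \<and> \<epsilon> \<alpha> \<beta> * \<epsilon> \<beta> \<alpha> = (-1) powi \<lfloor>\<alpha> \<bullet> \<beta>\<rfloor>) \<and>
     (\<forall>\<alpha>\<in>\<Lambda>. \<forall>\<beta>\<in>\<Lambda>. \<forall>\<gamma>\<in>\<Lambda>. \<epsilon> (\<alpha> + \<beta>) \<gamma> = \<epsilon> \<alpha> \<gamma> * \<epsilon> \<beta> \<gamma> \<and> \<epsilon> \<alpha> (\<beta> + \<gamma>) = \<epsilon> \<alpha> \<beta> * \<epsilon> \<alpha> \<gamma>)"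

text \<open>The projective representation on \<open>T\<close>, with a basis of \<open>T\<close> chosen:
  \<open>\<rho> \<alpha>\<close> is the matrix of the operator \<open>e\<^sub>\<alpha>\<close>, and \<open>4096 = 2\<^sup>1\<^sup>2\<close>.\<close>

definition projective_rep ::
  "(real^24) set \<Rightarrow> (real^24 \<Rightarrow> real^24 \<Rightarrow> complex) \<Rightarrow> (real^24 \<Rightarrow> complex^4096^4096) \<Rightarrow> bool" where
  "projective_rep \<Lambda> \<epsilon> \<rho> \<longleftrightarrow>
     (\<forall>\<alpha>\<in>\<Lambda>. \<forall>\<beta>\<in>\<Lambda>. \<rho> \<alpha> ** \<rho> \<beta> = (\<chi> s t. \<epsilon> \<alpha> \<beta> * \<rho> (\<alpha> + \<beta>) $ s $ t)) \<and>
     (\<forall>\<alpha>\<in>\<Lambda>. \<rho> (2 *\<^sub>R \<alpha>) = mat 1)"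

section \<open>Heisenberg algebra and Fock spaces\<close>

text \<open>Let \<open>h\<^sub>i\<close> be the standard orthonormal basis of \<open>\<complex>\<^sup>2\<^sup>4\<close>.  A Fock space is a polynomial ring in
  the commuting variables \<open>h\<^sub>i(-r)\<close>; the variable \<open>h\<^sub>i(-r)\<close>, \<open>r > 0\<close>, is indexed by \<open>(i, r)\<close>.
  Both sectors use this one type: \<open>M(1)\<close> consists of the polynomials whose \<open>r\<close> are positive
  integers, and the symmetric algebra of the twisted sector of those with \<open>r\<close> in
  \<open>{1/2, 3/2, \<dots>}\<close>.\<close>

type_synonym monomial = "(24 \<times> real) \<Rightarrow>\<^sub>0 nat"
type_synonym fock = "monomial \<Rightarrow>\<^sub>0 complex"

definition integer_modes :: "real set" where
  "integer_modes = {r. \<exists>n::nat. r = real n + 1}"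

definition half_modes :: "real set" where
  "half_modes = {r. \<exists>n::nat. r = real n + 1/2}"

definition fock_space :: "real set \<Rightarrow> fock set" where
  "fock_space I = {p. \<forall>m \<in> Poly_Mapping.keys p. \<forall>x \<in> Poly_Mapping.keys m. snd x \<in> I}"

definition const_fock :: "complex \<Rightarrow> fock" where
  "const_fock c = Poly_Mapping.single 0 c"

definition var_fock :: "24 \<times> real \<Rightarrow> fock" where
  "var_fock x = Poly_Mapping.single (Poly_Mapping.single x 1) 1"

definition pdiff_fock :: "24 \<times> real \<Rightarrow> fock \<Rightarrow> fock" where
  "pdiff_fock x p = (\<Sum>m \<in> Poly_Mapping.keys p.
     Poly_Mapping.single (m - Poly_Mapping.single x 1)
       (of_nat (Poly_Mapping.lookup m x) * Poly_Mapping.lookup p m))"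

definition mono_count :: "monomial \<Rightarrow> nat" where
  "mono_count m = (\<Sum>x \<in> Poly_Mapping.keys m. Poly_Mapping.lookup m x)"

definition mono_weight :: "monomial \<Rightarrow> real" where
  "mono_weight m = (\<Sum>x \<in> Poly_Mapping.keys m. snd x * real (Poly_Mapping.lookup m x))"

definition sign_fock :: "fock \<Rightarrow> fock" where
  "sign_fock p = (\<Sum>m \<in> Poly_Mapping.keys p.
     Poly_Mapping.single m ((-1) ^ mono_count m * Poly_Mapping.lookup p m))"

definition complexify :: "real^24 \<Rightarrow> complex^24" where
  "complexify \<alpha> = (\<chi> i. complex_of_real (\<alpha> $ i))"

text \<open>\<open>heis \<alpha> h r\<close> is the operator \<open>h(r)\<close> at level 1.  The lattice vector \<open>\<alpha>\<close> only enters through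
  the zero mode \<open>h(0) = \<langle>h, \<alpha>\<rangle>\<close> on \<open>M(1) \<otimes> e\<^sup>\<alpha>\<close>.\<close>

definition heis :: "real^24 \<Rightarrow> complex^24 \<Rightarrow> real \<Rightarrow> fock \<Rightarrow> fock" where
  "heis \<alpha> h r p =
     (if r < 0 then (\<Sum>i\<in>UNIV. const_fock (h $ i) * var_fock (i, -r)) * p
      else if r = 0 then const_fock (\<Sum>i\<in>UNIV. h $ i * complexify \<alpha> $ i) * p
      else (\<Sum>i\<in>UNIV. const_fock (complex_of_real r * h $ i) * pdiff_fock (i, r) p))"

section \<open>Exponentials of operator-valued series\<close>

text \<open>\<open>A :: nat \<Rightarrow> fock \<Rightarrow> fock\<close> stands for \<open>\<Sum>k. A k w\<^sup>k\<close>.  Truncating the exponential series of the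
  \<open>k\<close>-th coefficient at \<open>j \<le> k\<close> is exact when \<open>A 0 = 0\<close>.\<close>

definition ser_mult :: "(nat \<Rightarrow> fock \<Rightarrow> fock) \<Rightarrow> (nat \<Rightarrow> fock \<Rightarrow> fock) \<Rightarrow> nat \<Rightarrow> fock \<Rightarrow> fock" where
  "ser_mult A B k p = (\<Sum>i\<le>k. A i (B (k - i) p))"

primrec ser_power :: "(nat \<Rightarrow> fock \<Rightarrow> fock) \<Rightarrow> nat \<Rightarrow> nat \<Rightarrow> fock \<Rightarrow> fock" where
  "ser_power A 0 = (\<lambda>k p. if k = 0 then p else 0)"
| "ser_power A (Suc j) = ser_mult A (ser_power A j)"

definition ser_exp :: "(nat \<Rightarrow> fock \<Rightarrow> fock) \<Rightarrow> nat \<Rightarrow> fock \<Rightarrow> fock" where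
  "ser_exp A k p = (\<Sum>j\<le>k. const_fock (1 / fact j) * ser_power A j k p)"

text \<open>\<open>exp (\<Sum>\<^sub>r\<^sub>\<in>\<^sub>I h(-r)/(-r) z\<^sup>r)\<close> and \<open>exp (\<Sum>\<^sub>r\<^sub>\<in>\<^sub>I h(r)/r z\<^sup>-\<^sup>r)\<close>: the \<open>k\<close>-th coefficient belongs to
  \<open>z\<close> to the power \<open>k/2\<close>, respectively \<open>-k/2\<close>.\<close>

definition E_minus :: "real set \<Rightarrow> complex^24 \<Rightarrow> nat \<Rightarrow> fock \<Rightarrow> fock" where
  "E_minus I h = ser_exp (\<lambda>k p. if real k / 2 \<in> I
     then const_fock (1 / (- (of_nat k / 2))) * heis 0 h (- (real k / 2)) p else 0)"

definition E_plus :: "real set \<Rightarrow> complex^24 \<Rightarrow> nat \<Rightarrow> fock \<Rightarrow> fock" where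
  "E_plus I h = ser_exp (\<lambda>k p. if real k / 2 \<in> I
     then const_fock (1 / (of_nat k / 2)) * heis 0 h (real k / 2) p else 0)"

text \<open>The coefficient of \<open>z\<^sup>r\<close> in the product of the two series, applied to \<open>p\<close>.\<close>

definition E_coeff :: "real set \<Rightarrow> complex^24 \<Rightarrow> real \<Rightarrow> fock \<Rightarrow> fock" where
  "E_coeff I h r p = Sum_any (\<lambda>(a, b).
     if real a / 2 - real b / 2 = r then E_minus I h a (E_plus I h b p) else 0)"

section \<open>The moonshine module\<close>

text \<open>Elements of \<open>M(1) \<otimes> \<complex>[\<Lambda>]\<close> are written as finite sums of \<open>p \<otimes> e\<^sup>\<alpha>\<close>, elements of the twisted
  module as finite sums of \<open>p \<otimes> s\<close> with \<open>s\<close> in the chosen basis of \<open>T\<close>.  The type \<open>moonshine\<close>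
  is an ambient space; the module itself is the set \<open>moonshine_module \<Lambda>\<close> below.\<close>

type_synonym group_algebra = "(real^24) \<Rightarrow>\<^sub>0 complex"
type_synonym moonshine = "((real^24) \<Rightarrow>\<^sub>0 fock) \<times> (4096 \<Rightarrow>\<^sub>0 fock)"

definition scale_state :: "complex \<Rightarrow> ('l \<Rightarrow>\<^sub>0 fock) \<Rightarrow> ('l \<Rightarrow>\<^sub>0 fock)" where
  "scale_state c u = Poly_Mapping.map (\<lambda>p. const_fock c * p) u"

definition scale_moonshine :: "complex \<Rightarrow> moonshine \<Rightarrow> moonshine" where
  "scale_moonshine c v = (scale_state c (fst v), scale_state c (snd v))"

lemma lookup_scale_state:
  "Poly_Mapping.lookup (scale_state c u) x = const_fock c * Poly_Mapping.lookup u x"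
  by (simp add: scale_state_def Poly_Mapping.map.rep_eq when_def)

lemma const_fock_add: "const_fock (a + b) = const_fock a + const_fock b"
  by (simp add: const_fock_def single_add)

lemma const_fock_mult: "const_fock (a * b) = const_fock a * const_fock b"
  by (simp add: const_fock_def mult_single)

lemma const_fock_1: "const_fock 1 = 1"
  by (simp add: const_fock_def)

interpretation mspace: vector_space scale_moonshine
  by unfold_locales
    (auto simp: scale_moonshine_def lookup_scale_state lookup_add const_fock_add const_fock_mult
      const_fock_1 algebra_simps intro!: poly_mapping_eqI prod_eqI)

definition t_untwisted :: "((real^24) \<Rightarrow>\<^sub>0 fock) \<Rightarrow> ((real^24) \<Rightarrow>\<^sub>0 fock)" where
  "t_untwisted u = (\<Sum>\<alpha> \<in> Poly_Mapping.keys u.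
     Poly_Mapping.single (-\<alpha>) (sign_fock (Poly_Mapping.lookup u \<alpha>)))"

definition t_twisted :: "(4096 \<Rightarrow>\<^sub>0 fock) \<Rightarrow> (4096 \<Rightarrow>\<^sub>0 fock)" where
  "t_twisted w = (\<Sum>s \<in> Poly_Mapping.keys w.
     Poly_Mapping.single s (- sign_fock (Poly_Mapping.lookup w s)))"

definition lattice_voa :: "(real^24) set \<Rightarrow> ((real^24) \<Rightarrow>\<^sub>0 fock) set" where
  "lattice_voa \<Lambda> = {u. Poly_Mapping.keys u \<subseteq> \<Lambda> \<and>
     (\<forall>\<alpha>. Poly_Mapping.lookup u \<alpha> \<in> fock_space integer_modes)}"

definition twisted_module :: "(4096 \<Rightarrow>\<^sub>0 fock) set" where
  "twisted_module = {w. \<forall>s. Poly_Mapping.lookup w s \<in> fock_space half_modes}"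

definition moonshine_module :: "(real^24) set \<Rightarrow> moonshine set" where
  "moonshine_module \<Lambda> = {u \<in> lattice_voa \<Lambda>. t_untwisted u = u} \<times> {w \<in> twisted_module. t_twisted w = w}"

definition moonshine_graded :: "(real^24) set \<Rightarrow> nat \<Rightarrow> moonshine set" where
  "moonshine_graded \<Lambda> n = {(u, w) \<in> moonshine_module \<Lambda>.
     (\<forall>\<alpha>. \<forall>m \<in> Poly_Mapping.keys (Poly_Mapping.lookup u \<alpha>). mono_weight m + (\<alpha> \<bullet> \<alpha>) / 2 = real n) \<and>
     (\<forall>s. \<forall>m \<in> Poly_Mapping.keys (Poly_Mapping.lookup w s). mono_weight m + 3 / 2 = real n)}"

section \<open>Virasoro operators\<close>

definition normal_ordered :: "real^24 \<Rightarrow> complex^24 \<Rightarrow> real \<Rightarrow> real \<Rightarrow> fock \<Rightarrow> fock" where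
  "normal_ordered \<alpha> h r s p =
     (if r \<le> s then heis \<alpha> h r (heis \<alpha> h s p) else heis \<alpha> h s (heis \<alpha> h r p))"

text \<open>\<open>(1/2) \<Sum>\<^sub>i \<Sum>\<^sub>r :h\<^sub>i(r) h\<^sub>i(n-r):\<close>, with \<open>r\<close> running over \<open>\<int> + \<delta>\<close>.\<close>

definition sugawara :: "real^24 \<Rightarrow> real \<Rightarrow> int \<Rightarrow> fock \<Rightarrow> fock" where
  "sugawara \<alpha> \<delta> n p = (\<Sum>i\<in>UNIV. Sum_any (\<lambda>m::int. const_fock (1 / 2) *
     normal_ordered \<alpha> (axis i 1) (of_int m + \<delta>) (of_int n - (of_int m + \<delta>)) p))"

text \<open>\<open>L(n)\<close> for the conformal vector \<open>(1/2) \<Sum>\<^sub>i h\<^sub>i(-1)\<^sup>2\<close>; on the twisted module its modes contain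
  the vacuum energy \<open>24/16 = 3/2\<close>.\<close>

definition virasoro :: "int \<Rightarrow> moonshine \<Rightarrow> moonshine" where
  "virasoro n v =
     (\<Sum>\<alpha> \<in> Poly_Mapping.keys (fst v). Poly_Mapping.single \<alpha>
        (sugawara \<alpha> 0 n (Poly_Mapping.lookup (fst v) \<alpha>)),
      \<Sum>s \<in> Poly_Mapping.keys (snd v). Poly_Mapping.single s
        (sugawara 0 (1 / 2) n (Poly_Mapping.lookup (snd v) s) +
         (if n = 0 then const_fock (3 / 2) * Poly_Mapping.lookup (snd v) s else 0)))"

definition highest_weight_vector :: "(real^24) set \<Rightarrow> complex \<Rightarrow> moonshine \<Rightarrow> bool" where
  "highest_weight_vector \<Lambda> k v \<longleftrightarrow> v \<in> moonshine_module \<Lambda> \<and>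
     (\<forall>n>0. virasoro n v = 0) \<and> virasoro 0 v = scale_moonshine k v"

section \<open>Vertex operators\<close>

text \<open>The coefficient of \<open>z\<^sup>r\<close> in \<open>Y(e\<^sup>\<alpha>, z)\<close> on the lattice vertex operator algebra and on the
  twisted module.\<close>

definition Y_untwisted ::
  "(real^24 \<Rightarrow> real^24 \<Rightarrow> complex) \<Rightarrow> real^24 \<Rightarrow> real \<Rightarrow> ((real^24) \<Rightarrow>\<^sub>0 fock) \<Rightarrow> ((real^24) \<Rightarrow>\<^sub>0 fock)" where
  "Y_untwisted \<epsilon> \<alpha> r u = (\<Sum>\<beta> \<in> Poly_Mapping.keys u. Poly_Mapping.single (\<alpha> + \<beta>)
     (const_fock (\<epsilon> \<alpha> \<beta>) *
        E_coeff integer_modes (complexify (-\<alpha>)) (r - \<alpha> \<bullet> \<beta>) (Poly_Mapping.lookup u \<beta>)))"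

definition Y_twisted ::
  "(real^24 \<Rightarrow> complex^4096^4096) \<Rightarrow> real^24 \<Rightarrow> real \<Rightarrow> (4096 \<Rightarrow>\<^sub>0 fock) \<Rightarrow> (4096 \<Rightarrow>\<^sub>0 fock)" where
  "Y_twisted \<rho> \<beta> r w = (\<Sum>s \<in> Poly_Mapping.keys w. \<Sum>t\<in>UNIV. Poly_Mapping.single t
     (const_fock (complex_of_real (2 powr (- (\<beta> \<bullet> \<beta>))) * \<rho> \<beta> $ t $ s) *
        E_coeff half_modes (complexify (-\<beta>)) (r + (\<beta> \<bullet> \<beta>) / 2) (Poly_Mapping.lookup w s)))"

text \<open>Vertex operators are defined only for vectors of \<open>1 \<otimes> \<complex>[\<Lambda>]\<close>, by linear extension
  from the \<open>e\<^sup>\<alpha>\<close>.  The mode \<open>v(n)\<close> is the coefficient of \<open>z\<close> to the power \<open>-n-1\<close>.\<close>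

definition vertex_mode ::
  "(real^24 \<Rightarrow> real^24 \<Rightarrow> complex) \<Rightarrow> (real^24 \<Rightarrow> complex^4096^4096) \<Rightarrow> group_algebra \<Rightarrow> int
     \<Rightarrow> moonshine \<Rightarrow> moonshine" where
  "vertex_mode \<epsilon> \<rho> v n x = (\<Sum>\<alpha> \<in> Poly_Mapping.keys v. scale_moonshine (Poly_Mapping.lookup v \<alpha>)
     (Y_untwisted \<epsilon> \<alpha> (- of_int n - 1) (fst x), Y_twisted \<rho> \<alpha> (- of_int n - 1) (snd x)))"

definition to_moonshine :: "group_algebra \<Rightarrow> moonshine" where
  "to_moonshine v = (Poly_Mapping.map const_fock v, 0)"

definition weight :: "(real^24) set \<Rightarrow> moonshine \<Rightarrow> nat" where
  "weight \<Lambda> v = (THE n. v \<in> moonshine_graded \<Lambda> n)"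

definition zero_mode ::
  "(real^24) set \<Rightarrow> (real^24 \<Rightarrow> real^24 \<Rightarrow> complex) \<Rightarrow> (real^24 \<Rightarrow> complex^4096^4096) \<Rightarrow> group_algebra
     \<Rightarrow> moonshine \<Rightarrow> moonshine" where
  "zero_mode \<Lambda> \<epsilon> \<rho> v = vertex_mode \<epsilon> \<rho> v (int (weight \<Lambda> (to_moonshine v)) - 1)"

definition v_vec :: "real^24 \<Rightarrow> group_algebra" where
  "v_vec \<alpha> = Poly_Mapping.single \<alpha> 1 + Poly_Mapping.single (-\<alpha>) 1"

section \<open>Graded traces\<close>

definition trace_on :: "moonshine set \<Rightarrow> (moonshine \<Rightarrow> moonshine) \<Rightarrow> complex" where
  "trace_on W f = (let B = (SOME B. mspace.independent B \<and> mspace.span B = W)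
     in \<Sum>b\<in>B. mspace.representation B (f b) b)"

definition graded_trace ::
  "(real^24) set \<Rightarrow> (real^24 \<Rightarrow> real^24 \<Rightarrow> complex) \<Rightarrow> (real^24 \<Rightarrow> complex^4096^4096) \<Rightarrow> group_algebra
     \<Rightarrow> nat \<Rightarrow> complex" where
  "graded_trace \<Lambda> \<epsilon> \<rho> v n = trace_on (moonshine_graded \<Lambda> n) (zero_mode \<Lambda> \<epsilon> \<rho> v)"

text \<open>\<open>q_pow a \<tau>\<close> is \<open>q\<^sup>a\<close> for \<open>q = exp (2 \<pi> \<i> \<tau>)\<close>, with the usual choice of fractional powers.\<close>

definition q_pow :: "real \<Rightarrow> complex \<Rightarrow> complex" where
  "q_pow a \<tau> = exp (2 * of_real pi * \<i> * of_real a * \<tau>)"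

definition Z ::
  "(real^24) set \<Rightarrow> (real^24 \<Rightarrow> real^24 \<Rightarrow> complex) \<Rightarrow> (real^24 \<Rightarrow> complex^4096^4096) \<Rightarrow> group_algebra
     \<Rightarrow> complex \<Rightarrow> complex" where
  "Z \<Lambda> \<epsilon> \<rho> v \<tau> = q_pow (-1) \<tau> * suminf (\<lambda>n. graded_trace \<Lambda> \<epsilon> \<rho> v n * q_pow (real n) \<tau>)"

section \<open>Eta and theta functions\<close>

definition eta :: "complex \<Rightarrow> complex" where
  "eta \<tau> = q_pow (1 / 24) \<tau> * prodinf (\<lambda>n. 1 - q_pow (real n + 1) \<tau>)"

definition Theta1 :: "complex \<Rightarrow> complex" where
  "Theta1 \<tau> = 2 * q_pow (1 / 8) \<tau> *
     prodinf (\<lambda>n. (1 - q_pow (real n + 1) \<tau>) * (1 + q_pow (real n + 1) \<tau>)\<^sup>2)"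

definition Theta2 :: "complex \<Rightarrow> complex" where
  "Theta2 \<tau> = prodinf (\<lambda>n. (1 - q_pow (real n + 1) \<tau>) * (1 - q_pow (real n + 1 / 2) \<tau>)\<^sup>2)"

definition Theta3 :: "complex \<Rightarrow> complex" where
  "Theta3 \<tau> = prodinf (\<lambda>n. (1 - q_pow (real n + 1) \<tau>) * (1 + q_pow (real n + 1 / 2) \<tau>)\<^sup>2)"

end

theory Submission
  imports Defs
begin

text \<open>
  Since \<open>o(v(\<lambda>))\<close> commutes with \<open>t\<close>, its trace on the fixed points is the trace of its composition with
  \<open>(1 + t)/2\<close> on the whole space.  In the untwisted sector \<open>o(e\<^sup>\<lambda>)\<close> shifts \<open>e\<^sup>\<beta>\<close> to \<open>e\<^bsup>\<beta>+\<lambda>\<^esup>\<close> and \<open>t\<close> maps this to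
  \<open>e\<^bsup>-\<beta>-\<lambda>\<^esup>\<close>, so that only \<open>\<beta> = \<plusminus>\<lambda>/2\<close> contributes; in the twisted sector \<open>e\<^sub>\<lambda>\<close> acts as the identity.
  What remains are traces of \<open>E\<^sup>-(-\<lambda>, z) E\<^sup>+(-\<lambda>, z)\<close> at \<open>z\<^sup>0\<close> over Fock spaces.  These factor over the
  oscillators: on one oscillator \<open>x\<close> the operator \<open>exp (c x) exp (d \<partial>\<^sub>x)\<close> has the diagonal entries
  \<open>\<Sum>\<^sub>j (n choose j) (c d)\<^sup>j / j!\<close>, Laguerre polynomials with generating function
  \<open>exp (c d y/(1 - y)) / (1 - y)\<close>.  The products over all oscillators are expressed by
  \<open>P(w) = \<Prod> (1 - w\<^sup>n)\<close> through \<open>\<Sum> (1/n) w\<^sup>n/(1 - w\<^sup>n) = - log P(w)\<close>: with \<open>w\<^sup>n/(1 + w\<^sup>n)\<close> in place of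
  \<open>w\<^sup>n/(1 - w\<^sup>n)\<close>, or with odd \<open>n\<close> only, the sum is a combination of \<open>log P(w)\<close> and \<open>log P(w\<^sup>2)\<close>, and so are
  the logarithms of the theta functions.
\<close>

section \<open>Linear operators and exponential series on Fock space\<close>

text \<open>The 12 has two sources. Each mode carries a factor \<open>(1 - y)\<close> to the power
  -24 from the 24 coordinates; together with twelve of the \<langle>\<lambda>,\<lambda>\<rangle>
  equal theta quotients from the exponentials it collapses to P(q)^12, the product part of eta^12.
  In the twisted sector dim T = 2^12 reduces 2^(-\<langle>\<lambda>,\<lambda>\<rangle>) to
  2^(-(\<langle>\<lambda>,\<lambda>\<rangle> - 12)), which is the halving of Theta2 and Theta3. The
  minus sign of Theta3 comes from t = -1 on T: on the oscillators t replaces q^(1/2) by -q^(1/2),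
  which turns Theta2 into Theta3. A nonzero \<lambda> in 2\<Lambda> has
  \<langle>\<lambda>,\<lambda>\<rangle> at least 16, because \<Lambda> has no vectors of norm 2, so
  all exponents are natural numbers. The obstacle is that \<open>trace_on\<close> refers to an
  arbitrary basis of the fixed points, while (1 + t)/2 maps the monomial basis to a family with
  repetitions and zeros. The trace is therefore computed from a spanning family and a choice of
  linear coordinates. The interchange of sums over monomials with products over infinitely many
  oscillators rests on absolute convergence.\<close>

declare One_nat_def [simp del]

abbreviation "lookup \<equiv> Poly_Mapping.lookup"
abbreviation "keys \<equiv> Poly_Mapping.keys"
abbreviation "single \<equiv> Poly_Mapping.single"

lemma sum_keys_superset:
  assumes "finite S" "keys p \<subseteq> S" "\<And>m. g m 0 = 0"
  shows "(\<Sum>m\<in>keys p. g m (lookup p m)) = (\<Sum>m\<in>S. g m (lookup p m))"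
  by (rule sum.mono_neutral_left) (use assms in \<open>auto simp: in_keys_iff\<close>)

lemma prod_keys_superset:
  assumes "finite S" "keys p \<subseteq> S" "\<And>m. g m 0 = 1"
  shows "(\<Prod>m\<in>keys p. g m (lookup p m)) = (\<Prod>m\<in>S. g m (lookup p m))"
  by (rule prod.mono_neutral_left) (use assms in \<open>auto simp: in_keys_iff\<close>)

lemma poly_mapping_sum_single: "(\<Sum>m\<in>keys p. single m (lookup p m)) = p"
  by (rule poly_mapping_eqI)
    (auto simp: lookup_sum lookup_single when_def sum.delta in_keys_iff)

lemma lookup_const_fock_mult [simp]: "lookup (const_fock c * p) m = c * lookup p m"
proof -
  have "const_fock c * p = Poly_Mapping.map ((*) c) p"
    by (simp add: const_fock_def mult_map_scale_conv_mult)
  then show ?thesis by (simp add: Poly_Mapping.map.rep_eq when_def)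
qed

lemma const_fock_0 [simp]: "const_fock 0 = 0"
  by (simp add: const_fock_def)

lemma const_fock_mult_single: "const_fock c * single m d = single m (c * d)"
  by (simp add: const_fock_def mult_single)

lemma const_fock_mult_assoc: "const_fock c * (const_fock d * p) = const_fock (c * d) * p"
  by (simp add: const_fock_mult mult.assoc)

lemma const_fock_sum: "const_fock (sum f S) = (\<Sum>x\<in>S. const_fock (f x))"
  by (induction S rule: infinite_finite_induct) (auto simp: const_fock_add)

definition flinear :: "(fock \<Rightarrow> fock) \<Rightarrow> bool" where
  "flinear L \<longleftrightarrow> (\<forall>p q. L (p + q) = L p + L q) \<and> (\<forall>c p. L (const_fock c * p) = const_fock c * L p)"

lemma flinearI:
  "(\<And>p q. L (p + q) = L p + L q) \<Longrightarrow> (\<And>c p. L (const_fock c * p) = const_fock c * L p) \<Longrightarrow> flinear L"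
  by (simp add: flinear_def)

lemma flinear_add: "flinear L \<Longrightarrow> L (p + q) = L p + L q"
  and flinear_scale: "flinear L \<Longrightarrow> L (const_fock c * p) = const_fock c * L p"
  by (auto simp: flinear_def)

lemma flinear_0: "flinear L \<Longrightarrow> L 0 = 0"
  using flinear_scale[of L 0 0] by simp

lemma flinear_sum: "flinear L \<Longrightarrow> L (sum f S) = (\<Sum>x\<in>S. L (f x))"
  by (induction S rule: infinite_finite_induct) (auto simp: flinear_add flinear_0)

lemma flinear_id: "flinear (\<lambda>p. p)"
  by (simp add: flinear_def)

lemma flinear_const: "flinear L \<Longrightarrow> flinear (\<lambda>p. const_fock c * L p)"
  by (auto simp: flinear_def algebra_simps)

lemma flinear_mult: "flinear ((*) p)"
  by (auto simp: flinear_def algebra_simps)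

lemma flinear_compose: "flinear L \<Longrightarrow> flinear K \<Longrightarrow> flinear (\<lambda>p. L (K p))"
  by (auto simp: flinear_def)

lemma flinear_sumI: "(\<And>x. x \<in> S \<Longrightarrow> flinear (L x)) \<Longrightarrow> flinear (\<lambda>p. \<Sum>x\<in>S. L x p)"
  by (auto simp: flinear_def sum.distrib sum_distrib_left)

lemma flinear_expand:
  assumes "flinear L"
  shows "L p = (\<Sum>m\<in>keys p. const_fock (lookup p m) * L (single m 1))"
proof -
  have "L p = L (\<Sum>m\<in>keys p. const_fock (lookup p m) * single m 1)"
    by (simp add: const_fock_mult_single poly_mapping_sum_single)
  also have "\<dots> = (\<Sum>m\<in>keys p. L (const_fock (lookup p m) * single m 1))"
    by (rule flinear_sum[OF assms])
  also have "\<dots> = (\<Sum>m\<in>keys p. const_fock (lookup p m) * L (single m 1))"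
    by (simp add: flinear_scale[OF assms])
  finally show ?thesis .
qed

lemma flinear_eqI:
  assumes "flinear L" "flinear K" "\<And>m. L (single m 1) = K (single m 1)"
  shows "L p = K p"
  unfolding flinear_expand[OF assms(1), of p] flinear_expand[OF assms(2), of p] assms(3) ..

text \<open>\<open>pdiff_fock\<close>, \<open>sign_fock\<close> and the iterated derivatives all
  have this form, so their linearity is proved once.\<close>

definition lin_ext :: "(monomial \<Rightarrow> fock) \<Rightarrow> fock \<Rightarrow> fock" where
  "lin_ext F p = (\<Sum>m\<in>keys p. const_fock (lookup p m) * F m)"

lemma flinear_lin_ext: "flinear (lin_ext F)"
proof (rule flinearI)
  fix p q
  show "lin_ext F (p + q) = lin_ext F p + lin_ext F q"
    unfolding lin_ext_def
    by (rule setsum_keys_plus_distrib) (auto simp: const_fock_add algebra_simps)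
next
  fix c p
  have "keys (const_fock c * p) \<subseteq> keys p" by (auto simp: in_keys_iff)
  then have "lin_ext F (const_fock c * p) = (\<Sum>m\<in>keys p. const_fock (lookup (const_fock c * p) m) * F m)"
    unfolding lin_ext_def by (intro sum_keys_superset) auto
  then show "lin_ext F (const_fock c * p) = const_fock c * lin_ext F p"
    by (simp add: lin_ext_def sum_distrib_left const_fock_mult_assoc)
qed

lemma lin_ext_single [simp]: "lin_ext F (single m 1) = F m"
  by (simp add: lin_ext_def const_fock_1)

text \<open>The truncated subtraction of exponents is harmless: where it truncates, the coefficient
  \<open>lookup m x\<close> is 0.\<close>

lemma pdiff_fock_lin_ext:
  "pdiff_fock x = lin_ext (\<lambda>m. single (m - single x 1) (of_nat (lookup m x)))"
  by (rule ext) (simp add: pdiff_fock_def lin_ext_def const_fock_mult_single mult.commute)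

lemma sign_fock_lin_ext: "sign_fock = lin_ext (\<lambda>m. single m ((-1) ^ mono_count m))"
  by (rule ext) (simp add: sign_fock_def lin_ext_def const_fock_mult_single mult.commute)

lemma flinear_sign_fock: "flinear sign_fock"
  by (simp add: sign_fock_lin_ext flinear_lin_ext)

lemma flinear_pdiff_fock: "flinear (pdiff_fock x)"
  by (simp add: pdiff_fock_lin_ext flinear_lin_ext)

lemma sign_fock_single: "sign_fock (single m c) = single m ((-1) ^ mono_count m * c)"
  by (cases "c = 0") (auto simp: sign_fock_def)

lemma mono_count_add: "mono_count (M + N) = mono_count M + mono_count N"
  unfolding mono_count_def by (rule setsum_keys_plus_distrib) auto

lemma mono_weight_add: "mono_weight (M + N) = mono_weight M + mono_weight N"
  unfolding mono_weight_def
  by (rule setsum_keys_plus_distrib[where f = "\<lambda>x n. snd x * real n"]) (auto simp: algebra_simps)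

lemma mono_count_single [simp]: "mono_count (single x n) = n"
  by (cases "n = 0") (auto simp: mono_count_def)

lemma mono_weight_single [simp]: "mono_weight (single x n) = snd x * real n"
  by (cases "n = 0") (auto simp: mono_weight_def)

lemma mono_count_0 [simp]: "mono_count 0 = 0" and mono_weight_0 [simp]: "mono_weight 0 = 0"
  by (auto simp: mono_count_def mono_weight_def)

lemma keys_add_nat: "keys (M + N :: 'a \<Rightarrow>\<^sub>0 nat) = keys M \<union> keys N"
  by (auto simp: in_keys_iff lookup_add)

lemma sub_add_cancel_le:
  fixes m M :: "'a \<Rightarrow>\<^sub>0 nat"
  assumes "\<And>x. lookup M x \<le> lookup m x"
  shows "(m - M) + M = m"
  by (rule poly_mapping_eqI) (use assms in \<open>simp add: lookup_add lookup_minus\<close>)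

section \<open>Monomials graded by weight\<close>

definition mode_monos :: "real set \<Rightarrow> monomial set" where
  "mode_monos I = {m. \<forall>x\<in>keys m. snd x \<in> I}"

definition weight_monos :: "real set \<Rightarrow> real \<Rightarrow> monomial set" where
  "weight_monos I w = {m \<in> mode_monos I. mono_weight m = w}"

text \<open>Contains the modes of both sectors, and its elements \<open>k / 2\<close> match the
  indexing of powers of z in \<open>E_minus\<close> and \<open>E_plus\<close>; everything proved for
  subsets of it serves both sectors.\<close>

definition positive_half_integers :: "real set" where
  "positive_half_integers = {r. \<exists>k::nat. k > 0 \<and> r = real k / 2}"

text \<open>Every mode is at least 1/2. The bound makes the sets of given weight finite and shows
  that the truncation in \<open>ser_exp\<close> is exact.\<close>

lemma mono_count_le_weight:
  assumes "I \<subseteq> positive_half_integers" "m \<in> mode_monos I"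
  shows "real (mono_count m) \<le> 2 * mono_weight m"
proof -
  have "real (mono_count m) = (\<Sum>x\<in>keys m. real (lookup m x))" by (simp add: mono_count_def)
  also have "\<dots> \<le> (\<Sum>x\<in>keys m. 2 * (snd x * real (lookup m x)))"
  proof (rule sum_mono)
    fix x assume "x \<in> keys m"
    then have "1 \<le> 2 * snd x"
      using assms by (force simp: positive_half_integers_def mode_monos_def)
    then show "real (lookup m x) \<le> 2 * (snd x * real (lookup m x))"
      using mult_right_mono[of 1 "2 * snd x" "real (lookup m x)"] by simp
  qed
  also have "\<dots> = 2 * mono_weight m" by (simp add: mono_weight_def sum_distrib_left)
  finally show ?thesis .
qed

lemma snd_le_mono_weight:
  assumes "I \<subseteq> positive_half_integers" "m \<in> mode_monos I" "x \<in> keys m"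
  shows "snd x \<le> mono_weight m"
proof -
  have pos: "0 < snd y" if "y \<in> keys m" for y
    using assms that by (force simp: positive_half_integers_def mode_monos_def)
  have "snd x \<le> snd x * real (lookup m x)"
    using pos[OF assms(3)] assms(3) by (simp add: in_keys_iff)
  also have "\<dots> \<le> mono_weight m"
    unfolding mono_weight_def using assms(3) pos
    by (intro member_le_sum mult_nonneg_nonneg less_imp_le[OF pos]) auto
  finally show ?thesis .
qed

text \<open>Transfers distributivity of products over sums, which the library states for extensional
  functions, to monomials; used for finite sums and for infinite ones.\<close>

lemma bij_betw_lookup_PiE:
  fixes X :: "'a set"
  assumes "finite X"
  shows "bij_betw (\<lambda>M. restrict (lookup M) X)
           {M :: 'a \<Rightarrow>\<^sub>0 nat. keys M \<subseteq> X \<and> (\<forall>x\<in>X. lookup M x \<in> B x)} (PiE X B)"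
proof (rule bij_betwI[where g = "\<lambda>f. Abs_poly_mapping (\<lambda>x. if x \<in> X then f x else 0)"])
  have fin: "finite {x. (if x \<in> X then f x else 0) \<noteq> (0::nat)}" for f
    by (rule finite_subset[OF _ assms]) auto
  show "(\<lambda>M. restrict (lookup M) X) \<in>
      {M. keys M \<subseteq> X \<and> (\<forall>x\<in>X. lookup M x \<in> B x)} \<rightarrow> PiE X B"
    by auto
  show "(\<lambda>f. Abs_poly_mapping (\<lambda>x. if x \<in> X then f x else 0)) \<in>
      PiE X B \<rightarrow> {M. keys M \<subseteq> X \<and> (\<forall>x\<in>X. lookup M x \<in> B x)}"
    by (auto simp: in_keys_iff lookup_Abs_poly_mapping[OF fin] split: if_splits)
  show "Abs_poly_mapping (\<lambda>x. if x \<in> X then restrict (lookup M) X x else 0) = M"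
    if "M \<in> {M. keys M \<subseteq> X \<and> (\<forall>x\<in>X. lookup M x \<in> B x)}" for M
  proof (rule poly_mapping_eqI)
    fix y show "lookup (Abs_poly_mapping (\<lambda>x. if x \<in> X then restrict (lookup M) X x else 0)) y = lookup M y"
      using that in_keys_iff[of y M] by (subst lookup_Abs_poly_mapping[OF fin]) auto
  qed
  show "restrict (lookup (Abs_poly_mapping (\<lambda>x. if x \<in> X then f x else 0))) X = f"
    if "f \<in> PiE X B" for f
  proof
    fix y show "restrict (lookup (Abs_poly_mapping (\<lambda>x. if x \<in> X then f x else 0))) X y = f y"
      using that by (subst lookup_Abs_poly_mapping[OF fin]) (auto simp: restrict_def PiE_def extensional_def)
  qed
qed

lemma sum_prod_lookup:
  fixes g :: "'a \<Rightarrow> nat \<Rightarrow> 'b :: comm_semiring_1"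
  assumes "finite X" "\<And>x. x \<in> X \<Longrightarrow> finite (B x)"
  shows "(\<Sum>M | keys M \<subseteq> X \<and> (\<forall>x\<in>X. lookup M x \<in> B x). \<Prod>x\<in>X. g x (lookup M x)) =
    (\<Prod>x\<in>X. \<Sum>n\<in>B x. g x n)"
proof -
  have "(\<Sum>M | keys M \<subseteq> X \<and> (\<forall>x\<in>X. lookup M x \<in> B x). \<Prod>x\<in>X. g x (restrict (lookup M) X x)) =
    (\<Sum>f\<in>PiE X B. \<Prod>x\<in>X. g x (f x))"
    by (rule sum.reindex_bij_betw[OF bij_betw_lookup_PiE[OF assms(1)]])
  then show ?thesis using assms by (simp add: prod_sum_PiE)
qed

lemma finite_bounded_monomials:
  fixes f :: "'a \<Rightarrow> nat"
  assumes "finite X"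
  shows "finite {m :: 'a \<Rightarrow>\<^sub>0 nat. keys m \<subseteq> X \<and> (\<forall>x. lookup m x \<le> f x)}"
proof (rule finite_subset)
  show "{m. keys m \<subseteq> X \<and> (\<forall>x. lookup m x \<le> f x)} \<subseteq>
      {m. keys m \<subseteq> X \<and> (\<forall>x\<in>X. lookup m x \<in> {..f x})}" by auto
  show "finite {m :: 'a \<Rightarrow>\<^sub>0 nat. keys m \<subseteq> X \<and> (\<forall>x\<in>X. lookup m x \<in> {..f x})}"
    using bij_betw_finite[OF bij_betw_lookup_PiE[OF assms, of "\<lambda>x. {..f x}"]] assms
    by (simp add: finite_PiE)
qed

text \<open>Only modes up to \<open>w\<close> can occur, each with multiplicity at most
  \<open>2 * w\<close>.\<close>

lemma finite_weight_monos:
  assumes I: "I \<subseteq> positive_half_integers"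
  shows "finite (weight_monos I w)"
proof -
  let ?J = "{r \<in> positive_half_integers. r \<le> w}"
  have "?J \<subseteq> (\<lambda>k. real k / 2) ` {..nat \<lceil>2 * w\<rceil>}"
  proof
    fix r assume "r \<in> ?J"
    then obtain k :: nat where k: "r = real k / 2" "r \<le> w" by (auto simp: positive_half_integers_def)
    then have "k \<le> nat \<lceil>2 * w\<rceil>" by linarith
    with k show "r \<in> (\<lambda>k. real k / 2) ` {..nat \<lceil>2 * w\<rceil>}" by auto
  qed
  then have J: "finite ?J" by (rule finite_subset) auto
  have "weight_monos I w \<subseteq> {m. keys m \<subseteq> UNIV \<times> ?J \<and> (\<forall>x. lookup m x \<le> nat \<lceil>2 * w\<rceil>)}"
  proof
    fix m assume m: "m \<in> weight_monos I w"
    then have mI: "m \<in> mode_monos I" and w: "mono_weight m = w" by (auto simp: weight_monos_def)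
    have "lookup m x \<le> nat \<lceil>2 * w\<rceil>" for x
    proof (cases "x \<in> keys m")
      case True
      then have "lookup m x \<le> mono_count m" unfolding mono_count_def by (intro member_le_sum) auto
      then show ?thesis using mono_count_le_weight[OF I mI] w by linarith
    qed (simp add: in_keys_iff)
    moreover have "x \<in> UNIV \<times> ?J" if "x \<in> keys m" for x
      using snd_le_mono_weight[OF I mI that] that mI w I by (cases x) (auto simp: mode_monos_def)
    ultimately show "m \<in> {m. keys m \<subseteq> UNIV \<times> ?J \<and> (\<forall>x. lookup m x \<le> nat \<lceil>2 * w\<rceil>)}"
      by blast
  qed
  then show ?thesis by (rule finite_subset) (intro finite_bounded_monomials finite_cartesian_product J finite)
qed

text \<open>The coefficient of the monomial \<open>M\<close> in exp (\<Sum>x. c x * X x) for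
  commuting X x.\<close>

definition mono_exp_coeff :: "(24 \<times> real \<Rightarrow> complex) \<Rightarrow> monomial \<Rightarrow> complex" where
  "mono_exp_coeff c M = (\<Prod>x\<in>keys M. c x ^ lookup M x / fact (lookup M x))"

lemma mono_exp_coeff_0 [simp]: "mono_exp_coeff c 0 = 1"
  by (simp add: mono_exp_coeff_def)

text \<open>Only the factor at \<open>x\<close> changes; if \<open>x\<close> is new to the support,
  its old factor is \<open>g x 0 = 1\<close>. The multipliers \<open>a\<close> and \<open>b\<close>
  keep the rule free of division.\<close>

lemma prod_keys_add_single:
  fixes g :: "'a \<Rightarrow> nat \<Rightarrow> 'b :: comm_semiring_1"
  assumes g: "\<And>y. g y 0 = 1"
    and ab: "a * g x (Suc (lookup M x)) = b * g x (lookup M x)"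
  shows "a * (\<Prod>y\<in>keys (M + single x 1). g y (lookup (M + single x 1) y)) =
    b * (\<Prod>y\<in>keys M. g y (lookup M y))"
proof -
  let ?S = "insert x (keys M)"
  have k: "keys (M + single x 1) = ?S" by (auto simp: keys_add_nat)
  have "(\<Prod>y\<in>keys (M + single x 1). g y (lookup (M + single x 1) y)) =
      g x (Suc (lookup M x)) * (\<Prod>y\<in>?S - {x}. g y (lookup M y))"
  proof -
    have "lookup (M + single x 1) y = lookup M y" if "y \<in> ?S - {x}" for y
      using that by (auto simp: lookup_add lookup_single_not_eq)
    then show ?thesis
      unfolding k by (subst prod.remove[of _ x]) (simp_all add: lookup_add Suc_eq_plus1)
  qed
  moreover have "(\<Prod>y\<in>keys M. g y (lookup M y)) = (\<Prod>y\<in>?S. g y (lookup M y))"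
    by (rule prod_keys_superset) (auto simp: g)
  moreover have "\<dots> = g x (lookup M x) * (\<Prod>y\<in>?S - {x}. g y (lookup M y))"
    by (subst prod.remove[of _ x]) auto
  ultimately show ?thesis using ab by (simp add: mult.assoc[symmetric])
qed

lemma mono_exp_coeff_step:
  "of_nat (lookup (M + single x 1) x) * mono_exp_coeff c (M + single x 1) = c x * mono_exp_coeff c M"
  unfolding mono_exp_coeff_def
proof (rule prod_keys_add_single)
  have "of_nat (Suc k) * (c x ^ Suc k / fact (Suc k)) = c x * (c x ^ k / fact k)" for k
    by (simp del: of_nat_Suc)
  then show "of_nat (lookup (M + single x 1) x) * (c x ^ Suc (lookup M x) / fact (Suc (lookup M x))) =
      c x * (c x ^ lookup M x / fact (lookup M x))"
    by (simp add: lookup_add del: of_nat_Suc fact_Suc flip: Suc_eq_plus1)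
qed simp

text \<open>The multinomial theorem for operators: \<open>Xm M\<close> is the product of the
  \<open>X x\<close> over \<open>M\<close>, and \<open>fact j * mono_exp_coeff c M\<close> is the
  multinomial coefficient times the power of \<open>c\<close>. Since \<open>XmS\<close> holds for
  every way of building up \<open>M\<close>, it also encodes that the factors commute.\<close>

lemma ser_power_closed:
  assumes I: "I \<subseteq> positive_half_integers"
    and A: "\<And>k p. A k p = (\<Sum>i\<in>UNIV. if real k / 2 \<in> I
              then const_fock (c (i, real k / 2)) * X (i, real k / 2) p else 0)"
    and X: "\<And>x. flinear (X x)"
    and Xm0: "\<And>p. Xm 0 p = p"
    and XmS: "\<And>M x p. Xm (M + single x 1) p = X x (Xm M p)"
  shows "ser_power A j k p = (\<Sum>M\<in>{M \<in> weight_monos I (real k / 2). mono_count M = j}.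
           const_fock (fact j * mono_exp_coeff c M) * Xm M p)"
proof (induction j arbitrary: k)
  case 0
  have z: "M = 0" if "mono_count M = 0" for M
  proof -
    show "M = 0"
      using that by (intro poly_mapping_eqI) (auto simp: mono_count_def in_keys_iff)
  qed
  have "{M \<in> weight_monos I (real k / 2). mono_count M = 0} = (if k = 0 then {0} else {})"
    by (auto simp: weight_monos_def mode_monos_def dest: z)
  then show ?case by (simp add: Xm0 const_fock_1)
next
  case (Suc j)
  let ?S = "\<lambda>j k. {M \<in> weight_monos I (real k / 2). mono_count M = j}"
  have finS: "finite (?S j k)" for j k using finite_weight_monos[OF I] by simp
  let ?g = "\<lambda>x M. const_fock (c x * (fact j * mono_exp_coeff c M)) * Xm (M + single x 1) p"
  let ?D = "{(i, l). i \<le> k \<and> real i / 2 \<in> I \<and> (l::24) \<in> UNIV}"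
  have finD: "finite ?D"
    by (rule finite_subset[of _ "{..k} \<times> UNIV"]) auto
  have "ser_power A (Suc j) k p = (\<Sum>i\<le>k. A i (ser_power A j (k - i) p))"
    by (simp add: ser_mult_def)
  also have "\<dots> = (\<Sum>i\<le>k. \<Sum>l\<in>UNIV. if real i / 2 \<in> I
      then \<Sum>M\<in>?S j (k - i). ?g (l, real i / 2) M else 0)"
    unfolding A Suc.IH flinear_sum[OF X] flinear_scale[OF X] XmS sum_distrib_left const_fock_mult_assoc ..
  also have "\<dots> = (\<Sum>(i, l)\<in>{..k} \<times> UNIV. if real i / 2 \<in> I
      then \<Sum>M\<in>?S j (k - i). ?g (l, real i / 2) M else 0)"
    by (simp add: sum.cartesian_product)
  also have "\<dots> = (\<Sum>(i, l)\<in>?D. \<Sum>M\<in>?S j (k - i). ?g (l, real i / 2) M)"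
    by (rule sum.mono_neutral_cong_right) (auto split: if_splits)
  also have "\<dots> = (\<Sum>d\<in>?D. \<Sum>M\<in>?S j (k - fst d). ?g (snd d, real (fst d) / 2) M)"
    by (rule sum.cong) auto
  also have "\<dots> = (\<Sum>(d, M)\<in>(SIGMA d:?D. ?S j (k - fst d)). ?g (snd d, real (fst d) / 2) M)"
    by (rule sum.Sigma) (use finD finS in auto)
  \<comment> \<open>Multiplying \<open>M\<close> by a further variable is the same as choosing a
    monomial of count \<open>Suc j\<close> with a marked variable in its support;
    \<open>nat \<lfloor>2 * snd x\<rfloor>\<close> recovers the index of the mode.\<close>
  also have "\<dots> = (\<Sum>(M, x)\<in>(SIGMA M:?S (Suc j) k. keys M). ?g x (M - single x 1))"
  proof (rule sum.reindex_bij_witness[where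
        j = "\<lambda>(d, M). (M + single (snd d, real (fst d) / 2) 1, (snd d, real (fst d) / 2))" and
        i = "\<lambda>(M, x). ((nat \<lfloor>2 * snd x\<rfloor>, fst x), M - single x 1)"], goal_cases)
    case (1 a)
    obtain i l M where "a = ((i, l), M)" by (metis prod.exhaust)
    then show ?case by simp
  next
    case (2 a)
    obtain i l M where a: "a = ((i, l), M)" by (metis prod.exhaust)
    have i: "i \<le> k" "real i / 2 \<in> I" and M: "M \<in> mode_monos I" "mono_count M = j"
      and w: "mono_weight M = real (k - i) / 2"
      using 2 by (auto simp: a weight_monos_def)
    have "M + single (l, real i / 2) 1 \<in> mode_monos I"
      using i(2) M(1) by (auto simp: mode_monos_def keys_add_nat)
    moreover have "mono_weight (M + single (l, real i / 2) 1) = real k / 2"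
      using w i(1) by (simp add: mono_weight_add of_nat_diff diff_divide_distrib)
    moreover have "mono_count (M + single (l, real i / 2) 1) = Suc j"
      using M by (simp add: mono_count_add)
    ultimately show ?case by (simp add: a weight_monos_def keys_add_nat)
  next
    case (3 b)
    obtain M x where b: "b = (M, x)" by (cases b)
    have x: "x \<in> keys M" "M \<in> mode_monos I" "mono_weight M = real k / 2" "mono_count M = Suc j"
      using 3 b by (auto simp: weight_monos_def)
    then have "snd x \<in> I" by (auto simp: mode_monos_def)
    then obtain n :: nat where n: "snd x = real n / 2" using I by (auto simp: positive_half_integers_def)
    have "(M - single x 1) + single x 1 = M"
      by (rule sub_add_cancel_le) (use x(1) in \<open>auto simp: lookup_single when_def in_keys_iff\<close>)
    moreover obtain l where "x = (l, real n / 2)" using n by (cases x) auto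
    ultimately show ?case using b by simp
  next
    case (4 b)
    obtain M x where b: "b = (M, x)" by (cases b)
    have x: "x \<in> keys M" "M \<in> mode_monos I" "mono_weight M = real k / 2" "mono_count M = Suc j"
      using 4 b by (auto simp: weight_monos_def)
    then have xI: "snd x \<in> I" by (auto simp: mode_monos_def)
    then obtain n :: nat where n: "snd x = real n / 2" using I by (auto simp: positive_half_integers_def)
    define N where "N = M - single x 1"
    have MN: "M = N + single x 1" unfolding N_def
      by (rule sub_add_cancel_le[symmetric]) (use x(1) in \<open>auto simp: lookup_single when_def in_keys_iff\<close>)
    have N: "N \<in> mode_monos I" using x(2) by (auto simp: MN mode_monos_def keys_add_nat)
    have w: "mono_weight N = real k / 2 - real n / 2" "mono_count N = j"
      using x n by (auto simp: MN mono_weight_add mono_count_add)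
    \<comment> \<open>The left side is nonnegative, so \<open>n \<le> k\<close> and the subtraction
      \<open>k - n\<close> does not truncate.\<close>
    have "real (mono_count N) \<le> real k - real n"
      using mono_count_le_weight[OF I N] w by simp
    then have nk: "n \<le> k" by linarith
    have "N \<in> ?S j (k - n)"
      using N w nk by (auto simp: weight_monos_def of_nat_diff diff_divide_distrib)
    moreover have "nat \<lfloor>2 * snd x\<rfloor> = n" unfolding n by simp
    moreover obtain l where "x = (l, real n / 2)" using n by (cases x) auto
    ultimately show ?case using b nk xI by (simp add: N_def)
  next
    case (5 a)
    obtain i l M where "a = ((i, l), M)" by (metis prod.exhaust)
    then show ?case by simp
  qed
  also have "\<dots> = (\<Sum>M\<in>?S (Suc j) k. \<Sum>x\<in>keys M. ?g x (M - single x 1))"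
    by (rule sum.Sigma[symmetric]) (use finS in auto)
  also have "\<dots> = (\<Sum>M\<in>?S (Suc j) k. const_fock (fact (Suc j) * mono_exp_coeff c M) * Xm M p)"
  proof (rule sum.cong[OF refl])
    fix M assume M: "M \<in> ?S (Suc j) k"
    \<comment> \<open>The weights \<open>lookup M x\<close> of the marked variables add up to
      \<open>mono_count M = Suc j\<close>, which turns \<open>fact j\<close> into
      \<open>fact (Suc j)\<close>.\<close>
    have "?g x (M - single x 1) = const_fock (of_nat (lookup M x) * (fact j * mono_exp_coeff c M)) * Xm M p"
      if "x \<in> keys M" for x
    proof -
      have MN: "(M - single x 1) + single x 1 = M"
        by (rule sub_add_cancel_le) (use that in \<open>auto simp: lookup_single when_def in_keys_iff\<close>)
      show ?thesis
        using mono_exp_coeff_step[of "M - single x 1" x c] unfolding MN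
        by (simp add: algebra_simps)
    qed
    then have "(\<Sum>x\<in>keys M. ?g x (M - single x 1)) =
        (\<Sum>x\<in>keys M. const_fock (of_nat (lookup M x) * (fact j * mono_exp_coeff c M)) * Xm M p)"
      by simp
    also have "\<dots> = const_fock (of_nat (mono_count M) * (fact j * mono_exp_coeff c M)) * Xm M p"
      by (simp add: mono_count_def const_fock_sum sum_distrib_right)
    also have "\<dots> = const_fock (fact (Suc j) * mono_exp_coeff c M) * Xm M p"
      using M by (simp add: algebra_simps)
    finally show "(\<Sum>x\<in>keys M. ?g x (M - single x 1)) =
      const_fock (fact (Suc j) * mono_exp_coeff c M) * Xm M p" .
  qed
  finally show ?case .
qed

text \<open>The factor \<open>1 / fact j\<close> cancels in each power, and a monomial of weight
  \<open>k / 2\<close> has at most \<open>k\<close> factors, so grouping by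
  \<open>mono_count\<close> over \<open>j \<le> k\<close> reaches every monomial.\<close>

lemma ser_exp_closed:
  assumes I: "I \<subseteq> positive_half_integers"
    and A: "\<And>k p. A k p = (\<Sum>i\<in>UNIV. if real k / 2 \<in> I
              then const_fock (c (i, real k / 2)) * X (i, real k / 2) p else 0)"
    and X: "\<And>x. flinear (X x)"
    and Xm0: "\<And>p. Xm 0 p = p"
    and XmS: "\<And>M x p. Xm (M + single x 1) p = X x (Xm M p)"
  shows "ser_exp A k p = (\<Sum>M\<in>weight_monos I (real k / 2). const_fock (mono_exp_coeff c M) * Xm M p)"
proof -
  have "ser_exp A k p = (\<Sum>j\<le>k. \<Sum>M\<in>{M \<in> weight_monos I (real k / 2). mono_count M = j}.
           const_fock (mono_exp_coeff c M) * Xm M p)"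
    unfolding ser_exp_def
      ser_power_closed[where A = A and X = X and Xm = Xm and c = c, OF I A X Xm0 XmS]
      sum_distrib_left const_fock_mult_assoc
    by simp
  also have "\<dots> = (\<Sum>M\<in>weight_monos I (real k / 2). const_fock (mono_exp_coeff c M) * Xm M p)"
  proof (rule sum.group)
    show "mono_count ` weight_monos I (real k / 2) \<subseteq> {..k}"
      using mono_count_le_weight[OF I] by (force simp: weight_monos_def)
  qed (auto simp: finite_weight_monos[OF I])
  finally show ?thesis .
qed

text \<open>A product of falling factorials, the constant produced when the derivative of
  multi-order \<open>M\<close> acts on the monomial \<open>m\<close>. It vanishes unless
  \<open>M\<close> divides \<open>m\<close>, which makes the truncated \<open>m - M\<close> in
  \<open>iter_pdiff\<close> safe.\<close>

definition falling_coeff :: "monomial \<Rightarrow> monomial \<Rightarrow> complex" where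
  "falling_coeff m M = (\<Prod>x\<in>keys M. of_nat ((lookup m x choose lookup M x) * fact (lookup M x)))"

definition iter_pdiff :: "monomial \<Rightarrow> fock \<Rightarrow> fock" where
  "iter_pdiff M = lin_ext (\<lambda>m. single (m - M) (falling_coeff m M))"

lemma flinear_iter_pdiff: "flinear (iter_pdiff M)"
  by (simp add: iter_pdiff_def flinear_lin_ext)

lemma iter_pdiff_single [simp]: "iter_pdiff M (single m 1) = single (m - M) (falling_coeff m M)"
  by (simp add: iter_pdiff_def)

lemma falling_coeff_step:
  "falling_coeff m (M + single x 1) = of_nat (lookup m x - lookup M x) * falling_coeff m M"
proof -
  have *: "(n choose Suc k) * fact (Suc k) = (n - k) * ((n choose k) * fact k)" for n k :: nat
  proof -
    have "(n choose Suc k) * fact (Suc k) = (Suc k * (n choose Suc k)) * fact k"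
      by (simp add: algebra_simps)
    also have "\<dots> = (n - k) * ((n choose k) * fact k)"
      by (simp only: binomial_absorption binomial_absorb_comp[symmetric] mult.assoc)
    finally show ?thesis .
  qed
  have "1 * falling_coeff m (M + single x 1) = of_nat (lookup m x - lookup M x) * falling_coeff m M"
    unfolding falling_coeff_def
    by (rule prod_keys_add_single) (auto simp: * simp flip: of_nat_mult simp del: fact_Suc)
  then show ?thesis by simp
qed

lemma iter_pdiff_0: "iter_pdiff 0 p = p"
  by (rule flinear_eqI[OF flinear_iter_pdiff flinear_id]) (simp add: falling_coeff_def)

lemma iter_pdiff_step: "iter_pdiff (M + single x 1) p = pdiff_fock x (iter_pdiff M p)"
proof (rule flinear_eqI[OF flinear_iter_pdiff flinear_compose[OF flinear_pdiff_fock flinear_iter_pdiff]])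
  fix m
  have "m - M - single x 1 = m - (M + single x 1)"
    by (rule poly_mapping_eqI) (simp add: lookup_add lookup_minus)
  moreover have "single (m - M) (falling_coeff m M) = const_fock (falling_coeff m M) * single (m - M) 1"
    by (simp add: const_fock_mult_single)
  ultimately show "iter_pdiff (M + single x 1) (single m 1) = pdiff_fock x (iter_pdiff M (single m 1))"
    by (simp add: flinear_scale[OF flinear_pdiff_fock])
      (simp add: pdiff_fock_lin_ext const_fock_mult_single falling_coeff_step lookup_minus mult.commute)
qed

lemma falling_coeff_nonzero_iff: "falling_coeff m M \<noteq> 0 \<longleftrightarrow> (\<forall>x. lookup M x \<le> lookup m x)"
proof -
  have "falling_coeff m M \<noteq> 0 \<longleftrightarrow> (\<forall>x\<in>keys M. lookup M x \<le> lookup m x)"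
    by (auto simp: falling_coeff_def binomial_eq_0_iff not_less)
  then show ?thesis by (auto simp: in_keys_iff)
qed

text \<open>The exponent of E^- contains h(-r)/(-r), and h(-r) is multiplication by \<Sum>i. h_i
  times the variable (i, r).\<close>

definition minus_mode :: "complex^24 \<Rightarrow> 24 \<times> real \<Rightarrow> complex" where
  "minus_mode h x = - (h $ fst x) / of_real (snd x)"

text \<open>No division by the mode: the factor r in h(r) = r \<Sum>i. h_i \<partial>_(i,r) cancels
  the 1/r in the exponent of E^+.\<close>

definition plus_mode :: "complex^24 \<Rightarrow> 24 \<times> real \<Rightarrow> complex" where
  "plus_mode h x = h $ fst x"

lemma positive_half_integers_pos: "I \<subseteq> positive_half_integers \<Longrightarrow> r \<in> I \<Longrightarrow> r > 0"
  by (auto simp: positive_half_integers_def)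

lemma E_minus_closed:
  assumes I: "I \<subseteq> positive_half_integers"
  shows "E_minus I h a p =
    (\<Sum>M\<in>weight_monos I (real a / 2). single M (mono_exp_coeff (minus_mode h) M)) * p"
proof -
  let ?A = "\<lambda>k p. if real k / 2 \<in> I
     then const_fock (1 / (- (of_nat k / 2))) * heis 0 h (- (real k / 2)) p else 0"
  have "?A k p = (\<Sum>i\<in>UNIV. if real k / 2 \<in> I
      then const_fock (minus_mode h (i, real k / 2)) * (var_fock (i, real k / 2) * p) else 0)" for k p
  proof (cases "real k / 2 \<in> I")
    case True
    then have k: "real k > 0" using positive_half_integers_pos[OF I] by fastforce
    have "const_fock (1 / (- (of_nat k / 2))) * heis 0 h (- (real k / 2)) p =
        (\<Sum>i\<in>UNIV. const_fock (1 / (- (of_nat k / 2)) * h $ i) * (var_fock (i, real k / 2) * p))"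
    proof -
      have "heis 0 h (- (real k / 2)) p = (\<Sum>i\<in>UNIV. const_fock (h $ i) * var_fock (i, real k / 2)) * p"
        using k by (simp add: heis_def)
      then show ?thesis
        by (simp only: sum_distrib_left sum_distrib_right mult.assoc const_fock_mult_assoc)
    qed
    also have "\<dots> = (\<Sum>i\<in>UNIV. const_fock (minus_mode h (i, real k / 2)) * (var_fock (i, real k / 2) * p))"
      by (simp add: minus_mode_def mult.commute)
    finally show ?thesis using True by simp
  qed simp
  then have "ser_exp ?A a p =
      (\<Sum>M\<in>weight_monos I (real a / 2). const_fock (mono_exp_coeff (minus_mode h) M) * (single M 1 * p))"
    by (rule ser_exp_closed[OF I, where X = "\<lambda>x p. var_fock x * p"])
      (auto simp: flinear_mult var_fock_def mult_single mult.assoc[symmetric] add.commute)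
  then show ?thesis
    by (simp add: E_minus_def sum_distrib_right mult.assoc[symmetric] const_fock_mult_single)
qed

lemma E_plus_closed:
  assumes I: "I \<subseteq> positive_half_integers"
  shows "E_plus I h b p =
    (\<Sum>M\<in>weight_monos I (real b / 2). const_fock (mono_exp_coeff (plus_mode h) M) * iter_pdiff M p)"
proof -
  let ?A = "\<lambda>k p. if real k / 2 \<in> I
     then const_fock (1 / (of_nat k / 2)) * heis 0 h (real k / 2) p else 0"
  have "?A k p = (\<Sum>i\<in>UNIV. if real k / 2 \<in> I
      then const_fock (plus_mode h (i, real k / 2)) * pdiff_fock (i, real k / 2) p else 0)" for k p
  proof (cases "real k / 2 \<in> I")
    case True
    then have k: "real k > 0" using positive_half_integers_pos[OF I] by fastforce
    have "const_fock (1 / (of_nat k / 2)) * heis 0 h (real k / 2) p =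
        (\<Sum>i\<in>UNIV. const_fock (1 / (of_nat k / 2) * (complex_of_real (real k / 2) * h $ i)) *
          pdiff_fock (i, real k / 2) p)"
      using k by (simp add: heis_def sum_distrib_left const_fock_mult_assoc)
    also have "\<dots> = (\<Sum>i\<in>UNIV. const_fock (plus_mode h (i, real k / 2)) * pdiff_fock (i, real k / 2) p)"
      using k by (simp add: plus_mode_def)
    finally show ?thesis using True by simp
  qed simp
  then show ?thesis
    unfolding E_plus_def
    by (rule ser_exp_closed[OF I]) (auto simp: flinear_pdiff_fock iter_pdiff_0 iter_pdiff_step)
qed

section \<open>Coefficients of the vertex operators\<close>

lemma falling_coeff_nonzeroD:
  assumes "falling_coeff m M \<noteq> 0"
  shows "(m - M) + M = m" "M \<in> {M. keys M \<subseteq> keys m \<and> (\<forall>x. lookup M x \<le> lookup m x)}"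
proof -
  have le: "lookup M x \<le> lookup m x" for x
    using iffD1[OF falling_coeff_nonzero_iff assms] by (rule spec)
  then show "(m - M) + M = m" by (rule sub_add_cancel_le)
  have "keys M \<subseteq> keys m" using le by (metis in_keys_iff le_zero_eq subsetI)
  then show "M \<in> {M. keys M \<subseteq> keys m \<and> (\<forall>x. lookup M x \<le> lookup m x)}"
    using le by (intro CollectI conjI allI)
qed

text \<open>A polynomial is killed by all derivatives except those by divisors of its monomials.
  This is what makes \<open>E_coeff\<close> meaningful, since \<open>Sum_any\<close> is 0 on an
  infinite support.\<close>

lemma finite_E_plus_support:
  assumes I: "I \<subseteq> positive_half_integers"
  shows "finite {b. E_plus I h b p \<noteq> 0}"
proof (rule finite_subset)
  let ?N = "\<lambda>m :: monomial. {M. keys M \<subseteq> keys m \<and> (\<forall>x. lookup M x \<le> lookup m x)}"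
  show "{b. E_plus I h b p \<noteq> 0} \<subseteq> (\<lambda>M. nat \<lfloor>2 * mono_weight M\<rfloor>) ` (\<Union>m\<in>keys p. ?N m)"
  proof
    fix b assume "b \<in> {b. E_plus I h b p \<noteq> 0}"
    then have "(\<Sum>M\<in>weight_monos I (real b / 2).
        const_fock (mono_exp_coeff (plus_mode h) M) * iter_pdiff M p) \<noteq> 0"
      by (simp add: E_plus_closed[OF I])
    then obtain M where M: "M \<in> weight_monos I (real b / 2)"
        "const_fock (mono_exp_coeff (plus_mode h) M) * iter_pdiff M p \<noteq> 0"
      by (rule sum.not_neutral_contains_not_neutral)
    then have "(\<Sum>m\<in>keys p. const_fock (lookup p m) * single (m - M) (falling_coeff m M)) \<noteq> 0"
      by (auto simp: iter_pdiff_def lin_ext_def)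
    then obtain m where "m \<in> keys p"
        "const_fock (lookup p m) * single (m - M) (falling_coeff m M) \<noteq> 0"
      by (rule sum.not_neutral_contains_not_neutral)
    then have m: "m \<in> keys p" "falling_coeff m M \<noteq> 0"
      by (auto simp: const_fock_mult_single)
    have "M \<in> ?N m" by (rule falling_coeff_nonzeroD[OF m(2)])
    moreover have "2 * mono_weight M = real b" using M(1) by (simp add: weight_monos_def)
    then have "b = nat \<lfloor>2 * mono_weight M\<rfloor>" by simp
    ultimately show "b \<in> (\<lambda>M. nat \<lfloor>2 * mono_weight M\<rfloor>) ` (\<Union>m\<in>keys p. ?N m)" using m(1) by blast
  qed
  show "finite ((\<lambda>M. nat \<lfloor>2 * mono_weight M\<rfloor>) ` (\<Union>m\<in>keys p. ?N m))"
    by (intro finite_imageI finite_UN_I finite_bounded_monomials finite_keys)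
qed

text \<open>The index pairs that produce z^r; \<open>a\<close> is determined by \<open>b\<close>, so
  the set is finite whenever \<open>S\<close> is.\<close>

definition mode_pairs :: "nat set \<Rightarrow> real \<Rightarrow> (nat \<times> nat) set" where
  "mode_pairs S r = {(a, b). b \<in> S \<and> real a / 2 - real b / 2 = r}"

lemma finite_mode_pairs:
  assumes "finite S"
  shows "finite (mode_pairs S r)"
proof (rule finite_subset)
  show "mode_pairs S r \<subseteq> (\<lambda>b. (nat \<lfloor>2 * (r + real b / 2)\<rfloor>, b)) ` S"
  proof
    fix x assume "x \<in> mode_pairs S r"
    then obtain a b where x: "x = (a, b)" "b \<in> S" and "2 * (r + real b / 2) = real a"
      by (auto simp: mode_pairs_def)
    then have "a = nat \<lfloor>2 * (r + real b / 2)\<rfloor>" by simp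
    with x show "x \<in> (\<lambda>b. (nat \<lfloor>2 * (r + real b / 2)\<rfloor>, b)) ` S" by blast
  qed
qed (use assms in simp)

lemma flinear_E_minus: "I \<subseteq> positive_half_integers \<Longrightarrow> flinear (E_minus I h a)"
  using flinear_mult E_minus_closed by presburger

lemma flinear_E_plus:
  assumes "I \<subseteq> positive_half_integers"
  shows "flinear (E_plus I h b)"
proof -
  have "E_plus I h b = (\<lambda>p. \<Sum>M\<in>weight_monos I (real b / 2).
      const_fock (mono_exp_coeff (plus_mode h) M) * iter_pdiff M p)"
    using E_plus_closed[OF assms] by blast
  then show ?thesis by (simp add: flinear_sumI flinear_const flinear_iter_pdiff)
qed

text \<open>\<open>S\<close> is an arbitrary finite superset of the support, so that several
  arguments can be evaluated over one common index set.\<close>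

lemma E_coeff_finite:
  assumes I: "I \<subseteq> positive_half_integers" and S: "finite S" "{b. E_plus I h b p \<noteq> 0} \<subseteq> S"
  shows "E_coeff I h r p = (\<Sum>(a, b)\<in>mode_pairs S r. E_minus I h a (E_plus I h b p))"
proof -
  have "E_coeff I h r p = (\<Sum>(a, b)\<in>mode_pairs S r.
      if real a / 2 - real b / 2 = r then E_minus I h a (E_plus I h b p) else 0)"
    unfolding E_coeff_def
  proof (rule Sum_any.expand_superset)
    show "finite (mode_pairs S r)" by (rule finite_mode_pairs[OF S(1)])
    show "{x. (case x of (a, b) \<Rightarrow> if real a / 2 - real b / 2 = r
        then E_minus I h a (E_plus I h b p) else 0) \<noteq> 0} \<subseteq> mode_pairs S r"
      using S(2) flinear_0[OF flinear_E_minus[OF I]]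
      by (auto simp: mode_pairs_def split: if_splits)
  qed
  also have "\<dots> = (\<Sum>(a, b)\<in>mode_pairs S r. E_minus I h a (E_plus I h b p))"
    by (rule sum.cong) (auto simp: mode_pairs_def)
  finally show ?thesis .
qed

lemma flinear_E_coeff:
  assumes I: "I \<subseteq> positive_half_integers"
  shows "flinear (E_coeff I h r)"
proof -
  let ?T = "\<lambda>p. {b. E_plus I h b p \<noteq> 0}"
  have lin: "flinear (\<lambda>p. E_minus I h a (E_plus I h b p))" for a b
    by (rule flinear_compose[OF flinear_E_minus[OF I] flinear_E_plus[OF I]])
  note fin = finite_E_plus_support[OF I]
  show ?thesis
  proof (rule flinearI)
    fix p q
    have *: "E_coeff I h r x = (\<Sum>(a, b)\<in>mode_pairs (?T p \<union> ?T q \<union> ?T (p + q)) r. E_minus I h a (E_plus I h b x))"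
      if "?T x \<subseteq> ?T p \<union> ?T q \<union> ?T (p + q)" for x
      by (rule E_coeff_finite[OF I _ that]) (simp add: fin)
    show "E_coeff I h r (p + q) = E_coeff I h r p + E_coeff I h r q"
      unfolding *[of "p + q", OF Un_upper2] *[of p, OF le_supI1, OF Un_upper1]
        *[of q, OF le_supI1, OF Un_upper2]
      by (simp add: flinear_add[OF lin] sum.distrib split_def)
  next
    fix c p
    have *: "E_coeff I h r x = (\<Sum>(a, b)\<in>mode_pairs (?T p \<union> ?T (const_fock c * p)) r. E_minus I h a (E_plus I h b x))"
      if "?T x \<subseteq> ?T p \<union> ?T (const_fock c * p)" for x
      by (rule E_coeff_finite[OF I _ that]) (simp add: fin)
    show "E_coeff I h r (const_fock c * p) = const_fock c * E_coeff I h r p"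
      unfolding *[of "const_fock c * p", OF Un_upper2] *[of p, OF Un_upper1]
      by (simp add: flinear_scale[OF lin] sum_distrib_left split_def)
  qed
qed

lemma keys_mult_single:
  assumes "n \<in> keys (single M (c :: complex) * p)"
  obtains m where "m \<in> keys p" "n = M + m"
  using keys_mult[of "single M c" p] assms by (auto split: if_splits)

lemma in_keys_sumE:
  assumes "n \<in> keys (\<Sum>x\<in>S. f x)"
  obtains x where "x \<in> S" "n \<in> keys (f x)"
  using keys_sum[of f S] assms by blast

lemma keys_E_minus:
  assumes I: "I \<subseteq> positive_half_integers" and n: "n \<in> keys (E_minus I h a p)"
  obtains m where "m \<in> keys p" "mono_weight n = mono_weight m + real a / 2"
    "m \<in> mode_monos I \<Longrightarrow> n \<in> mode_monos I"
proof -
  obtain M where M: "M \<in> weight_monos I (real a / 2)"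
    and "n \<in> keys (single M (mono_exp_coeff (minus_mode h) M) * p)"
    using n unfolding E_minus_closed[OF I] sum_distrib_right by (blast elim: in_keys_sumE)
  then obtain m where "m \<in> keys p" "n = M + m" by (blast elim: keys_mult_single)
  with M show ?thesis
    by (intro that[of m]) (auto simp: weight_monos_def mono_weight_add mode_monos_def keys_add_nat)
qed

lemma keys_E_plus:
  assumes I: "I \<subseteq> positive_half_integers" and n: "n \<in> keys (E_plus I h b p)"
  obtains m where "m \<in> keys p" "mono_weight n = mono_weight m - real b / 2"
    "m \<in> mode_monos I \<Longrightarrow> n \<in> mode_monos I"
proof -
  obtain M where M: "M \<in> weight_monos I (real b / 2)"
    and "n \<in> keys (const_fock (mono_exp_coeff (plus_mode h) M) * iter_pdiff M p)"
    using n unfolding E_plus_closed[OF I] by (blast elim: in_keys_sumE)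
  then have "n \<in> keys (iter_pdiff M p)" by (auto simp: in_keys_iff)
  then obtain m where m: "m \<in> keys p"
      and "n \<in> keys (const_fock (lookup p m) * single (m - M) (falling_coeff m M))"
    unfolding iter_pdiff_def lin_ext_def by (blast elim: in_keys_sumE)
  then have nm: "n = m - M" and "falling_coeff m M \<noteq> 0"
    by (auto simp: const_fock_mult_single split: if_splits)
  then have "m = n + M" by (metis falling_coeff_nonzeroD(1))
  with M m show ?thesis
    by (intro that[of m]) (auto simp: weight_monos_def mono_weight_add mode_monos_def keys_add_nat)
qed

text \<open>E^+ lowers the weight by \<open>b / 2\<close> and E^- raises it by \<open>a / 2\<close>,
  with \<open>a / 2 - b / 2 = r\<close>; neither introduces modes outside \<open>I\<close>.\<close>

lemma keys_E_coeff:
  assumes I: "I \<subseteq> positive_half_integers" and n: "n \<in> keys (E_coeff I h r p)"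
  obtains m where "m \<in> keys p" "mono_weight n = mono_weight m + r"
    "m \<in> mode_monos I \<Longrightarrow> n \<in> mode_monos I"
proof -
  obtain a b where ab: "real a / 2 - real b / 2 = r" and "n \<in> keys (E_minus I h a (E_plus I h b p))"
    using n unfolding E_coeff_finite[OF I finite_E_plus_support[OF I] subset_refl]
    by (auto simp: mode_pairs_def elim!: in_keys_sumE)
  then show ?thesis
    by (elim keys_E_minus[OF I] keys_E_plus[OF I]) (auto intro!: that)
qed

lemma mono_exp_coeff_uminus:
  assumes "\<And>x. c' x = - c x"
  shows "mono_exp_coeff c' M = (-1) ^ mono_count M * mono_exp_coeff c M"
proof -
  have "mono_exp_coeff c' M = (\<Prod>x\<in>keys M. (-1) ^ lookup M x * (c x ^ lookup M x / fact (lookup M x)))"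
    unfolding mono_exp_coeff_def by (intro prod.cong refl) (subst assms, subst power_minus, simp)
  then show ?thesis
    by (simp only: prod.distrib mono_exp_coeff_def mono_count_def power_sum)
qed

lemma sign_fock_mult_single:
  "sign_fock (single M c * p) = single M ((-1) ^ mono_count M * c) * sign_fock p"
proof (rule flinear_eqI[where L = "\<lambda>p. sign_fock (single M c * p)"
      and K = "\<lambda>p. single M ((-1) ^ mono_count M * c) * sign_fock p"])
  show "flinear (\<lambda>p. sign_fock (single M c * p))"
    by (rule flinear_compose[OF flinear_sign_fock flinear_mult])
  show "flinear (\<lambda>p. single M ((-1) ^ mono_count M * c) * sign_fock p)"
    by (rule flinear_compose[OF flinear_mult flinear_sign_fock])
qed (simp add: mult_single sign_fock_single mono_count_add power_add mult_ac)

text \<open>Differentiation lowers the degree by \<open>mono_count M\<close>. The case split is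
  needed because degrees are additive along \<open>m - M\<close> only if \<open>M\<close> divides
  \<open>m\<close>; otherwise both sides vanish.\<close>

lemma sign_fock_iter_pdiff:
  "sign_fock (iter_pdiff M p) = const_fock ((-1) ^ mono_count M) * iter_pdiff M (sign_fock p)"
proof (rule flinear_eqI[where L = "\<lambda>p. sign_fock (iter_pdiff M p)"
      and K = "\<lambda>p. const_fock ((-1) ^ mono_count M) * iter_pdiff M (sign_fock p)"])
  show "flinear (\<lambda>p. sign_fock (iter_pdiff M p))"
    by (rule flinear_compose[OF flinear_sign_fock flinear_iter_pdiff])
  show "flinear (\<lambda>p. const_fock ((-1) ^ mono_count M) * iter_pdiff M (sign_fock p))"
    by (intro flinear_const flinear_compose[OF flinear_iter_pdiff flinear_sign_fock])
  fix m
  show "sign_fock (iter_pdiff M (single m 1)) =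
    const_fock ((-1) ^ mono_count M) * iter_pdiff M (sign_fock (single m 1))"
  proof (cases "falling_coeff m M = 0")
    case True
    then show ?thesis
      using flinear_scale[OF flinear_iter_pdiff, of M "(-1) ^ mono_count m" "single m 1"]
      by (simp add: sign_fock_single const_fock_mult_single flinear_0[OF flinear_sign_fock])
  next
    case False
    then have "(m - M) + M = m" by (rule falling_coeff_nonzeroD(1))
    then have *: "mono_count m = mono_count (m - M) + mono_count M" by (metis mono_count_add)
    show ?thesis
      using flinear_scale[OF flinear_iter_pdiff, of M "(-1) ^ mono_count m" "single m 1"]
      by (cases "even (mono_count M)") (simp_all add: sign_fock_single const_fock_mult_single * power_add)
  qed
qed

lemma sign_fock_E_minus:
  assumes I: "I \<subseteq> positive_half_integers"
  shows "sign_fock (E_minus I h a p) = E_minus I (- h) a (sign_fock p)"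
proof -
  have "mono_exp_coeff (minus_mode (- h)) M = (-1) ^ mono_count M * mono_exp_coeff (minus_mode h) M" for M
    by (rule mono_exp_coeff_uminus) (simp add: minus_mode_def)
  then show ?thesis
    by (simp add: E_minus_closed[OF I] sum_distrib_right flinear_sum[OF flinear_sign_fock]
        sign_fock_mult_single)
qed

lemma sign_fock_E_plus:
  assumes I: "I \<subseteq> positive_half_integers"
  shows "sign_fock (E_plus I h b p) = E_plus I (- h) b (sign_fock p)"
proof -
  have "mono_exp_coeff (plus_mode (- h)) M = mono_exp_coeff (plus_mode h) M * (-1) ^ mono_count M" for M
    by (subst mono_exp_coeff_uminus[of _ "plus_mode h"]) (simp_all add: plus_mode_def mult.commute)
  then show ?thesis
    by (simp add: E_plus_closed[OF I] flinear_sum[OF flinear_sign_fock]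
        flinear_scale[OF flinear_sign_fock] sign_fock_iter_pdiff const_fock_mult_assoc)
qed

text \<open>Conjugation by the sign operator turns each oscillator h(r) into -h(r), hence replaces
  \<open>h\<close> by \<open>- h\<close> in both exponentials.\<close>

lemma sign_fock_E_coeff:
  assumes I: "I \<subseteq> positive_half_integers"
  shows "sign_fock (E_coeff I h r p) = E_coeff I (- h) r (sign_fock p)"
proof -
  let ?S = "{b. E_plus I h b p \<noteq> 0} \<union> {b. E_plus I (- h) b (sign_fock p) \<noteq> 0}"
  have fin: "finite ?S" using finite_E_plus_support[OF I] by blast
  have "E_coeff I h r p = (\<Sum>(a, b)\<in>mode_pairs ?S r. E_minus I h a (E_plus I h b p))"
    "E_coeff I (- h) r (sign_fock p) =
      (\<Sum>(a, b)\<in>mode_pairs ?S r. E_minus I (- h) a (E_plus I (- h) b (sign_fock p)))"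
    by (rule E_coeff_finite[OF I fin]; blast)+
  then show ?thesis
    by (simp add: flinear_sum[OF flinear_sign_fock] split_def sign_fock_E_minus[OF I] sign_fock_E_plus[OF I])
qed

text \<open>The classical Laguerre polynomial L_n at the argument -t.\<close>

definition laguerre :: "nat \<Rightarrow> complex \<Rightarrow> complex" where
  "laguerre n t = (\<Sum>j\<le>n. of_nat (n choose j) * t ^ j / fact j)"

lemma mono_exp_coeff_falling:
  assumes "keys M \<subseteq> keys m"
  shows "mono_exp_coeff c M * mono_exp_coeff d M * falling_coeff m M =
    (\<Prod>x\<in>keys m. of_nat (lookup m x choose lookup M x) * (c x * d x) ^ lookup M x / fact (lookup M x))"
proof -
  have "mono_exp_coeff c M * mono_exp_coeff d M * falling_coeff m M =
    (\<Prod>x\<in>keys M. of_nat (lookup m x choose lookup M x) * (c x * d x) ^ lookup M x / fact (lookup M x))"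
    unfolding mono_exp_coeff_def falling_coeff_def prod.distrib[symmetric]
    by (intro prod.cong refl) (simp add: field_simps)
  also have "\<dots> = (\<Prod>x\<in>keys m. of_nat (lookup m x choose lookup M x) * (c x * d x) ^ lookup M x / fact (lookup M x))"
    by (rule prod_keys_superset) (use assms in auto)
  finally show ?thesis .
qed

text \<open>A diagonal entry arises only when E^- restores exactly the monomial \<open>M\<close>
  that E^+ removed. The sum over all divisors \<open>M\<close> of \<open>m\<close> then factors over
  the variables, and the product of the two coefficients at \<open>x\<close> is -h_i^2/r.\<close>

lemma E_coeff_diagonal:
  assumes I: "I \<subseteq> positive_half_integers" and m: "m \<in> mode_monos I"
  shows "lookup (E_coeff I h 0 (single m 1)) m =
    (\<Prod>x\<in>keys m. laguerre (lookup m x) (- ((h $ fst x)\<^sup>2 / of_real (snd x))))"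
proof -
  let ?N = "{M. keys M \<subseteq> keys m \<and> (\<forall>x. lookup M x \<le> lookup m x)}"
  let ?e = "\<lambda>M. nat \<lfloor>2 * mono_weight M\<rfloor>"
  let ?c = "mono_exp_coeff (minus_mode h)" and ?d = "mono_exp_coeff (plus_mode h)"
  \<comment> \<open>The support is needed for \<open>E_coeff_finite\<close>; the image of
    \<open>?N\<close> is added so that grouping the divisors of \<open>m\<close> by weight covers
    all of them.\<close>
  define S where "S = {b. E_plus I h b (single m 1) \<noteq> 0} \<union> ?e ` ?N"
  have finN: "finite ?N" by (intro finite_bounded_monomials finite_keys)
  then have fS: "finite S" unfolding S_def using finite_E_plus_support[OF I] by blast
  have NI: "M \<in> mode_monos I" if "M \<in> ?N" for M using that m by (auto simp: mode_monos_def)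
  \<comment> \<open>Weights of such monomials are half-integers, so the floor in \<open>?e\<close>
    loses nothing.\<close>
  have Nw: "real (?e M) / 2 = mono_weight M" if "M \<in> ?N" for M
  proof -
    have "\<exists>k::nat. y * real n = real k / 2" if "y \<in> I" for y n
    proof -
      have "y \<in> positive_half_integers" using that I by blast
      then obtain k :: nat where "y = real k / 2" by (auto simp: positive_half_integers_def)
      then show ?thesis by (intro exI[of _ "k * n"]) simp
    qed
    then obtain f where f: "\<And>y n. y \<in> I \<Longrightarrow> y * real n = real (f y n :: nat) / 2" by metis
    have "mono_weight M = (\<Sum>x\<in>keys M. real (f (snd x) (lookup M x)) / 2)"
      unfolding mono_weight_def using NI[OF that] by (intro sum.cong refl f) (auto simp: mode_monos_def)
    then have "2 * mono_weight M = real (\<Sum>x\<in>keys M. f (snd x) (lookup M x))"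
      by (simp add: sum_divide_distrib[symmetric])
    then show ?thesis by (metis floor_of_nat nat_int nonzero_mult_div_cancel_left zero_neq_numeral)
  qed
  have "lookup (E_minus I h b (E_plus I h b (single m 1))) m =
      (\<Sum>M\<in>{M \<in> ?N. ?e M = b}. ?c M * ?d M * falling_coeff m M)" for b
  proof -
    let ?W = "weight_monos I (real b / 2)"
    have fW: "finite ?W" by (rule finite_weight_monos[OF I])
    have "lookup (E_minus I h b (E_plus I h b (single m 1))) m =
      (\<Sum>M\<in>?W. \<Sum>M'\<in>?W. (?c M' * (?d M * falling_coeff m M) when M' + (m - M) = m))"
      by (simp add: E_minus_closed[OF I] E_plus_closed[OF I] sum_distrib_left sum_distrib_right
          lookup_sum const_fock_mult_single mult_single lookup_single)
    also have "\<dots> = (\<Sum>M\<in>?W. ?c M * ?d M * falling_coeff m M)"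
    proof (rule sum.cong[OF refl])
      fix M assume M: "M \<in> ?W"
      show "(\<Sum>M'\<in>?W. (?c M' * (?d M * falling_coeff m M) when M' + (m - M) = m)) =
        ?c M * ?d M * falling_coeff m M"
      proof (cases "falling_coeff m M = 0")
        case False
        then have *: "(m - M) + M = m" by (rule falling_coeff_nonzeroD(1))
        have "M' + (m - M) = m \<longleftrightarrow> M' = M" for M'
        proof
          assume "M' + (m - M) = m"
          then have "M' + (m - M) = M + (m - M)" using * by (simp add: add.commute)
          then show "M' = M" by simp
        qed (use * in \<open>simp add: add.commute\<close>)
        then show ?thesis using M fW by (simp add: when_def)
      qed simp
    qed
    also have "\<dots> = (\<Sum>M\<in>{M \<in> ?N. ?e M = b}. ?c M * ?d M * falling_coeff m M)"
    proof (rule sum.mono_neutral_right)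
      show "{M \<in> ?N. ?e M = b} \<subseteq> ?W"
        using NI Nw by (force simp: weight_monos_def)
      show "\<forall>M\<in>?W - {M \<in> ?N. ?e M = b}. ?c M * ?d M * falling_coeff m M = 0"
      proof
        fix M assume M: "M \<in> ?W - {M \<in> ?N. ?e M = b}"
        then have "2 * mono_weight M = real b" by (simp add: weight_monos_def)
        then have "?e M = b" by simp
        then have "M \<notin> ?N" using M by blast
        then have "falling_coeff m M = 0"
          by (rule contrapos_np) (rule falling_coeff_nonzeroD(2))
        then show "?c M * ?d M * falling_coeff m M = 0" by simp
      qed
    qed (rule fW)
    finally show ?thesis .
  qed
  moreover have "E_coeff I h 0 (single m 1) = (\<Sum>b\<in>S. E_minus I h b (E_plus I h b (single m 1)))"
  proof -
    have "mode_pairs S 0 = (\<lambda>b. (b, b)) ` S" by (auto simp: mode_pairs_def)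
    then show ?thesis
      using E_coeff_finite[OF I fS, of h "single m 1" 0]
      by (simp add: S_def sum.reindex inj_on_def)
  qed
  ultimately have "lookup (E_coeff I h 0 (single m 1)) m =
      (\<Sum>b\<in>S. \<Sum>M\<in>{M \<in> ?N. ?e M = b}. ?c M * ?d M * falling_coeff m M)"
    by (simp add: lookup_sum)
  also have "\<dots> = (\<Sum>M\<in>?N. ?c M * ?d M * falling_coeff m M)"
    by (rule sum.group) (use finN fS in \<open>auto simp: S_def\<close>)
  also have "\<dots> = (\<Sum>M\<in>?N. \<Prod>x\<in>keys m. of_nat (lookup m x choose lookup M x) *
      (minus_mode h x * plus_mode h x) ^ lookup M x / fact (lookup M x))"
    by (rule sum.cong[OF refl], rule mono_exp_coeff_falling) auto
  also have "?N = {M. keys M \<subseteq> keys m \<and> (\<forall>x\<in>keys m. lookup M x \<in> {..lookup m x})}"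
    by (intro Collect_cong conj_cong refl) (metis atMost_iff in_keys_iff le0 subsetD)
  also have "(\<Sum>M\<in>\<dots>. \<Prod>x\<in>keys m. of_nat (lookup m x choose lookup M x) *
      (minus_mode h x * plus_mode h x) ^ lookup M x / fact (lookup M x)) =
      (\<Prod>x\<in>keys m. \<Sum>n\<in>{..lookup m x}. of_nat (lookup m x choose n) *
        (minus_mode h x * plus_mode h x) ^ n / fact n)"
    by (rule sum_prod_lookup) auto
  also have "\<dots> = (\<Prod>x\<in>keys m. laguerre (lookup m x) (- ((h $ fst x)\<^sup>2 / of_real (snd x))))"
    by (simp add: laguerre_def minus_mode_def plus_mode_def power2_eq_square)
  finally show ?thesis .
qed

section \<open>Generating functions over monomials\<close>

text \<open>The binomial series with exponent -(j+1), with \<open>- of_nat (Suc j) gchoose k\<close>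
  rewritten by negation of the upper index.\<close>

lemma neg_binomial_sums:
  fixes z :: complex
  assumes "norm z < 1"
  shows "(\<lambda>k. of_nat ((j + k) choose j) * z ^ k) sums (1 / (1 - z) ^ Suc j)"
proof -
  have "(\<lambda>k. (- of_nat (Suc j) gchoose k) * (- z) ^ k) sums (1 + - z) powr (- of_nat (Suc j))"
    by (rule gen_binomial_complex) (use assms in simp)
  moreover have "(- of_nat (Suc j) gchoose k) * (- z) ^ k = of_nat ((j + k) choose j) * z ^ k" for k
  proof -
    have "of_nat (Suc j) + of_nat k - (1::complex) = of_nat (j + k)" by simp
    then have "(- of_nat (Suc j) gchoose k) = (-1) ^ k * (of_nat ((j + k) choose k) :: complex)"
      using gbinomial_minus[of "of_nat (Suc j) :: complex" k] by (simp only: binomial_gbinomial)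
    moreover have "(j + k) choose k = (j + k) choose j"
      using binomial_symmetric[of j "j + k"] by simp
    ultimately show ?thesis by (simp add: power_minus' mult_ac power_minus[of z])
  qed
  moreover have "(1 + - z) powr (- of_nat (Suc j)) = 1 / (1 - z) ^ Suc j"
  proof -
    have "1 - z \<noteq> 0" using assms by auto
    then have "(1 - z) powr of_nat (Suc j) = (1 - z) ^ Suc j" by (intro powr_nat') simp
    then show ?thesis by (simp only: powr_minus divide_inverse mult_1_left add_uminus_conv_diff)
  qed
  ultimately show ?thesis by simp
qed

lemma neg_binomial_sums_real:
  fixes z :: real
  assumes "0 \<le> z" "z < 1"
  shows "(\<lambda>k. real ((j + k) choose j) * z ^ k) sums (1 / (1 - z) ^ Suc j)"
proof -
  have "(\<lambda>k. of_real (real ((j + k) choose j) * z ^ k)) sums (of_real (1 / (1 - z) ^ Suc j) :: complex)"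
    using neg_binomial_sums[of "of_real z" j] assms by simp
  then show ?thesis by (simp only: sums_of_real_iff)
qed

lemma neg_binomial_has_sum:
  fixes z :: complex
  assumes "norm z < 1"
  shows "((\<lambda>k. of_nat ((j + k) choose j) * z ^ k) has_sum (1 / (1 - z) ^ Suc j)) UNIV"
  using neg_binomial_sums_real[of "norm z" j] assms
  by (intro norm_summable_imp_has_sum neg_binomial_sums)
    (auto simp: norm_mult norm_power sums_iff)

lemma exp_has_sum: "((\<lambda>j. u ^ j / fact j) has_sum exp u) UNIV" for u :: complex
  using exp_converges[of u] summable_norm_exp[of u]
  by (intro norm_summable_imp_has_sum) (auto simp: scaleR_conv_of_real divide_inverse mult.commute norm_mult norm_inverse norm_power)

text \<open>Setting \<open>n = j + k\<close> turns the triangle \<open>j \<le> n\<close> into a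
  quadrant. The sum over \<open>k\<close> is a negative binomial series, and what is left is the
  exponential series in \<open>t * y / (1 - y)\<close>.\<close>

lemma laguerre_double_sum:
  fixes t y :: complex
  assumes y: "norm y < 1"
    and sm: "(\<lambda>(j, k). of_nat ((j + k) choose j) * t ^ j / fact j * y ^ (j + k)) summable_on UNIV \<times> UNIV"
  shows "((\<lambda>n. laguerre n t * y ^ n) has_sum (exp (t * y / (1 - y)) / (1 - y))) UNIV"
proof -
  let ?f = "\<lambda>(j, k). of_nat ((j + k) choose j) * t ^ j / fact j * y ^ (j + k)"
  have y1: "1 - y \<noteq> 0" using y by auto
  have "(?f has_sum (exp (t * y / (1 - y)) / (1 - y))) (UNIV \<times> UNIV)"
  proof (rule has_sum_SigmaI)
    show "((\<lambda>k. ?f (j, k)) has_sum ((t * y / (1 - y)) ^ j / fact j / (1 - y))) UNIV" for j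
      using has_sum_cmult_right[OF neg_binomial_has_sum[OF y, of j], of "t ^ j / fact j * y ^ j"] y1
      by (simp add: power_add mult_ac power_divide power_mult_distrib)
    show "((\<lambda>j. (t * y / (1 - y)) ^ j / fact j / (1 - y)) has_sum (exp (t * y / (1 - y)) / (1 - y))) UNIV"
      by (rule has_sum_divide_const[OF exp_has_sum])
  qed (rule sm)
  moreover have "((\<lambda>(n, j). of_nat (n choose j) * t ^ j / fact j * y ^ n) has_sum s) (SIGMA n:UNIV. {..n}) \<longleftrightarrow>
      (?f has_sum s) (UNIV \<times> UNIV)" for s
    by (rule has_sum_reindex_bij_witness[where i = "\<lambda>(j, k). (j + k, j)" and j = "\<lambda>(n, j). (j, n - j)"]) auto
  ultimately have "((\<lambda>(n, j). of_nat (n choose j) * t ^ j / fact j * y ^ n) has_sum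
      (exp (t * y / (1 - y)) / (1 - y))) (SIGMA n:UNIV. {..n})" by blast
  then show ?thesis
    by (rule has_sum_SigmaD)
      (auto simp: laguerre_def sum_distrib_right intro!: has_sum_finiteI)
qed

text \<open>The same iterated summation applied to the norms of the terms.\<close>

lemma laguerre_summable:
  fixes t y :: complex
  assumes y: "norm y < 1"
  shows "(\<lambda>(j, k). of_nat ((j + k) choose j) * t ^ j / fact j * y ^ (j + k)) summable_on UNIV \<times> UNIV"
proof (rule abs_summable_summable)
  let ?u = "norm t * norm y / (1 - norm y)"
  let ?g = "\<lambda>(j, k). real ((j + k) choose j) * norm t ^ j / fact j * norm y ^ (j + k)"
  have "?g summable_on UNIV \<times> UNIV"
  proof (rule summable_on_SigmaI)
    show "((\<lambda>k. ?g (j, k)) has_sum (?u ^ j / fact j / (1 - norm y))) UNIV" for j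
    proof -
      have "((\<lambda>k. real ((j + k) choose j) * norm y ^ k) has_sum (1 / (1 - norm y) ^ Suc j)) UNIV"
        using neg_binomial_sums_real[of "norm y" j] y
        by (intro norm_summable_imp_has_sum) (auto simp: sums_iff norm_mult)
      from has_sum_cmult_right[OF this, of "norm t ^ j / fact j * norm y ^ j"] y show ?thesis
        by (simp add: power_add mult_ac power_divide power_mult_distrib)
    qed
    have "(\<lambda>j. ?u ^ j / fact j) summable_on UNIV"
      using summable_norm_exp[of ?u] y
      by (intro norm_summable_imp_summable_on) (simp add: divide_inverse mult.commute norm_mult norm_inverse norm_power)
    then show "(\<lambda>j. ?u ^ j / fact j / (1 - norm y)) summable_on UNIV"
      unfolding divide_inverse[of _ "1 - norm y"] by (rule summable_on_cmult_left)
  qed auto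
  moreover have "(\<lambda>x. norm (case x of (j, k) \<Rightarrow> of_nat ((j + k) choose j) * t ^ j / fact j * y ^ (j + k))) = ?g"
    by (auto simp: norm_mult norm_divide norm_power)
  ultimately show "(\<lambda>x. norm (case x of (j, k) \<Rightarrow> of_nat ((j + k) choose j) * t ^ j / fact j * y ^ (j + k)))
      summable_on UNIV \<times> UNIV" by simp
qed

lemma laguerre_has_sum:
  fixes t y :: complex
  assumes "norm y < 1"
  shows "((\<lambda>n. laguerre n t * y ^ n) has_sum (exp (t * y / (1 - y)) / (1 - y))) UNIV"
  by (rule laguerre_double_sum[OF assms laguerre_summable[OF assms]])

text \<open>All coefficients of \<open>laguerre n\<close> are nonnegative.\<close>

lemma norm_laguerre_le: "norm (laguerre n t) \<le> Re (laguerre n (of_real (norm t)))"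
proof -
  have "norm (laguerre n t) \<le> (\<Sum>j\<le>n. real (n choose j) * norm t ^ j / fact j)"
    unfolding laguerre_def by (rule order_trans[OF norm_sum]) (simp add: norm_mult norm_divide norm_power)
  also have "\<dots> = Re (of_real (\<Sum>j\<le>n. real (n choose j) * norm t ^ j / fact j))"
    by (rule Re_complex_of_real[symmetric])
  also have "of_real (\<Sum>j\<le>n. real (n choose j) * norm t ^ j / fact j) = laguerre n (of_real (norm t))"
    by (simp add: laguerre_def)
  finally show ?thesis .
qed

text \<open>Comparison with the generating function at \<open>norm t\<close> and
  \<open>norm y\<close>. The explicit bound is what later controls a product over infinitely many
  oscillators.\<close>

lemma laguerre_abs_summable:
  fixes t y :: complex
  assumes y: "norm y < 1"
  shows "(\<lambda>n. norm (laguerre n t * y ^ n)) summable_on UNIV"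
    "(\<Sum>\<^sub>\<infinity>n. norm (laguerre n t * y ^ n)) \<le> exp (norm t * norm y / (1 - norm y)) / (1 - norm y)"
proof -
  let ?t = "complex_of_real (norm t)" and ?y = "complex_of_real (norm y)"
  let ?S = "exp (norm t * norm y / (1 - norm y)) / (1 - norm y)"
  have "((\<lambda>n. laguerre n ?t * ?y ^ n) has_sum (exp (?t * ?y / (1 - ?y)) / (1 - ?y))) UNIV"
    by (rule laguerre_has_sum) (use y in simp)
  then have "((\<lambda>n. Re (laguerre n ?t * ?y ^ n)) has_sum Re (exp (?t * ?y / (1 - ?y)) / (1 - ?y))) UNIV"
    by (rule has_sum_Re)
  moreover have "exp (?t * ?y / (1 - ?y)) / (1 - ?y) = of_real ?S"
    by (simp flip: exp_of_real)
  moreover have "Re (laguerre n ?t * ?y ^ n) = Re (laguerre n ?t) * norm y ^ n" for n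
    by (simp flip: of_real_power)
  ultimately have hs: "((\<lambda>n. Re (laguerre n ?t) * norm y ^ n) has_sum ?S) UNIV" by simp
  have le: "norm (laguerre n t * y ^ n) \<le> Re (laguerre n ?t) * norm y ^ n" for n
    unfolding norm_mult norm_power by (intro mult_right_mono norm_laguerre_le) auto
  show sm: "(\<lambda>n. norm (laguerre n t * y ^ n)) summable_on UNIV"
    by (rule summable_on_comparison_test[OF has_sum_imp_summable[OF hs]]) (use le in auto)
  have "(\<Sum>\<^sub>\<infinity>n. norm (laguerre n t * y ^ n)) \<le> (\<Sum>\<^sub>\<infinity>n. Re (laguerre n ?t) * norm y ^ n)"
    by (rule infsum_mono[OF sm has_sum_imp_summable[OF hs]]) (rule le)
  then show "(\<Sum>\<^sub>\<infinity>n. norm (laguerre n t * y ^ n)) \<le> ?S"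
    using infsumI[OF hs] by simp
qed

text \<open>A finite set that approximates the total sum lies in some \<open>A R0\<close>. For
  larger \<open>R\<close> its union with a finite set approximating the sum over \<open>A R\<close>
  is close to both sums.\<close>

lemma tendsto_infsum_incseq:
  fixes f :: "'a \<Rightarrow> 'b :: banach"
  assumes f: "f summable_on (\<Union>R. A R)" and A: "incseq A"
  shows "(\<lambda>R :: nat. infsum f (A R)) \<longlonglongrightarrow> infsum f (\<Union>R. A R)"
  unfolding tendsto_iff
proof (intro allI impI)
  fix e :: real assume e: "e > 0"
  let ?S = "infsum f (\<Union>R. A R)"
  have "eventually (\<lambda>F. dist (sum f F) ?S < e / 2) (finite_subsets_at_top (\<Union>R. A R))"
    by (rule tendstoD[OF infsum_tendsto[OF f]]) (use e in simp)
  then obtain F0 where F0: "finite F0" "F0 \<subseteq> (\<Union>R. A R)"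
    and d0: "\<And>F. finite F \<Longrightarrow> F0 \<subseteq> F \<Longrightarrow> F \<subseteq> (\<Union>R. A R) \<Longrightarrow> dist (sum f F) ?S < e / 2"
    by (auto simp: eventually_finite_subsets_at_top)
  obtain R0 where R0: "F0 \<subseteq> A R0"
  proof -
    have "\<forall>x\<in>F0. \<exists>R. x \<in> A R" using F0 by blast
    then obtain r where r: "\<And>x. x \<in> F0 \<Longrightarrow> x \<in> A (r x)" by metis
    have "x \<in> A (Max (r ` F0))" if "x \<in> F0" for x
      using r[OF that] incseqD[OF A, of "r x" "Max (r ` F0)"] F0(1) that by auto
    then show ?thesis using that by blast
  qed
  have "dist (infsum f (A R)) ?S < e" if "R \<ge> R0" for R
  proof -
    have "f summable_on A R" by (rule summable_on_subset_banach[OF f]) blast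
    then have "eventually (\<lambda>F. dist (sum f F) (infsum f (A R)) < e / 2) (finite_subsets_at_top (A R))"
      by (intro tendstoD[OF infsum_tendsto]) (use e in simp_all)
    then obtain F1 where F1: "finite F1" "F1 \<subseteq> A R"
      and d1: "\<And>F. finite F \<Longrightarrow> F1 \<subseteq> F \<Longrightarrow> F \<subseteq> A R \<Longrightarrow> dist (sum f F) (infsum f (A R)) < e / 2"
      by (auto simp: eventually_finite_subsets_at_top)
    have "F0 \<subseteq> A R" using R0 incseqD[OF A that] by blast
    then have F01: "finite (F0 \<union> F1)" "F0 \<union> F1 \<subseteq> A R" "F0 \<union> F1 \<subseteq> (\<Union>R. A R)" using F0 F1 by auto
    show ?thesis
      by (rule dist_triangle_half_r[OF d1[OF F01(1) Un_upper2 F01(2)] d0[OF F01(1) Un_upper1 F01(3)]])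
  qed
  then show "eventually (\<lambda>R. dist (infsum f (A R)) ?S < e) sequentially"
    by (auto simp: eventually_sequentially)
qed

text \<open>Expansion of an infinite product of series into a series over monomials. Any finite set
  of monomials lies in a finite box, where the sum of norms factors and is at most
  \<open>exp K\<close>; this gives absolute summability. The value is then found along the
  exhaustion \<open>Y\<close>, where the product is finite.\<close>

lemma has_sum_prod_keys:
  fixes g :: "'x \<Rightarrow> nat \<Rightarrow> complex" and Y :: "nat \<Rightarrow> 'x set"
  assumes g0: "\<And>x. g x 0 = 1"
    and gsum: "\<And>x. x \<in> X \<Longrightarrow> (\<lambda>n. norm (g x n)) summable_on UNIV"
    and gb: "\<And>x. x \<in> X \<Longrightarrow> (\<Sum>\<^sub>\<infinity>n. norm (g x n)) \<le> exp (b x)"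
    and bK: "\<And>F. finite F \<Longrightarrow> F \<subseteq> X \<Longrightarrow> sum b F \<le> K"
    and Y: "\<And>R. finite (Y R)" "incseq Y" "(\<Union>R. Y R) = X"
    and lim: "(\<lambda>R. \<Prod>x\<in>Y R. infsum (g x) UNIV) \<longlonglongrightarrow> S"
  shows "((\<lambda>m. \<Prod>x\<in>keys m. g x (lookup m x)) has_sum S) {m. keys m \<subseteq> X}"
proof -
  let ?f = "\<lambda>m. \<Prod>x\<in>keys m. g x (lookup m x)"
  have "(\<lambda>m. norm (?f m)) summable_on {m. keys m \<subseteq> X}"
  proof (rule nonneg_bdd_above_summable_on)
    show "bdd_above (sum (\<lambda>m. norm (?f m)) ` {F. F \<subseteq> {m. keys m \<subseteq> X} \<and> finite F})"
    proof (rule bdd_aboveI2)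
      fix F :: "('x \<Rightarrow>\<^sub>0 nat) set" assume "F \<in> {F. F \<subseteq> {m. keys m \<subseteq> X} \<and> finite F}"
      then have F: "\<And>m. m \<in> F \<Longrightarrow> keys m \<subseteq> X" "finite F" by auto
      define Z where "Z = (\<Union>m\<in>F. keys m)"
      define k where "k = Max (insert 0 (\<Union>m\<in>F. lookup m ` keys m))"
      let ?B = "{m. keys m \<subseteq> Z \<and> (\<forall>x\<in>Z. lookup m x \<in> {..k})}"
      have Z: "finite Z" "Z \<subseteq> X" unfolding Z_def using F by auto
      have finB: "finite ?B"
        using bij_betw_finite[OF bij_betw_lookup_PiE[OF Z(1), of "\<lambda>x. {..k}"]] Z(1)
        by (simp add: finite_PiE)
      have "F \<subseteq> ?B"
      proof
        fix m assume m: "m \<in> F"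
        have "lookup m x \<le> k" for x
        proof (cases "x \<in> keys m")
          case True
          then show ?thesis unfolding k_def using F(2) m by (intro Max_ge) auto
        qed (simp add: in_keys_iff)
        then show "m \<in> ?B" using m by (auto simp: Z_def)
      qed
      then have "(\<Sum>m\<in>F. norm (?f m)) \<le> (\<Sum>m\<in>?B. norm (?f m))"
        by (intro sum_mono2 finB) auto
      also have "\<dots> = (\<Sum>m\<in>?B. \<Prod>x\<in>Z. norm (g x (lookup m x)))"
      proof (rule sum.cong[OF refl])
        fix m assume "m \<in> ?B"
        then show "norm (?f m) = (\<Prod>x\<in>Z. norm (g x (lookup m x)))"
          unfolding prod_norm[symmetric] by (intro prod_keys_superset Z) (auto simp: g0)
      qed
      also have "\<dots> = (\<Prod>x\<in>Z. \<Sum>n\<in>{..k}. norm (g x n))"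
        by (rule sum_prod_lookup) (auto simp: Z)
      also have "\<dots> \<le> (\<Prod>x\<in>Z. exp (b x))"
      proof (rule prod_mono, intro conjI)
        fix x assume x: "x \<in> Z"
        have "(\<Sum>n\<in>{..k}. norm (g x n)) \<le> (\<Sum>\<^sub>\<infinity>n. norm (g x n))"
          using gsum[of x] x Z by (intro finite_sum_le_infsum) auto
        also have "\<dots> \<le> exp (b x)" using gb x Z by blast
        finally show "(\<Sum>n\<in>{..k}. norm (g x n)) \<le> exp (b x)" .
      qed (simp add: sum_nonneg)
      also have "\<dots> = exp (sum b Z)" by (rule exp_sum[OF Z(1), symmetric])
      also have "\<dots> \<le> exp K" using bK[OF Z] by simp
      finally show "(\<Sum>m\<in>F. norm (?f m)) \<le> exp K" .
    qed
  qed auto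
  then have sm: "?f summable_on {m. keys m \<subseteq> X}" by (rule abs_summable_summable)
  have U: "(\<Union>R. {m :: 'x \<Rightarrow>\<^sub>0 nat. keys m \<subseteq> Y R}) = {m. keys m \<subseteq> X}"
  proof (intro set_eqI iffI)
    fix m :: "'x \<Rightarrow>\<^sub>0 nat" assume "m \<in> {m. keys m \<subseteq> X}"
    then have "\<forall>x\<in>keys m. \<exists>R. x \<in> Y R" using Y(3) by blast
    then obtain r where r: "\<And>x. x \<in> keys m \<Longrightarrow> x \<in> Y (r x)" by metis
    have "x \<in> Y (Max (r ` keys m))" if "x \<in> keys m" for x
      using r[OF that] incseqD[OF Y(2), of "r x" "Max (r ` keys m)"] that by auto
    then show "m \<in> (\<Union>R. {m. keys m \<subseteq> Y R})" by blast
  qed (use Y(3) in blast)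
  have "infsum ?f {m. keys m \<subseteq> Y R} = (\<Prod>x\<in>Y R. infsum (g x) UNIV)" for R
  proof -
    have "infsum ?f {m. keys m \<subseteq> Y R} =
        infsum (\<lambda>m. \<Prod>x\<in>Y R. g x (restrict (lookup m) (Y R) x)) {m. keys m \<subseteq> Y R \<and> (\<forall>x\<in>Y R. lookup m x \<in> UNIV)}"
    proof (rule infsum_cong_neutral)
      fix m :: "'x \<Rightarrow>\<^sub>0 nat"
      assume "m \<in> {m. keys m \<subseteq> Y R} \<inter> {m. keys m \<subseteq> Y R \<and> (\<forall>x\<in>Y R. lookup m x \<in> UNIV)}"
      then have "?f m = (\<Prod>x\<in>Y R. g x (lookup m x))" by (intro prod_keys_superset Y) (auto simp: g0)
      then show "?f m = (\<Prod>x\<in>Y R. g x (restrict (lookup m) (Y R) x))" by simp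
    qed auto
    also have "\<dots> = infsum (\<lambda>f. \<Prod>x\<in>Y R. g x (f x)) (PiE (Y R) (\<lambda>x. UNIV))"
      by (rule infsum_reindex_bij_betw[OF bij_betw_lookup_PiE[OF Y(1), where B = "\<lambda>x. UNIV"]])
    also have "\<dots> = (\<Prod>x\<in>Y R. infsum (g x) UNIV)"
      using Y gsum by (intro infsum_prod_PiE_abs) auto
    finally show ?thesis .
  qed
  moreover have "(\<lambda>R. infsum ?f {m. keys m \<subseteq> Y R}) \<longlonglongrightarrow> infsum ?f {m. keys m \<subseteq> X}"
  proof -
    have "incseq (\<lambda>R. {m :: 'x \<Rightarrow>\<^sub>0 nat. keys m \<subseteq> Y R})"
      by (rule incseq_SucI, rule Collect_mono, rule impI, erule subset_trans, rule incseq_SucD[OF Y(2)])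
    from tendsto_infsum_incseq[OF _ this, of ?f, unfolded U, OF sm] show ?thesis .
  qed
  ultimately have "infsum ?f {m. keys m \<subseteq> X} = S"
    using LIMSEQ_unique[OF _ lim] by simp
  then show ?thesis using has_sum_infsum[OF sm] by simp
qed

section \<open>Euler products and theta functions\<close>

definition euler_prod :: "complex \<Rightarrow> complex" where
  "euler_prod w = prodinf (\<lambda>n. 1 - w ^ Suc n)"

text \<open>Index \<open>n\<close> stands for the exponent n+1. The sum is a logarithm of the
  reciprocal of the Euler product, but the principal branch is never invoked for it: only its
  exponential is used.\<close>

definition log_term :: "complex \<Rightarrow> nat \<Rightarrow> complex" where
  "log_term w n = w ^ Suc n / of_nat (Suc n) / (1 - w ^ Suc n)"

definition log_sum :: "complex \<Rightarrow> complex" where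
  "log_sum w = suminf (log_term w)"

lemma norm_power_Suc_less_1: "norm w < 1 \<Longrightarrow> norm (w ^ Suc n) < 1" for w :: complex
  by (simp add: norm_power power_less_one_iff del: power_Suc)

text \<open>Justifies summing the double series in either order. The inner geometric sums are
  bounded by means of \<open>1 - norm w ^ Suc n \<ge> 1 - norm w\<close>.\<close>

lemma log_term_double_summable:
  fixes w :: complex
  assumes w: "norm w < 1"
  shows "(\<lambda>(n, m). (w ^ Suc n) ^ Suc m / of_nat (Suc n)) summable_on UNIV \<times> UNIV"
proof (rule abs_summable_summable)
  let ?r = "norm w"
  let ?g = "\<lambda>(n, m). (?r ^ Suc n) ^ Suc m / real (Suc n)"
  have geo: "((\<lambda>m. z ^ Suc m) has_sum (z / (1 - z))) UNIV" if "0 \<le> z" "z < 1" for z :: real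
  proof -
    have "(\<lambda>m. z * z ^ m) sums (z * (1 / (1 - z)))"
      by (intro sums_mult geometric_sums) (use that in simp)
    then show ?thesis using that by (intro norm_summable_imp_has_sum) (auto simp: sums_iff norm_mult norm_power)
  qed
  have "?g summable_on UNIV \<times> UNIV"
  proof (rule summable_on_SigmaI)
    show "((\<lambda>m. ?g (n, m)) has_sum (?r ^ Suc n / (1 - ?r ^ Suc n) / real (Suc n))) UNIV" for n
      using has_sum_divide_const[OF geo[of "?r ^ Suc n"], of "real (Suc n)"] norm_power_Suc_less_1[OF w, of n]
      by (simp add: norm_power del: of_nat_Suc power_Suc)
    show "(\<lambda>n. ?r ^ Suc n / (1 - ?r ^ Suc n) / real (Suc n)) summable_on UNIV"
    proof (rule summable_on_comparison_test)
      show "(\<lambda>n. ?r ^ Suc n * (1 / (1 - ?r))) summable_on UNIV"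
        using geo[of ?r] w by (intro summable_on_cmult_left) (auto intro: has_sum_imp_summable)
      fix n :: nat
      have p: "?r ^ Suc n < 1" "?r ^ Suc n \<le> ?r"
        using power_Suc_less_one[of ?r n] power_decreasing[of 1 "Suc n" ?r] w by (auto simp del: power_Suc)
      have "?r ^ Suc n / (1 - ?r ^ Suc n) / real (Suc n) \<le> ?r ^ Suc n / (1 - ?r ^ Suc n) / 1"
        using p by (intro divide_left_mono) (auto intro!: divide_nonneg_nonneg)
      also have "\<dots> \<le> ?r ^ Suc n / (1 - ?r)"
        using p w by (simp only: div_by_1) (intro divide_left_mono, auto intro!: mult_pos_pos)
      finally show "?r ^ Suc n / (1 - ?r ^ Suc n) / real (Suc n) \<le> ?r ^ Suc n * (1 / (1 - ?r))"
        by simp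
      show "0 \<le> ?r ^ Suc n / (1 - ?r ^ Suc n) / real (Suc n)"
        using p by (intro divide_nonneg_nonneg) auto
    qed
  qed auto
  moreover have "(\<lambda>x. norm (case x of (n, m) \<Rightarrow> (w ^ Suc n) ^ Suc m / of_nat (Suc n))) = ?g"
    by (rule ext) (auto simp only: norm_divide norm_power norm_of_nat split: prod.splits)
  ultimately show "(\<lambda>x. norm (case x of (n, m) \<Rightarrow> (w ^ Suc n) ^ Suc m / of_nat (Suc n))) summable_on UNIV \<times> UNIV"
    by simp
qed

lemma Ln_has_sum:
  assumes z: "norm z < 1"
  shows "((\<lambda>n. z ^ Suc n / of_nat (Suc n)) has_sum - Ln (1 - z)) UNIV"
proof (rule norm_summable_imp_has_sum)
  \<comment> \<open>The term at \<open>n = 0\<close> is a division by zero, hence 0, so the later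
    shift by one does not change the sum.\<close>
  have "(\<lambda>n. - (z ^ n / of_nat n)) sums Ln (1 - z)"
    using Ln_series'[of "- z"] z by simp
  then have "(\<lambda>n. z ^ n / of_nat n) sums - Ln (1 - z)" using sums_minus by fastforce
  then show "(\<lambda>n. z ^ Suc n / of_nat (Suc n)) sums - Ln (1 - z)"
    by (subst sums_Suc_iff) simp
  have "summable (\<lambda>n. norm z * norm z ^ n)"
    using z by (intro summable_mult summable_geometric) simp
  then show "summable (\<lambda>n. norm (z ^ Suc n / of_nat (Suc n)))"
  proof (rule summable_comparison_test'[where N = 0])
    show "norm (norm (z ^ Suc n / of_nat (Suc n))) \<le> norm z * norm z ^ n" for n
      using divide_left_mono[of 1 "real (Suc n)" "norm z ^ Suc n"]
      by (simp add: norm_divide norm_power norm_mult del: of_nat_Suc)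
  qed
qed

text \<open>The exponent is expanded into a double series over \<open>w\<^bsup>(n+1)(m+1)\<^esup>/(n+1)\<close> and summed
  over \<open>n\<close> first.\<close>

lemma
  fixes w :: complex
  assumes w: "norm w < 1"
  shows log_term_sums: "log_term w sums log_sum w"
    and tendsto_euler_prod: "(\<lambda>n. \<Prod>k<n. 1 - w ^ Suc k) \<longlonglongrightarrow> exp (- log_sum w)"
proof -
  let ?f = "\<lambda>(n, m). (w ^ Suc n) ^ Suc m / of_nat (Suc n)"
  have geo: "((\<lambda>m. z ^ Suc m) has_sum (z / (1 - z))) UNIV" if "norm z < 1" for z :: complex
  proof -
    have "(\<lambda>m. z * z ^ m) sums (z * (1 / (1 - z)))"
      by (intro sums_mult geometric_sums that)
    moreover have "summable (\<lambda>m. norm z * norm z ^ m)"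
      using that by (intro summable_mult summable_geometric) simp
    ultimately show ?thesis using that
      by (intro norm_summable_imp_has_sum) (auto simp: norm_mult norm_power)
  qed
  obtain T where T: "(?f has_sum T) (UNIV \<times> UNIV)"
    using log_term_double_summable[OF w] has_sum_infsum by blast
  have "(log_term w has_sum T) UNIV"
  proof (rule has_sum_SigmaD[OF T])
    show "((\<lambda>m. ?f (n, m)) has_sum log_term w n) UNIV" for n
      using has_sum_divide_const[OF geo[OF norm_power_Suc_less_1[OF w, of n]], of "of_nat (Suc n)"]
      by (simp add: log_term_def divide_divide_eq_left mult.commute del: of_nat_Suc power_Suc)
  qed
  then have "log_term w sums T" by (rule has_sum_imp_sums)
  then have T_eq: "T = log_sum w" by (simp add: log_sum_def sums_iff)
  with \<open>log_term w sums T\<close> show "log_term w sums log_sum w" by simp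
  have "((\<lambda>m. - Ln (1 - w ^ Suc m)) has_sum T) UNIV"
  proof (rule has_sum_SigmaD)
    show "((\<lambda>(m, n). ?f (n, m)) has_sum T) (UNIV \<times> UNIV)"
      using T by (subst (asm) has_sum_swap) simp
    show "((\<lambda>n. (\<lambda>(m, n). ?f (n, m)) (m, n)) has_sum - Ln (1 - w ^ Suc m)) UNIV" for m
    proof -
      have eq: "(\<lambda>(m, n). ?f (n, m)) (m, n) = (w ^ Suc m) ^ Suc n / of_nat (Suc n)" for n
        by (simp only: prod.case power_mult[symmetric] mult.commute[of "Suc n"])
      show ?thesis unfolding eq by (rule Ln_has_sum[OF norm_power_Suc_less_1[OF w]])
    qed
  qed
  then have "(\<lambda>m. - Ln (1 - w ^ Suc m)) sums T" by (rule has_sum_imp_sums)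
  then have "(\<lambda>n. exp (- (\<Sum>m<n. - Ln (1 - w ^ Suc m)))) \<longlonglongrightarrow> exp (- T)"
    unfolding sums_def by (intro tendsto_intros)
  moreover have "exp (- (\<Sum>m<n. - Ln (1 - w ^ Suc m))) = (\<Prod>m<n. 1 - w ^ Suc m)" for n
  proof -
    have "1 - w ^ Suc m \<noteq> 0" for m using norm_power_Suc_less_1[OF w, of m] by auto
    then show ?thesis by (simp add: sum_negf exp_sum del: power_Suc)
  qed
  ultimately show "(\<lambda>n. \<Prod>k<n. 1 - w ^ Suc k) \<longlonglongrightarrow> exp (- log_sum w)"
    by (simp add: T_eq del: power_Suc)
qed

text \<open>Convergence of an infinite product includes that the limit is nonzero for nonzero
  factors, hence the condition on \<open>L\<close>.\<close>

lemma prodinf_eqI: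
  fixes f :: "nat \<Rightarrow> complex"
  assumes "\<And>n. f n \<noteq> 0" "(\<lambda>n. \<Prod>k<n. f k) \<longlonglongrightarrow> L" "L \<noteq> 0"
  shows "prodinf f = L"
proof -
  have lim: "(\<lambda>n. \<Prod>k\<le>n. f k) \<longlonglongrightarrow> L"
    using LIMSEQ_Suc[OF assms(2)] by (simp add: lessThan_Suc_atMost)
  then have "convergent_prod f"
    using assms by (subst convergent_prod_iff_nz_lim) auto
  then show ?thesis using convergent_prod_LIMSEQ lim LIMSEQ_unique by blast
qed

lemma
  assumes w: "norm w < 1"
  shows euler_prod_eq_exp: "euler_prod w = exp (- log_sum w)"
    and euler_prod_tendsto: "(\<lambda>n. \<Prod>k<n. 1 - w ^ Suc k) \<longlonglongrightarrow> euler_prod w"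
    and euler_prod_nonzero: "euler_prod w \<noteq> 0"
proof -
  have "1 - w ^ Suc n \<noteq> 0" for n using norm_power_Suc_less_1[OF w, of n] by auto
  then show *: "euler_prod w = exp (- log_sum w)"
    unfolding euler_prod_def by (intro prodinf_eqI tendsto_euler_prod[OF w]) auto
  show "(\<lambda>n. \<Prod>k<n. 1 - w ^ Suc k) \<longlonglongrightarrow> euler_prod w" "euler_prod w \<noteq> 0"
    unfolding * using tendsto_euler_prod[OF w] by auto
qed


lemma one_minus_power_nonzero: "norm w < 1 \<Longrightarrow> 1 - w ^ Suc n \<noteq> 0" for w :: complex
  using norm_power_Suc_less_1[of w n] by auto

lemma one_plus_power_nonzero: "norm w < 1 \<Longrightarrow> 1 + w ^ Suc n \<noteq> 0" for w :: complex
proof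
  assume w: "norm w < 1" and "1 + w ^ Suc n = 0"
  then have "w ^ Suc n = - 1" by (simp only: add_eq_0_iff)
  then have "norm (w ^ Suc n) = 1" by (simp del: power_Suc)
  then show False using norm_power_Suc_less_1[OF w, of n] by (simp del: power_Suc)
qed

lemma norm_square_less_1: "norm w < 1 \<Longrightarrow> norm (w\<^sup>2) < 1" for w :: complex
  using norm_power_Suc_less_1[of w 1] by (simp add: numeral_2_eq_2)

text \<open>From 1 + x = (1 - x^2)/(1 - x) with x = q^n.\<close>

lemma prod_one_plus_tendsto:
  assumes q: "norm q < 1"
  shows "(\<lambda>R. \<Prod>n<R. 1 + q ^ Suc n) \<longlonglongrightarrow> euler_prod (q\<^sup>2) / euler_prod q"
proof -
  have "(\<lambda>R. (\<Prod>n<R. 1 - (q\<^sup>2) ^ Suc n) / (\<Prod>n<R. 1 - q ^ Suc n)) \<longlonglongrightarrow> euler_prod (q\<^sup>2) / euler_prod q"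
    by (intro tendsto_divide euler_prod_tendsto euler_prod_nonzero q norm_square_less_1)
  moreover have "(\<Prod>n<R. 1 - (q\<^sup>2) ^ Suc n) / (\<Prod>n<R. 1 - q ^ Suc n) = (\<Prod>n<R. 1 + q ^ Suc n)" for R
  proof -
    have "1 - (q\<^sup>2) ^ Suc n = (1 - q ^ Suc n) * (1 + q ^ Suc n)" for n
      by (simp add: power2_eq_square power_mult_distrib algebra_simps del: power_Suc)
    then have "(\<Prod>n<R. 1 - (q\<^sup>2) ^ Suc n) = (\<Prod>n<R. 1 - q ^ Suc n) * (\<Prod>n<R. 1 + q ^ Suc n)"
      by (simp only: prod.distrib)
    moreover have "(\<Prod>n<R. 1 - q ^ Suc n) \<noteq> 0"
      using one_minus_power_nonzero[OF q] by (simp del: power_Suc)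
    ultimately show ?thesis by simp
  qed
  ultimately show ?thesis by (simp del: power_Suc)
qed

lemma double_tendsto: "X \<longlonglongrightarrow> L \<Longrightarrow> (\<lambda>R. X (2 * R)) \<longlonglongrightarrow> L"
  using LIMSEQ_subseq_LIMSEQ[of X L "\<lambda>R. 2 * R"] by (simp add: strict_mono_def comp_def)

text \<open>The first 2R factors split into the odd ones and the first R factors of the product for
  \<open>w\<^sup>2\<close>.\<close>

lemma prod_odd_tendsto:
  assumes w: "norm w < 1"
  shows "(\<lambda>R. \<Prod>n<R. 1 - w ^ (2 * n + 1)) \<longlonglongrightarrow> euler_prod w / euler_prod (w\<^sup>2)"
proof -
  note w2 = norm_square_less_1[OF w]
  have "(\<lambda>R. (\<Prod>n<2 * R. 1 - w ^ Suc n) / (\<Prod>n<R. 1 - (w\<^sup>2) ^ Suc n)) \<longlonglongrightarrow> euler_prod w / euler_prod (w\<^sup>2)"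
    by (intro tendsto_divide euler_prod_tendsto euler_prod_nonzero w2 double_tendsto[OF euler_prod_tendsto[OF w]])
  moreover have "(\<Prod>n<2 * R. 1 - w ^ Suc n) / (\<Prod>n<R. 1 - (w\<^sup>2) ^ Suc n) = (\<Prod>n<R. 1 - w ^ (2 * n + 1))" for R
  proof -
    have "(\<Prod>n<2 * R. 1 - w ^ Suc n) = (\<Prod>n<R. 1 - w ^ (2 * n + 1)) * (\<Prod>n<R. 1 - (w\<^sup>2) ^ Suc n)"
    proof (induction R)
      case (Suc R)
      have "(w\<^sup>2) ^ Suc R = w ^ Suc (Suc (2 * R))" unfolding power_mult[symmetric] by simp
      then show ?case using Suc by (simp del: power_Suc add: mult_ac flip: Suc_eq_plus1)
    qed simp
    moreover have "(\<Prod>n<R. 1 - (w\<^sup>2) ^ Suc n) \<noteq> 0"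
      using one_minus_power_nonzero[OF w2] by (simp del: power_Suc)
    ultimately show ?thesis by simp
  qed
  ultimately show ?thesis by (simp del: power_Suc)
qed

lemma exp_log_sum:
  assumes "norm w < 1"
  shows "exp (log_sum w) = 1 / euler_prod w"
  by (simp add: euler_prod_eq_exp[OF assms] exp_minus inverse_eq_divide)

text \<open>The exponent at each n is \<open>of_nat N\<close> times a \<open>log_term\<close> of q
  minus twice one of q^2, so its exponential tends to a quotient of Euler products. The power 24
  counts the coordinates.\<close>

lemma untwisted_product_tendsto:
  assumes q: "norm q < 1"
  shows "(\<lambda>R. \<Prod>n<R. exp (of_nat N / of_nat (Suc n) * (q ^ Suc n / (1 + q ^ Suc n))) / (1 + q ^ Suc n) ^ 24)
    \<longlonglongrightarrow> ((euler_prod (q\<^sup>2))\<^sup>2 / euler_prod q) ^ N * (euler_prod q / euler_prod (q\<^sup>2)) ^ 24"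
proof -
  note q2 = norm_square_less_1[OF q]
  let ?s = "\<lambda>R. (\<Sum>n<R. log_term q n) - 2 * (\<Sum>n<R. log_term (q\<^sup>2) n)"
  have "(\<lambda>R. exp (of_nat N * ?s R) / (\<Prod>n<R. 1 + q ^ Suc n) ^ 24) \<longlonglongrightarrow>
      exp (of_nat N * (log_sum q - 2 * log_sum (q\<^sup>2))) / (euler_prod (q\<^sup>2) / euler_prod q) ^ 24"
    using log_term_sums[OF q] log_term_sums[OF q2] unfolding sums_def
    by (intro tendsto_intros prod_one_plus_tendsto q) (use euler_prod_nonzero[OF q] euler_prod_nonzero[OF q2] in auto)
  moreover have "exp (of_nat N * ?s R) / (\<Prod>n<R. 1 + q ^ Suc n) ^ 24 =
      (\<Prod>n<R. exp (of_nat N / of_nat (Suc n) * (q ^ Suc n / (1 + q ^ Suc n))) / (1 + q ^ Suc n) ^ 24)" for R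
  proof -
    have "log_term q n - 2 * log_term (q\<^sup>2) n = 1 / of_nat (Suc n) * (q ^ Suc n / (1 + q ^ Suc n))" for n
    proof -
      define x where "x = q ^ Suc n"
      have x: "1 - x \<noteq> 0" "1 + x \<noteq> 0"
        unfolding x_def by (rule one_minus_power_nonzero[OF q] one_plus_power_nonzero[OF q])+
      have x2: "(q\<^sup>2) ^ Suc n = x * x"
        unfolding x_def by (simp add: power2_eq_square power_mult_distrib del: power_Suc)
      \<comment> \<open>Partial fractions: x/(1 + x) = x/(1 - x) - 2 x^2/(1 - x^2), with the second
        denominator factored.\<close>
      have x3: "1 - x * x = (1 - x) * (1 + x)" by (simp add: algebra_simps)
      have "x / (1 - x) - 2 * (x * x / (1 - x * x)) = x / (1 + x)"
        unfolding x3 using x by (simp add: divide_simps) (simp add: algebra_simps)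
      then have "1 / of_nat (Suc n) * (x / (1 - x) - 2 * (x * x / (1 - x * x))) = 1 / of_nat (Suc n) * (x / (1 + x))"
        by simp
      moreover have "log_term q n - 2 * log_term (q\<^sup>2) n =
          1 / of_nat (Suc n) * (x / (1 - x) - 2 * (x * x / (1 - x * x)))"
        unfolding log_term_def x2 x_def[symmetric] by (simp add: right_diff_distrib mult_ac del: of_nat_Suc)
      ultimately show ?thesis by (simp only: x_def)
    qed
    then have "?s R = (\<Sum>n<R. 1 / of_nat (Suc n) * (q ^ Suc n / (1 + q ^ Suc n)))"
      by (simp only: sum_distrib_left sum_subtractf[symmetric])
    then have "exp (of_nat N * ?s R) = (\<Prod>n<R. exp (of_nat N / of_nat (Suc n) * (q ^ Suc n / (1 + q ^ Suc n))))"
      by (simp add: sum_distrib_left exp_sum mult.assoc[symmetric] del: power_Suc of_nat_Suc)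
    then show ?thesis by (simp only: prod_dividef prod_power_distrib)
  qed
  moreover have "exp (of_nat N * (log_sum q - 2 * log_sum (q\<^sup>2))) = ((euler_prod (q\<^sup>2))\<^sup>2 / euler_prod q) ^ N"
  proof -
    have "exp (log_sum q - 2 * log_sum (q\<^sup>2)) = (euler_prod (q\<^sup>2))\<^sup>2 / euler_prod q"
      using exp_log_sum[OF q] exp_log_sum[OF q2] by (simp add: exp_diff exp_double power_divide)
    then show ?thesis by (simp only: exp_of_nat_mult)
  qed
  ultimately show ?thesis by (simp add: power_divide del: power_Suc of_nat_Suc)
qed

text \<open>The modes are halves of odd numbers, so only odd exponents of w occur. They are isolated
  by removing the even part of the logarithmic series, which is half of the series for
  \<open>w\<^sup>2\<close>.\<close>

lemma twisted_product_tendsto: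
  assumes w: "norm w < 1"
  shows "(\<lambda>R. \<Prod>n<R. exp (- (of_nat N * 2 / of_nat (2 * n + 1) * (w ^ (2 * n + 1) / (1 - w ^ (2 * n + 1))))) /
      (1 - w ^ (2 * n + 1)) ^ 24)
    \<longlonglongrightarrow> ((euler_prod w)\<^sup>2 / euler_prod (w\<^sup>2)) ^ N * (euler_prod (w\<^sup>2) / euler_prod w) ^ 24"
proof -
  note w2 = norm_square_less_1[OF w]
  let ?s = "\<lambda>R. 2 * (\<Sum>n<2 * R. log_term w n) - (\<Sum>n<R. log_term (w\<^sup>2) n)"
  let ?t = "\<lambda>n. 2 / of_nat (2 * n + 1) * (w ^ (2 * n + 1) / (1 - w ^ (2 * n + 1)))"
  have "(\<lambda>R. exp (of_nat N * - ?s R) / (\<Prod>n<R. 1 - w ^ (2 * n + 1)) ^ 24) \<longlonglongrightarrow>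
      exp (of_nat N * - (2 * log_sum w - log_sum (w\<^sup>2))) / (euler_prod w / euler_prod (w\<^sup>2)) ^ 24"
    using double_tendsto[OF log_term_sums[OF w, unfolded sums_def]] log_term_sums[OF w2] unfolding sums_def
    by (intro tendsto_intros prod_odd_tendsto w) (use euler_prod_nonzero[OF w] euler_prod_nonzero[OF w2] in auto)
  moreover have "exp (of_nat N * - ?s R) / (\<Prod>n<R. 1 - w ^ (2 * n + 1)) ^ 24 =
      (\<Prod>n<R. exp (- (of_nat N * 2 / of_nat (2 * n + 1) * (w ^ (2 * n + 1) / (1 - w ^ (2 * n + 1))))) /
      (1 - w ^ (2 * n + 1)) ^ 24)" for R
  proof -
    have "?s R = (\<Sum>n<R. ?t n)"
    proof (induction R)
      case (Suc R)
      \<comment> \<open>Because of the index shift, position \<open>2 * R + 1\<close> carries the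
        even exponent 2R+2, and position \<open>2 * R\<close> the odd exponent 2R+1.\<close>
      have e1: "2 * log_term w (Suc (2 * R)) = log_term (w\<^sup>2) R"
      proof -
        have "(w\<^sup>2) ^ Suc R = w ^ Suc (Suc (2 * R))" unfolding power_mult[symmetric] by simp
        moreover have "of_nat (Suc (Suc (2 * R))) = 2 * (of_nat (Suc R) :: complex)" by simp
        ultimately show ?thesis by (simp add: log_term_def del: power_Suc of_nat_Suc)
      qed
      have e2: "2 * log_term w (2 * R) = ?t R"
        by (simp add: log_term_def del: power_Suc of_nat_Suc of_nat_add flip: Suc_eq_plus1)
      have "?s (Suc R) = ?s R + 2 * log_term w (2 * R) + (2 * log_term w (Suc (2 * R)) - log_term (w\<^sup>2) R)"
        by (simp add: algebra_simps)
      then show ?case unfolding Suc.IH e1 e2 by simp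
    qed simp
    then have "of_nat N * - ?s R = (\<Sum>n<R. - (of_nat N * ?t n))"
      by (simp only: sum_negf sum_distrib_left mult_minus_right)
    then have "exp (of_nat N * - ?s R) = (\<Prod>n<R. exp (- (of_nat N * ?t n)))"
      by (simp only: exp_sum finite_lessThan)
    then show ?thesis by (simp only: prod_dividef prod_power_distrib mult.assoc[symmetric] times_divide_eq_right)
  qed
  moreover have "exp (of_nat N * - (2 * log_sum w - log_sum (w\<^sup>2))) = ((euler_prod w)\<^sup>2 / euler_prod (w\<^sup>2)) ^ N"
  proof -
    have "exp (- (2 * log_sum w - log_sum (w\<^sup>2))) = (euler_prod w)\<^sup>2 / euler_prod (w\<^sup>2)"
      using exp_log_sum[OF w] exp_log_sum[OF w2] by (simp add: exp_diff exp_double power_divide)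
    then show ?thesis by (simp only: exp_of_nat_mult)
  qed
  ultimately show ?thesis by (simp add: power_divide del: power_Suc of_nat_Suc)
qed

section \<open>Eta and theta functions as quotients of Euler products\<close>

lemma q_pow_add: "q_pow (a + b) \<tau> = q_pow a \<tau> * q_pow b \<tau>"
  by (simp add: q_pow_def exp_add[symmetric] algebra_simps)

lemma q_pow_power: "q_pow a \<tau> ^ n = q_pow (a * real n) \<tau>"
  by (simp add: q_pow_def exp_of_nat_mult[symmetric] algebra_simps)

lemma q_pow_0 [simp]: "q_pow 0 \<tau> = 1"
  by (simp add: q_pow_def)

lemma q_pow_sum: "finite S \<Longrightarrow> (\<Prod>x\<in>S. q_pow (f x) \<tau>) = q_pow (\<Sum>x\<in>S. f x) \<tau>"
  by (induction S rule: finite_induct) (auto simp: q_pow_add)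

lemma norm_q_pow: "norm (q_pow a \<tau>) = exp (- (2 * pi * a * Im \<tau>))"
  by (simp add: q_pow_def)

lemma norm_q_pow_less_1: "Im \<tau> > 0 \<Longrightarrow> a > 0 \<Longrightarrow> norm (q_pow a \<tau>) < 1"
  by (simp add: norm_q_pow)

lemma q_pow_Suc: "q_pow (real n + 1) \<tau> = q_pow 1 \<tau> ^ Suc n"
  unfolding q_pow_power by (simp add: add.commute)

lemma q_pow_half: "q_pow (real n + 1 / 2) \<tau> = q_pow (1 / 2) \<tau> ^ (2 * n + 1)"
  unfolding q_pow_power by (simp add: add_divide_distrib)

lemma q_pow_half_square: "(q_pow (1 / 2) \<tau>)\<^sup>2 = q_pow 1 \<tau>"
  unfolding q_pow_power by simp

lemma eta_eq: "eta \<tau> = q_pow (1 / 24) \<tau> * euler_prod (q_pow 1 \<tau>)"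
  unfolding eta_def euler_prod_def q_pow_Suc ..

lemma Theta1_eq:
  assumes "Im \<tau> > 0"
  shows "Theta1 \<tau> / 2 = q_pow (1 / 8) \<tau> * ((euler_prod ((q_pow 1 \<tau>)\<^sup>2))\<^sup>2 / euler_prod (q_pow 1 \<tau>))"
proof -
  define q where "q = q_pow 1 \<tau>"
  have q: "norm q < 1" unfolding q_def by (rule norm_q_pow_less_1) (use assms in auto)
  note nz = euler_prod_nonzero[OF q] euler_prod_nonzero[OF norm_square_less_1[OF q]]
  have "prodinf (\<lambda>n. (1 - q ^ Suc n) * (1 + q ^ Suc n)\<^sup>2) = euler_prod q * (euler_prod (q\<^sup>2) / euler_prod q)\<^sup>2"
  proof (rule prodinf_eqI)
    show "(1 - q ^ Suc n) * (1 + q ^ Suc n)\<^sup>2 \<noteq> 0" for n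
      using one_minus_power_nonzero[OF q] one_plus_power_nonzero[OF q] by (simp del: power_Suc)
    show "(\<lambda>R. \<Prod>n<R. (1 - q ^ Suc n) * (1 + q ^ Suc n)\<^sup>2) \<longlonglongrightarrow> euler_prod q * (euler_prod (q\<^sup>2) / euler_prod q)\<^sup>2"
      unfolding prod.distrib prod_power_distrib[symmetric]
      by (intro tendsto_mult tendsto_power euler_prod_tendsto prod_one_plus_tendsto q)
  qed (use nz in simp)
  also have "\<dots> = (euler_prod (q\<^sup>2))\<^sup>2 / euler_prod q"
    using nz by (simp add: power2_eq_square)
  finally show ?thesis unfolding Theta1_def q_pow_Suc q_def by simp
qed

text \<open>Covers Theta2 with w = q^(1/2) and Theta3 with w = -q^(1/2): odd powers of w change sign
  while \<open>w\<^sup>2\<close> stays q.\<close>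

lemma theta_product:
  assumes w: "norm w < 1"
  shows "prodinf (\<lambda>n. (1 - (w\<^sup>2) ^ Suc n) * (1 - w ^ (2 * n + 1))\<^sup>2) = (euler_prod w)\<^sup>2 / euler_prod (w\<^sup>2)"
proof -
  note w2 = norm_square_less_1[OF w]
  note nz = euler_prod_nonzero[OF w] euler_prod_nonzero[OF w2]
  have "prodinf (\<lambda>n. (1 - (w\<^sup>2) ^ Suc n) * (1 - w ^ (2 * n + 1))\<^sup>2) =
      euler_prod (w\<^sup>2) * (euler_prod w / euler_prod (w\<^sup>2))\<^sup>2"
  proof (rule prodinf_eqI)
    show "(1 - (w\<^sup>2) ^ Suc n) * (1 - w ^ (2 * n + 1))\<^sup>2 \<noteq> 0" for n
      using one_minus_power_nonzero[OF w2] one_minus_power_nonzero[OF w, of "2 * n"]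
      by (simp del: power_Suc flip: Suc_eq_plus1)
    show "(\<lambda>R. \<Prod>n<R. (1 - (w\<^sup>2) ^ Suc n) * (1 - w ^ (2 * n + 1))\<^sup>2) \<longlonglongrightarrow>
        euler_prod (w\<^sup>2) * (euler_prod w / euler_prod (w\<^sup>2))\<^sup>2"
      unfolding prod.distrib prod_power_distrib[symmetric]
      by (intro tendsto_mult tendsto_power euler_prod_tendsto prod_odd_tendsto w w2)
  qed (use nz in simp)
  also have "\<dots> = (euler_prod w)\<^sup>2 / euler_prod (w\<^sup>2)"
    using nz by (simp add: power2_eq_square)
  finally show ?thesis .
qed

lemma Theta23_eq:
  assumes "Im \<tau> > 0"
  shows "Theta2 \<tau> = (euler_prod (q_pow (1 / 2) \<tau>))\<^sup>2 / euler_prod (q_pow 1 \<tau>)"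
    "Theta3 \<tau> = (euler_prod (- q_pow (1 / 2) \<tau>))\<^sup>2 / euler_prod (q_pow 1 \<tau>)"
proof -
  let ?w = "q_pow (1 / 2) \<tau>"
  have w: "norm ?w < 1" "norm (- ?w) < 1" using norm_q_pow_less_1[of \<tau> "1 / 2"] assms by auto
  show "Theta2 \<tau> = (euler_prod ?w)\<^sup>2 / euler_prod (q_pow 1 \<tau>)"
    using theta_product[OF w(1)] unfolding Theta2_def q_pow_Suc q_pow_half q_pow_half_square .
  have "(- ?w) ^ (2 * n + 1) = - (?w ^ (2 * n + 1))" for n by (rule power_minus_odd) simp
  then show "Theta3 \<tau> = (euler_prod (- ?w))\<^sup>2 / euler_prod (q_pow 1 \<tau>)"
    using theta_product[OF w(2)] unfolding Theta3_def q_pow_Suc q_pow_half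
    by (simp add: q_pow_half_square del: power_Suc power_add)
qed

section \<open>Trace series of the vertex operators\<close>

text \<open>Brings the factor 1/(1 - y) of the Laguerre bound into exponential form, as required by
  \<open>has_sum_prod_keys\<close>.\<close>

lemma inverse_one_minus_le_exp:
  fixes y :: real
  assumes "y < 1"
  shows "1 / (1 - y) \<le> exp (y / (1 - y))"
proof -
  have "1 / (1 - y) = 1 + y / (1 - y)" using assms by (simp add: field_simps)
  then show ?thesis using exp_ge_add_one_self[of "y / (1 - y)"] by simp
qed

text \<open>The common evaluation for both sectors: \<open>r\<close> enumerates the modes and
  \<open>y n\<close> is the variable attached to the mode \<open>r n\<close>. For fixed n the 24
  oscillators merge, the squares h_i^2 adding up to \<open>N\<close> in the exponent. A sector then
  only has to supply the limit of the product.\<close>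

lemma monomial_series_has_sum:
  fixes h :: "complex^24" and r :: "nat \<Rightarrow> real" and y :: "nat \<Rightarrow> complex"
  assumes I: "I = range r" "I \<subseteq> positive_half_integers" "inj r"
    and h: "(\<Sum>i\<in>UNIV. (h $ i)\<^sup>2) = of_nat N"
    and y: "\<And>n. norm (y n) \<le> a" "a < 1" "summable (\<lambda>n. norm (y n))"
    and z: "\<And>n. z (r n) = y n"
    and lim: "(\<lambda>R. \<Prod>n<R. exp (- (of_nat N / of_real (r n) * (y n / (1 - y n)))) / (1 - y n) ^ 24) \<longlonglongrightarrow> S"
  shows "((\<lambda>m. lookup (E_coeff I h 0 (single m 1)) m * (\<Prod>x\<in>keys m. z (snd x) ^ lookup m x)) has_sum S)
    (mode_monos I)"
proof -
  define t where "t x = - ((h $ fst x)\<^sup>2 / of_real (snd x))" for x :: "24 \<times> real"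
  \<comment> \<open>The 2 comes from modes being at least 1/2; the sum over all coordinates bounds
    each single one.\<close>
  define C where "C = (\<Sum>i\<in>UNIV. 2 * norm (h $ i) ^ 2)"
  \<comment> \<open>Dominates norm t * y/(1 - y) + y/(1 - y) for y = norm (z (snd x)), using norm t
    \<le> C and y \<le> a; being linear in y, it is summable over all oscillators.\<close>
  define b where "b x = (C + 1) / (1 - a) * norm (z (snd x))" for x :: "24 \<times> real"
  define Y where "Y R = (UNIV :: 24 set) \<times> r ` {..<R}" for R :: nat
  let ?g = "\<lambda>x n. laguerre n (t x) * z (snd x) ^ n"
  let ?X = "(UNIV :: 24 set) \<times> I"
  have C0: "C \<ge> 0" unfolding C_def by (intro sum_nonneg) auto
  have rpos: "r n > 0" "r n \<ge> 1 / 2" for n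
  proof -
    have "r n \<in> positive_half_integers" using I by blast
    then show "r n > 0" "r n \<ge> 1 / 2" by (auto simp: positive_half_integers_def)
  qed
  have tC: "norm (t x) \<le> C" if "x \<in> ?X" for x
  proof -
    have "snd x \<in> range r" using that I(1) by auto
    then obtain n where n: "snd x = r n" by blast
    have "norm (t x) = norm (h $ fst x) ^ 2 / r n"
      using rpos(1)[of n] by (simp add: t_def n norm_divide norm_power)
    also have "\<dots> \<le> norm (h $ fst x) ^ 2 / (1 / 2)"
      using rpos[of n] by (intro divide_left_mono) auto
    also have "\<dots> = 2 * norm (h $ fst x) ^ 2" by simp
    also have "\<dots> \<le> C" unfolding C_def by (rule member_le_sum) auto
    finally show ?thesis .
  qed
  have za: "norm (z (snd x)) \<le> a" if "x \<in> ?X" for x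
    using that I(1) y(1) z by auto
  then have z1: "norm (z (snd x)) < 1" if "x \<in> ?X" for x
    using that y(2) by fastforce
  have "((\<lambda>m. \<Prod>x\<in>keys m. ?g x (lookup m x)) has_sum S) {m. keys m \<subseteq> ?X}"
  proof (rule has_sum_prod_keys[where b = b and Y = Y])
    show "?g x 0 = 1" for x by (simp add: laguerre_def)
    show "(\<lambda>n. norm (?g x n)) summable_on UNIV" if "x \<in> ?X" for x
      by (rule laguerre_abs_summable(1)[OF z1[OF that]])
    show "(\<Sum>\<^sub>\<infinity>n. norm (?g x n)) \<le> exp (b x)" if x: "x \<in> ?X" for x
    proof -
      let ?y = "norm (z (snd x))"
      have y1: "?y < 1" by (rule z1[OF x])
      have "(\<Sum>\<^sub>\<infinity>n. norm (?g x n)) \<le> exp (norm (t x) * ?y / (1 - ?y)) * (1 / (1 - ?y))"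
        using laguerre_abs_summable(2)[OF y1, of "t x"] by simp
      also have "\<dots> \<le> exp (norm (t x) * ?y / (1 - ?y)) * exp (?y / (1 - ?y))"
        by (intro mult_left_mono inverse_one_minus_le_exp y1) auto
      also have "\<dots> = exp ((norm (t x) + 1) * (?y / (1 - ?y)))"
        by (simp add: exp_add[symmetric] distrib_right add_divide_distrib)
      also have "\<dots> \<le> exp (b x)"
      proof -
        have "?y / (1 - ?y) \<le> ?y / (1 - a)"
          using za[OF x] y(2) y1 by (intro divide_left_mono) auto
        then have "(norm (t x) + 1) * (?y / (1 - ?y)) \<le> (C + 1) * (?y / (1 - a))"
          using tC[OF x] y1 C0 by (intro mult_mono) auto
        then show ?thesis by (simp add: b_def)
      qed
      finally show ?thesis .
    qed
    show "sum b F \<le> 24 * ((C + 1) / (1 - a) * suminf (\<lambda>n. norm (y n)))" if F: "finite F" "F \<subseteq> ?X" for F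
    proof -
      have b0: "b x \<ge> 0" for x unfolding b_def using C0 y(2) by (intro mult_nonneg_nonneg divide_nonneg_nonneg) auto
      define J where "J = {n. r n \<in> snd ` F}"
      have "J = r -` (snd ` F)" by (auto simp: J_def)
      then have J: "finite J" using finite_vimageI[OF _ I(3), of "snd ` F"] F(1) by simp
      have "F \<subseteq> UNIV \<times> r ` J" using F(2) I(1) by (force simp: J_def)
      then have "sum b F \<le> sum b (UNIV \<times> r ` J)"
        using b0 J by (intro sum_mono2) auto
      also have "\<dots> = (\<Sum>i\<in>(UNIV :: 24 set). \<Sum>s\<in>r ` J. b (i, s))"
        by (simp add: sum.cartesian_product)
      also have "\<dots> = 24 * (\<Sum>n\<in>J. (C + 1) / (1 - a) * norm (y n))"
        using I(3) by (simp add: b_def sum.reindex inj_on_def z)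
      also have "\<dots> = 24 * ((C + 1) / (1 - a) * (\<Sum>n\<in>J. norm (y n)))"
        by (simp add: sum_distrib_left)
      also have "\<dots> \<le> 24 * ((C + 1) / (1 - a) * suminf (\<lambda>n. norm (y n)))"
        using C0 y(2) by (intro mult_left_mono sum_le_suminf y J) auto
      finally show ?thesis .
    qed
    show "finite (Y R)" for R by (simp add: Y_def)
    show "incseq Y" unfolding Y_def by (intro incseq_SucI) auto
    show "(\<Union>R. Y R) = ?X" unfolding Y_def I(1) by auto
    have "(\<Prod>x\<in>Y R. infsum (?g x) UNIV) =
        (\<Prod>n<R. exp (- (of_nat N / of_real (r n) * (y n / (1 - y n)))) / (1 - y n) ^ 24)" for R
    proof -
      have "(\<Prod>x\<in>Y R. infsum (?g x) UNIV) =
          (\<Prod>x\<in>Y R. exp (t x * z (snd x) / (1 - z (snd x))) / (1 - z (snd x)))"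
      proof (rule prod.cong[OF refl])
        fix x assume "x \<in> Y R"
        then have "x \<in> ?X" using I(1) by (auto simp: Y_def)
        then show "infsum (?g x) UNIV = exp (t x * z (snd x) / (1 - z (snd x))) / (1 - z (snd x))"
          by (intro infsumI laguerre_has_sum z1)
      qed
      also have "\<dots> = (\<Prod>i\<in>UNIV. \<Prod>s\<in>r ` {..<R}. exp (t (i, s) * z s / (1 - z s)) / (1 - z s))"
        unfolding Y_def by (simp add: prod.cartesian_product split_def)
      also have "\<dots> = (\<Prod>i\<in>UNIV. \<Prod>n<R. exp (t (i, r n) * y n / (1 - y n)) / (1 - y n))"
        using inj_on_subset[OF I(3) subset_UNIV] by (simp add: prod.reindex z)
      also have "\<dots> = (\<Prod>n<R. \<Prod>i\<in>UNIV. exp (t (i, r n) * y n / (1 - y n)) / (1 - y n))"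
        by (rule prod.swap)
      also have "\<dots> = (\<Prod>n<R. exp (- (of_nat N / of_real (r n) * (y n / (1 - y n)))) / (1 - y n) ^ 24)"
      proof (rule prod.cong[OF refl])
        fix n
        have "(\<Sum>i\<in>UNIV. t (i, r n) * y n / (1 - y n)) = (\<Sum>i\<in>UNIV. (h $ i)\<^sup>2) * - (1 / of_real (r n) * (y n / (1 - y n)))"
          unfolding sum_distrib_right by (rule sum.cong) (auto simp: t_def)
        also have "\<dots> = - (of_nat N / of_real (r n) * (y n / (1 - y n)))" by (simp add: h)
        finally have e: "(\<Sum>i\<in>UNIV. t (i, r n) * y n / (1 - y n)) = - (of_nat N / of_real (r n) * (y n / (1 - y n)))" .
        show "(\<Prod>i\<in>UNIV. exp (t (i, r n) * y n / (1 - y n)) / (1 - y n)) =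
            exp (- (of_nat N / of_real (r n) * (y n / (1 - y n)))) / (1 - y n) ^ 24"
          unfolding prod_dividef exp_sum[OF finite, symmetric] e by simp
      qed
      finally show ?thesis .
    qed
    then show "(\<lambda>R. \<Prod>x\<in>Y R. infsum (?g x) UNIV) \<longlonglongrightarrow> S" using lim by simp
  qed
  moreover have X: "{m. keys m \<subseteq> ?X} = mode_monos I" by (auto simp: mode_monos_def)
  moreover have eq: "(\<Prod>x\<in>keys m. ?g x (lookup m x)) =
      lookup (E_coeff I h 0 (single m 1)) m * (\<Prod>x\<in>keys m. z (snd x) ^ lookup m x)"
    if "m \<in> mode_monos I" for m
    by (simp add: E_coeff_diagonal[OF I(2) that] prod.distrib t_def)
  ultimately show ?thesis using iffD1[OF has_sum_cong[OF eq]] by simp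
qed

text \<open>Attaching \<sigma> q^r to the mode r makes a monomial contribute q to its weight;
  \<sigma> = -1 inserts the action of t on the oscillators.\<close>

lemma prod_q_pow_modes:
  "(\<Prod>x\<in>keys m. (\<sigma> * q_pow (snd x) \<tau>) ^ lookup m x) = \<sigma> ^ mono_count m * q_pow (mono_weight m) \<tau>"
  by (simp add: power_mult_distrib prod.distrib q_pow_power q_pow_sum mono_count_def mono_weight_def power_sum)

lemma integer_modes_eq: "integer_modes = range (\<lambda>n. real n + 1)"
  and half_modes_eq: "half_modes = range (\<lambda>n. real n + 1 / 2)"
  by (auto simp: integer_modes_def half_modes_def)

lemma modes_positive_half_integers:
  "integer_modes \<subseteq> positive_half_integers" "half_modes \<subseteq> positive_half_integers"
proof -
  have "real n + 1 \<in> positive_half_integers" for n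
    unfolding positive_half_integers_def by (intro CollectI exI[of _ "2 * n + 2"]) simp
  then show "integer_modes \<subseteq> positive_half_integers" unfolding integer_modes_eq by blast
  have "real n + 1 / 2 \<in> positive_half_integers" for n
    unfolding positive_half_integers_def by (intro CollectI exI[of _ "2 * n + 1"]) (simp add: add_divide_distrib)
  then show "half_modes \<subseteq> positive_half_integers" unfolding half_modes_eq by blast
qed

lemma untwisted_series_has_sum:
  assumes h: "(\<Sum>i\<in>UNIV. (h $ i)\<^sup>2) = of_nat N" and \<tau>: "Im \<tau> > 0"
  defines "q \<equiv> q_pow 1 \<tau>"
  shows "((\<lambda>m. (-1) ^ mono_count m * lookup (E_coeff integer_modes h 0 (single m 1)) m * q_pow (mono_weight m) \<tau>)
    has_sum (((euler_prod (q\<^sup>2))\<^sup>2 / euler_prod q) ^ N * (euler_prod q / euler_prod (q\<^sup>2)) ^ 24))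
    (mode_monos integer_modes)"
proof -
  have q: "norm q < 1" unfolding q_def by (rule norm_q_pow_less_1) (use \<tau> in auto)
  let ?P = "((euler_prod (q\<^sup>2))\<^sup>2 / euler_prod q) ^ N * (euler_prod q / euler_prod (q\<^sup>2)) ^ 24"
  have "((\<lambda>m. lookup (E_coeff integer_modes h 0 (single m 1)) m *
      (\<Prod>x\<in>keys m. (\<lambda>s. - 1 * q_pow s \<tau>) (snd x) ^ lookup m x)) has_sum ?P) (mode_monos integer_modes)"
  proof (rule monomial_series_has_sum[where r = "\<lambda>n. real n + 1" and y = "\<lambda>n. - (q ^ Suc n)" and a = "norm q"])
    show "integer_modes = range (\<lambda>n. real n + 1)" by (rule integer_modes_eq)
    show "integer_modes \<subseteq> positive_half_integers" by (rule modes_positive_half_integers)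
    show "inj (\<lambda>n. real n + 1)" by (auto simp: inj_on_def)
    show "norm (- (q ^ Suc n)) \<le> norm q" for n
      using power_decreasing[of 1 "Suc n" "norm q"] q by (simp add: norm_power del: power_Suc)
    have "summable (\<lambda>n. norm q * norm q ^ n)"
      using q by (intro summable_mult summable_geometric) simp
    then show "summable (\<lambda>n. norm (- (q ^ Suc n)))" by (simp add: norm_mult norm_power)
    show "- 1 * q_pow (real n + 1) \<tau> = - (q ^ Suc n)" for n by (simp add: q_pow_Suc q_def del: power_Suc)
    show "(\<lambda>R. \<Prod>n<R. exp (- (of_nat N / of_real (real n + 1) * (- (q ^ Suc n) / (1 - - (q ^ Suc n))))) /
        (1 - - (q ^ Suc n)) ^ 24) \<longlonglongrightarrow> ?P"
    proof -
      have "complex_of_real (real n + 1) = of_nat (Suc n)" for n by simp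
      then show ?thesis using untwisted_product_tendsto[OF q, of N]
        by (simp del: of_nat_Suc power_Suc of_real_add)
    qed
  qed (use h q in auto)
  then show ?thesis unfolding prod_q_pow_modes by (simp add: mult_ac)
qed

text \<open>\<sigma> = 1 and \<sigma> = -1 are the traces without and with the sign action of t on
  the oscillators.\<close>

lemma twisted_series_has_sum:
  assumes h: "(\<Sum>i\<in>UNIV. (h $ i)\<^sup>2) = of_nat N" and \<tau>: "Im \<tau> > 0" and \<sigma>: "\<sigma> \<in> {1, -1}"
  defines "w \<equiv> \<sigma> * q_pow (1 / 2) \<tau>"
  shows "((\<lambda>m. \<sigma> ^ mono_count m * lookup (E_coeff half_modes h 0 (single m 1)) m * q_pow (mono_weight m) \<tau>)
    has_sum (((euler_prod w)\<^sup>2 / euler_prod (w\<^sup>2)) ^ N * (euler_prod (w\<^sup>2) / euler_prod w) ^ 24))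
    (mode_monos half_modes)"
proof -
  have w: "norm w < 1"
    using norm_q_pow_less_1[of \<tau> "1 / 2"] \<tau> \<sigma> by (auto simp: w_def norm_mult)
  let ?P = "((euler_prod w)\<^sup>2 / euler_prod (w\<^sup>2)) ^ N * (euler_prod (w\<^sup>2) / euler_prod w) ^ 24"
  have "((\<lambda>m. lookup (E_coeff half_modes h 0 (single m 1)) m *
      (\<Prod>x\<in>keys m. (\<lambda>s. \<sigma> * q_pow s \<tau>) (snd x) ^ lookup m x)) has_sum ?P) (mode_monos half_modes)"
  proof (rule monomial_series_has_sum[where r = "\<lambda>n. real n + 1 / 2" and y = "\<lambda>n. w ^ (2 * n + 1)" and a = "norm w"])
    show "half_modes = range (\<lambda>n. real n + 1 / 2)" by (rule half_modes_eq)
    show "half_modes \<subseteq> positive_half_integers" by (rule modes_positive_half_integers)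
    show "inj (\<lambda>n. real n + 1 / 2)" by (auto simp: inj_on_def)
    show le: "norm (w ^ (2 * n + 1)) \<le> norm w" for n
      using power_decreasing[of 1 "2 * n + 1" "norm w"] w by (simp add: norm_power del: power_Suc power_add)
    have "summable (\<lambda>n. norm w * norm w ^ n)"
      using w by (intro summable_mult summable_geometric) simp
    then show "summable (\<lambda>n. norm (w ^ (2 * n + 1)))"
    proof (rule summable_comparison_test'[where N = 0])
      show "norm (norm (w ^ (2 * n + 1))) \<le> norm w * norm w ^ n" for n
        using power_decreasing[of "Suc n" "2 * n + 1" "norm w"] w by (simp add: norm_power norm_mult del: power_add)
    qed
    \<comment> \<open>The sign can be absorbed into w because the exponent is odd.\<close>
    show "\<sigma> * q_pow (real n + 1 / 2) \<tau> = w ^ (2 * n + 1)" for n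
      using \<sigma> unfolding w_def power_mult_distrib q_pow_half by (auto simp del: power_add)
    show "(\<lambda>R. \<Prod>n<R. exp (- (of_nat N / of_real (real n + 1 / 2) * (w ^ (2 * n + 1) / (1 - w ^ (2 * n + 1))))) /
        (1 - w ^ (2 * n + 1)) ^ 24) \<longlonglongrightarrow> ?P"
    proof -
      have "of_nat N / complex_of_real (real n + 1 / 2) = of_nat N * 2 / of_nat (2 * n + 1)" for n
      proof -
        have "complex_of_real (real n + 1 / 2) = of_nat (2 * n + 1) / 2" by (simp add: field_simps)
        then show ?thesis by (simp only: divide_divide_eq_right)
      qed
      then show ?thesis using twisted_product_tendsto[OF w, of N] by (simp only:)
    qed
  qed (use h w in auto)
  then show ?thesis unfolding prod_q_pow_modes by (simp add: mult_ac)
qed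

section \<open>Traces, the lattice and linear operators on the state space\<close>

text \<open>On \<open>W\<close> the map \<open>f\<close> is \<Sum>j. \<phi> j v times
  \<open>f (e j)\<close>. Expanding \<open>f (e j)\<close> in the chosen basis and exchanging the
  sums turns the trace into an expression without that basis. The family \<open>e\<close> may be
  dependent, and \<open>\<phi>\<close> is any linear choice of coordinates.\<close>

lemma trace_on_spanning_family:
  assumes J: "finite J" and W: "mspace.subspace W" and e: "\<And>j. j \<in> J \<Longrightarrow> e j \<in> W"
    and \<phi>_add: "\<And>j v w. j \<in> J \<Longrightarrow> \<phi> j (v + w) = \<phi> j v + \<phi> j w"
    and \<phi>_scale: "\<And>j c v. j \<in> J \<Longrightarrow> \<phi> j (scale_moonshine c v) = c * \<phi> j v"
    and expand: "\<And>v. v \<in> W \<Longrightarrow> v = (\<Sum>j\<in>J. scale_moonshine (\<phi> j v) (e j))"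
    and f_add: "\<And>v w. f (v + w) = f v + f w"
    and f_scale: "\<And>c v. f (scale_moonshine c v) = scale_moonshine c (f v)"
    and f: "\<And>j. j \<in> J \<Longrightarrow> f (e j) \<in> W"
  shows "trace_on W f = (\<Sum>j\<in>J. \<phi> j (f (e j)))"
proof -
  define B where "B = (SOME B. mspace.independent B \<and> mspace.span B = W)"
  obtain B0 where B0: "B0 \<subseteq> W" "mspace.independent B0" "W \<subseteq> mspace.span B0"
    using mspace.maximal_independent_subset by blast
  have "mspace.span B0 = W"
    using B0 W by (simp add: mspace.span_minimal subset_antisym)
  with B0 have "\<exists>B. mspace.independent B \<and> mspace.span B = W" by blast
  then have B: "mspace.independent B" "mspace.span B = W"
    unfolding B_def by (rule someI2_ex; blast)+
  have BW: "b \<in> W" if "b \<in> B" for b using that B(2) mspace.span_base by blast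
  have "B \<subseteq> mspace.span (e ` J)"
  proof
    fix b assume "b \<in> B"
    then have "b = (\<Sum>j\<in>J. scale_moonshine (\<phi> j b) (e j))" by (intro expand BW)
    also have "\<dots> \<in> mspace.span (e ` J)"
      by (intro mspace.span_sum mspace.span_scale mspace.span_base imageI)
    finally show "b \<in> mspace.span (e ` J)" .
  qed
  \<comment> \<open>An independent set inside the span of finitely many vectors is finite, so the
    sum in \<open>trace_on\<close> is a genuine sum.\<close>
  then have finB: "finite B"
    using mspace.independent_span_bound[of "e ` J" B] B(1) J by simp
  have f_sum: "f (sum g S) = (\<Sum>x\<in>S. f (g x))" if "finite S" for g and S :: "'a set"
  proof -
    have "f 0 = 0" using f_add[of 0 0] by simp
    with that show ?thesis by (induction S rule: finite_induct) (simp_all add: f_add)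
  qed
  have \<phi>_sum: "\<phi> j (sum g S) = (\<Sum>x\<in>S. \<phi> j (g x))" if "finite S" "j \<in> J" for j g and S :: "moonshine set"
  proof -
    have "\<phi> j 0 = 0" using \<phi>_add[OF that(2), of 0 0] by simp
    with that(1) show ?thesis by (induction S rule: finite_induct) (simp_all add: \<phi>_add[OF that(2)])
  qed
  have "mspace.representation B (f b) b =
      (\<Sum>j\<in>J. \<phi> j b * mspace.representation B (f (e j)) b)" if "b \<in> B" for b
  proof -
    have "f b = f (\<Sum>j\<in>J. scale_moonshine (\<phi> j b) (e j))"
      using expand[OF BW[OF that]] by (rule arg_cong)
    also have "\<dots> = (\<Sum>j\<in>J. scale_moonshine (\<phi> j b) (f (e j)))"
      by (simp add: f_sum[OF J] f_scale)
    finally have fb: "f b = (\<Sum>j\<in>J. scale_moonshine (\<phi> j b) (f (e j)))" .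
    have "mspace.representation B (f b) = (\<lambda>c. \<Sum>j\<in>J. mspace.representation B (scale_moonshine (\<phi> j b) (f (e j))) c)"
      unfolding fb by (rule mspace.representation_sum[OF B(1)]) (use f B(2) mspace.span_scale in blast)
    also have "\<dots> = (\<lambda>c. \<Sum>j\<in>J. \<phi> j b * mspace.representation B (f (e j)) c)"
      using f B by (intro ext sum.cong refl) (simp add: mspace.representation_scale)
    finally show ?thesis by simp
  qed
  then have "trace_on W f = (\<Sum>b\<in>B. \<Sum>j\<in>J. \<phi> j b * mspace.representation B (f (e j)) b)"
    by (simp add: trace_on_def Let_def B_def[symmetric])
  also have "\<dots> = (\<Sum>j\<in>J. \<Sum>b\<in>B. \<phi> j b * mspace.representation B (f (e j)) b)"
    by (rule sum.swap)
  also have "\<dots> = (\<Sum>j\<in>J. \<phi> j (f (e j)))"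
  proof (rule sum.cong[OF refl])
    fix j assume j: "j \<in> J"
    have "f (e j) = (\<Sum>b\<in>B. scale_moonshine (mspace.representation B (f (e j)) b) b)"
      using mspace.sum_representation_eq[OF B(1) _ finB subset_refl, of "f (e j)"] f[OF j] B(2) by simp
    then have "\<phi> j (f (e j)) = \<phi> j (\<Sum>b\<in>B. scale_moonshine (mspace.representation B (f (e j)) b) b)"
      by (rule arg_cong)
    also have "\<dots> = (\<Sum>b\<in>B. \<phi> j b * mspace.representation B (f (e j)) b)"
      by (simp add: \<phi>_sum[OF finB j] \<phi>_scale[OF j] mult.commute)
    finally show "(\<Sum>b\<in>B. \<phi> j b * mspace.representation B (f (e j)) b) = \<phi> j (f (e j))" by simp
  qed
  finally show ?thesis .
qed

text \<open>The closure properties are read off from self-duality, which describes \<Lambda> by a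
  condition linear in the vector.\<close>

lemma leech_lattice_add: "leech_lattice \<Lambda> \<Longrightarrow> x \<in> \<Lambda> \<Longrightarrow> y \<in> \<Lambda> \<Longrightarrow> x + y \<in> \<Lambda>"
  and leech_lattice_uminus: "leech_lattice \<Lambda> \<Longrightarrow> x \<in> \<Lambda> \<Longrightarrow> - x \<in> \<Lambda>"
  and leech_lattice_0: "leech_lattice \<Lambda> \<Longrightarrow> 0 \<in> \<Lambda>"
proof -
  assume L: "leech_lattice \<Lambda>"
  then have dual: "\<Lambda> = {y. \<forall>x\<in>\<Lambda>. x \<bullet> y \<in> \<int>}" by (auto simp: leech_lattice_def)
  show "x + y \<in> \<Lambda>" if "x \<in> \<Lambda>" "y \<in> \<Lambda>" using that by (subst (asm) (1 2) dual, subst dual) (auto simp: inner_add_right)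
  show "- x \<in> \<Lambda>" if "x \<in> \<Lambda>" using that by (subst (asm) dual, subst dual) auto
  show "0 \<in> \<Lambda>" by (subst dual) auto
qed

lemma leech_lattice_norm:
  assumes "leech_lattice \<Lambda>" "x \<in> \<Lambda>"
  obtains k :: nat where "x \<bullet> x = 2 * real k"
proof -
  obtain k :: int where k: "x \<bullet> x = 2 * of_int k" using assms by (auto simp: leech_lattice_def)
  moreover have "k \<ge> 0" using inner_ge_zero[of x] k by simp
  ultimately show ?thesis using that[of "nat k"] by simp
qed

text \<open>An infinite bounded subset would accumulate and so contain two distinct points at
  distance below 1, but nonzero lattice vectors have squared length at least 2.\<close>

lemma finite_leech_lattice_ball:
  assumes L: "leech_lattice \<Lambda>"
  shows "finite {x \<in> \<Lambda>. x \<bullet> x \<le> c}"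
proof (rule ccontr)
  assume inf: "infinite {x \<in> \<Lambda>. x \<bullet> x \<le> c}"
  let ?S = "{x \<in> \<Lambda>. x \<bullet> x \<le> c}"
  have "?S \<subseteq> cball 0 (sqrt c)"
    by (auto simp: norm_eq_sqrt_inner)
  then obtain z where "z islimpt ?S"
    using inf compact_cball[of "0::real^24" "sqrt c"] unfolding compact_eq_Bolzano_Weierstrass by blast
  then have inf': "infinite (?S \<inter> ball z (1 / 2))" unfolding islimpt_eq_infinite_ball by simp
  then obtain x where x: "x \<in> ?S \<inter> ball z (1 / 2)" using infinite_imp_nonempty by blast
  have "infinite (?S \<inter> ball z (1 / 2) - {x})" using inf' by (rule infinite_remove)
  then obtain y where y: "y \<in> ?S \<inter> ball z (1 / 2)" "y \<noteq> x" using infinite_imp_nonempty by blast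
  have "x - y \<in> \<Lambda>" using leech_lattice_add[OF L, of x "- y"] leech_lattice_uminus[OF L, of y] x y by simp
  then obtain k :: nat where k: "(x - y) \<bullet> (x - y) = 2 * real k" by (rule leech_lattice_norm[OF L])
  have "k \<noteq> 0" using k y(2) inner_eq_zero_iff[of "x - y"] by (intro notI) simp
  then have "(norm (x - y))\<^sup>2 \<ge> 2" using k by (simp add: power2_norm_eq_inner)
  moreover have "norm (x - y) < 1"
    using x y dist_triangle_half_r[of z x 1 y] by (simp add: dist_norm)
  then have "(norm (x - y))\<^sup>2 < 1" by (simp add: power_less_one_iff)
  ultimately show False by simp
qed

text \<open>By bilinearity negation inverts the value, and 1 and -1 are their own inverses. Hence
  the cocycle does not obstruct compatibility with t.\<close>

lemma bilinear_cocycle_uminus: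
  assumes L: "leech_lattice \<Lambda>" and \<epsilon>: "bilinear_cocycle \<Lambda> \<epsilon>" and "\<alpha> \<in> \<Lambda>" "\<beta> \<in> \<Lambda>"
  shows "\<epsilon> (- \<alpha>) \<beta> = \<epsilon> \<alpha> \<beta>" "\<epsilon> \<alpha> (- \<beta>) = \<epsilon> \<alpha> \<beta>"
proof -
  have pm: "\<epsilon> x y = 1 \<or> \<epsilon> x y = -1" if "x \<in> \<Lambda>" "y \<in> \<Lambda>" for x y
    using \<epsilon> that unfolding bilinear_cocycle_def by blast
  have add: "\<epsilon> (x + y) z = \<epsilon> x z * \<epsilon> y z" "\<epsilon> z (x + y) = \<epsilon> z x * \<epsilon> z y"
    if "x \<in> \<Lambda>" "y \<in> \<Lambda>" "z \<in> \<Lambda>" for x y z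
    using \<epsilon> that unfolding bilinear_cocycle_def by blast+
  note z = leech_lattice_0[OF L] and m = leech_lattice_uminus[OF L]
  have "\<epsilon> 0 \<beta> = 1" "\<epsilon> \<alpha> 0 = 1"
    using add[OF z z assms(4)] add[OF z z assms(3)] pm[OF z assms(4)] pm[OF assms(3) z] by auto
  then have "\<epsilon> \<alpha> \<beta> * \<epsilon> (- \<alpha>) \<beta> = 1" "\<epsilon> \<alpha> \<beta> * \<epsilon> \<alpha> (- \<beta>) = 1"
    using add(1)[OF assms(3) m[OF assms(3)] assms(4)] add(2)[OF assms(4) m[OF assms(4)] assms(3)] by auto
  then show "\<epsilon> (- \<alpha>) \<beta> = \<epsilon> \<alpha> \<beta>" "\<epsilon> \<alpha> (- \<beta>) = \<epsilon> \<alpha> \<beta>"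
    using pm[OF assms(3,4)] pm[OF m[OF assms(3)] assms(4)] pm[OF assms(3) m[OF assms(4)]] by auto
qed

section \<open>Linear operators on states\<close>

definition state_linear :: "(('a \<Rightarrow>\<^sub>0 fock) \<Rightarrow> ('b \<Rightarrow>\<^sub>0 fock)) \<Rightarrow> bool" where
  "state_linear L \<longleftrightarrow> (\<forall>u v. L (u + v) = L u + L v) \<and> (\<forall>c u. L (scale_state c u) = scale_state c (L u))"

lemma state_linear_add: "state_linear L \<Longrightarrow> L (u + v) = L u + L v"
  and state_linear_scale: "state_linear L \<Longrightarrow> L (scale_state c u) = scale_state c (L u)"
  by (auto simp: state_linear_def)

lemma scale_state_add: "scale_state c (u + v) = scale_state c u + scale_state c v"
  by (rule poly_mapping_eqI) (simp add: lookup_scale_state lookup_add algebra_simps)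

lemma scale_state_0 [simp]: "scale_state c 0 = 0" "scale_state 0 u = 0"
  by (rule poly_mapping_eqI; simp add: lookup_scale_state)+

lemma scale_state_sum: "scale_state c (sum f S) = (\<Sum>x\<in>S. scale_state c (f x))"
  by (induction S rule: infinite_finite_induct) (auto simp: scale_state_add)

lemma scale_state_single: "scale_state c (single l p) = single l (const_fock c * p)"
  by (rule poly_mapping_eqI) (simp add: lookup_scale_state lookup_single when_def)

lemma state_linear_0: "state_linear L \<Longrightarrow> L 0 = 0"
  using state_linear_scale[of L 0 0] by simp

lemma state_linear_sum: "state_linear L \<Longrightarrow> L (sum f S) = (\<Sum>x\<in>S. L (f x))"
  by (induction S rule: infinite_finite_induct) (auto simp: state_linear_add state_linear_0)

lemma state_linear_plus: "state_linear L \<Longrightarrow> state_linear K \<Longrightarrow> state_linear (\<lambda>u. L u + K u)"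
  by (auto simp: state_linear_def scale_state_add algebra_simps)

lemma state_linear_compose: "state_linear L \<Longrightarrow> state_linear K \<Longrightarrow> state_linear (\<lambda>u. L (K u))"
  by (auto simp: state_linear_def)

text \<open>All operators on states are defined as sums over the support of the argument; the
  support may shrink under addition or scaling, which is harmless as each summand vanishes at
  0.\<close>

lemma state_linear_ext:
  assumes G: "\<And>l p q. G l (p + q) = G l p + G l q" "\<And>l c p. G l (const_fock c * p) = scale_state c (G l p)"
  shows "state_linear (\<lambda>u. \<Sum>l\<in>keys u. G l (lookup u l))"
proof -
  have G0: "G l 0 = 0" for l using G(2)[of l 0 0] by simp
  have "keys (scale_state c u) \<subseteq> keys u" for c and u :: "'a \<Rightarrow>\<^sub>0 fock"
    by (auto simp: in_keys_iff lookup_scale_state)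
  then have "(\<Sum>l\<in>keys (scale_state c u). G l (lookup (scale_state c u) l)) =
      (\<Sum>l\<in>keys u. G l (lookup (scale_state c u) l))" for c u
    by (intro sum_keys_superset) (auto simp: G0)
  then show ?thesis
    unfolding state_linear_def
    by (auto simp: G G0 lookup_scale_state scale_state_sum intro!: setsum_keys_plus_distrib)
qed

text \<open>Agreement is asked for only on the support of \<open>u\<close>, since the cocycle
  identities are available only on \<Lambda>.\<close>

lemma state_linear_eq:
  assumes L: "state_linear L" and K: "state_linear K"
    and eq: "\<And>l p. l \<in> keys u \<Longrightarrow> L (single l p) = K (single l p)"
  shows "L u = K u"
proof -
  have "L u = L (\<Sum>l\<in>keys u. single l (lookup u l))" by (simp add: poly_mapping_sum_single)
  also have "\<dots> = K (\<Sum>l\<in>keys u. single l (lookup u l))"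
    by (simp add: state_linear_sum[OF L] state_linear_sum[OF K] eq)
  also have "\<dots> = K u" by (simp add: poly_mapping_sum_single)
  finally show ?thesis .
qed

lemma state_linear_t_untwisted: "state_linear t_untwisted"
  unfolding t_untwisted_def[abs_def]
  by (rule state_linear_ext)
    (simp_all add: flinear_add[OF flinear_sign_fock] flinear_scale[OF flinear_sign_fock] single_add scale_state_single)

lemma state_linear_t_twisted: "state_linear t_twisted"
  unfolding t_twisted_def[abs_def]
  by (rule state_linear_ext)
    (simp_all add: flinear_add[OF flinear_sign_fock] flinear_scale[OF flinear_sign_fock]
      scale_state_single minus_add_distrib single_add[symmetric])

lemma t_untwisted_single: "t_untwisted (single \<alpha> p) = single (- \<alpha>) (sign_fock p)"
  by (cases "p = 0") (auto simp: t_untwisted_def flinear_0[OF flinear_sign_fock])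

lemma t_twisted_single: "t_twisted (single s p) = single s (- sign_fock p)"
  by (cases "p = 0") (auto simp: t_twisted_def flinear_0[OF flinear_sign_fock])

lemmas flinear_E_coeff_integer = flinear_E_coeff[OF modes_positive_half_integers(1)]
lemmas flinear_E_coeff_half = flinear_E_coeff[OF modes_positive_half_integers(2)]

lemma const_fock_commute: "const_fock c * (const_fock d * p) = const_fock d * (const_fock c * p)"
  by (simp add: const_fock_mult_assoc mult.commute)

lemma state_linear_Y_untwisted: "state_linear (Y_untwisted \<epsilon> \<alpha> r)"
  unfolding Y_untwisted_def[abs_def]
  by (rule state_linear_ext)
    (simp_all add: flinear_add[OF flinear_E_coeff_integer] flinear_scale[OF flinear_E_coeff_integer]
      scale_state_single distrib_left single_add const_fock_commute)

lemma state_linear_Y_twisted: "state_linear (Y_twisted \<rho> \<beta> r)"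
  unfolding Y_twisted_def[abs_def]
  by (rule state_linear_ext)
    (simp_all add: flinear_add[OF flinear_E_coeff_half] flinear_scale[OF flinear_E_coeff_half]
      scale_state_single scale_state_sum sum.distrib distrib_left single_add const_fock_commute)

lemma Y_untwisted_single:
  "Y_untwisted \<epsilon> \<alpha> r (single \<beta> p) = single (\<alpha> + \<beta>)
     (const_fock (\<epsilon> \<alpha> \<beta>) * E_coeff integer_modes (complexify (- \<alpha>)) (r - \<alpha> \<bullet> \<beta>) p)"
  by (cases "p = 0") (auto simp: Y_untwisted_def flinear_0[OF flinear_E_coeff_integer])

lemma Y_twisted_single:
  assumes "\<rho> \<beta> = mat 1"
  shows "Y_twisted \<rho> \<beta> r (single s p) = single s
     (const_fock (complex_of_real (2 powr (- (\<beta> \<bullet> \<beta>)))) *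
       E_coeff half_modes (complexify (- \<beta>)) (r + (\<beta> \<bullet> \<beta>) / 2) p)"
proof -
  let ?G = "const_fock (complex_of_real (2 powr (- (\<beta> \<bullet> \<beta>)))) *
       E_coeff half_modes (complexify (- \<beta>)) (r + (\<beta> \<bullet> \<beta>) / 2) p"
  have *: "single t (const_fock (complex_of_real (2 powr (- (\<beta> \<bullet> \<beta>))) * \<rho> \<beta> $ t $ s) *
       E_coeff half_modes (complexify (- \<beta>)) (r + (\<beta> \<bullet> \<beta>) / 2) p) = (if t = s then single s ?G else 0)" for t
    by (simp add: assms mat_def)
  have "Y_twisted \<rho> \<beta> r (single s p) = (\<Sum>t\<in>UNIV. if t = s then single s ?G else 0)"
  proof (cases "p = 0")
    case False
    then have "Y_twisted \<rho> \<beta> r (single s p) = (\<Sum>t\<in>UNIV. single t (const_fock (complex_of_real (2 powr (- (\<beta> \<bullet> \<beta>))) * \<rho> \<beta> $ t $ s) *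
       E_coeff half_modes (complexify (- \<beta>)) (r + (\<beta> \<bullet> \<beta>) / 2) p))"
      by (simp add: Y_twisted_def)
    then show ?thesis unfolding * .
  qed (simp add: Y_twisted_def flinear_0[OF flinear_E_coeff_half])
  then show ?thesis by simp
qed

section \<open>The zero mode on the homogeneous components\<close>

lemma keys_const_fock: "keys (const_fock c) = (if c = 0 then {} else {0})"
  by (simp add: const_fock_def)

lemma keys_const_fock_mult: "keys (const_fock c * p) \<subseteq> keys p"
  by (auto simp: in_keys_iff)

lemma state_linear_scale_state: "state_linear (scale_state c)"
proof -
  have "scale_state c (scale_state d u) = scale_state d (scale_state c u)" for d and u :: "'a \<Rightarrow>\<^sub>0 fock"
    by (rule poly_mapping_eqI) (simp add: lookup_scale_state const_fock_commute)
  then show ?thesis by (simp add: state_linear_def scale_state_add)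
qed

definition untwisted_part :: "(real^24) set \<Rightarrow> nat \<Rightarrow> ((real^24) \<Rightarrow>\<^sub>0 fock) set" where
  "untwisted_part \<Lambda> n = {u. \<forall>\<gamma>. \<forall>m\<in>keys (lookup u \<gamma>). \<gamma> \<in> \<Lambda> \<and> m \<in> mode_monos integer_modes \<and>
     mono_weight m + (\<gamma> \<bullet> \<gamma>) / 2 = real n}"

definition twisted_part :: "nat \<Rightarrow> (4096 \<Rightarrow>\<^sub>0 fock) set" where
  "twisted_part n = {w. \<forall>s. \<forall>m\<in>keys (lookup w s). m \<in> mode_monos half_modes \<and> mono_weight m + 3 / 2 = real n}"

text \<open>Recasts support, admissible modes and degree as one condition on each occurring
  monomial, in which form closure under addition and scaling is immediate.\<close>

lemma moonshine_graded_eq: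
  "moonshine_graded \<Lambda> n =
    {u \<in> untwisted_part \<Lambda> n. t_untwisted u = u} \<times> {w \<in> twisted_part n. t_twisted w = w}"
proof -
  have "keys u \<subseteq> \<Lambda> \<longleftrightarrow> (\<forall>\<gamma>. \<forall>m\<in>keys (lookup u \<gamma>). \<gamma> \<in> \<Lambda>)" for u :: "(real^24) \<Rightarrow>\<^sub>0 fock"
  proof
    assume k: "\<forall>\<gamma>. \<forall>m\<in>keys (lookup u \<gamma>). \<gamma> \<in> \<Lambda>"
    show "keys u \<subseteq> \<Lambda>"
    proof
      fix \<gamma> assume "\<gamma> \<in> keys u"
      then have "keys (lookup u \<gamma>) \<noteq> {}" by (simp add: in_keys_iff)
      then show "\<gamma> \<in> \<Lambda>" using k by blast
    qed
  next
    assume k: "keys u \<subseteq> \<Lambda>"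
    show "\<forall>\<gamma>. \<forall>m\<in>keys (lookup u \<gamma>). \<gamma> \<in> \<Lambda>"
    proof (intro allI ballI)
      fix \<gamma> m assume "m \<in> keys (lookup u \<gamma>)"
      then have "lookup u \<gamma> \<noteq> 0" by auto
      then show "\<gamma> \<in> \<Lambda>" using k by (auto simp: in_keys_iff)
    qed
  qed
  then show ?thesis
    unfolding moonshine_graded_def moonshine_module_def lattice_voa_def twisted_module_def
      untwisted_part_def twisted_part_def fock_space_def mode_monos_def
    by blast
qed

lemma untwisted_part_0: "0 \<in> untwisted_part \<Lambda> n" and twisted_part_0: "0 \<in> twisted_part n"
  by (auto simp: untwisted_part_def twisted_part_def)

lemma untwisted_part_add:
  assumes "u \<in> untwisted_part \<Lambda> n" "v \<in> untwisted_part \<Lambda> n"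
  shows "u + v \<in> untwisted_part \<Lambda> n"
proof -
  have "m \<in> keys (lookup u \<gamma>) \<or> m \<in> keys (lookup v \<gamma>)" if "m \<in> keys (lookup (u + v) \<gamma>)" for m \<gamma>
    using that Poly_Mapping.keys_add[of "lookup u \<gamma>" "lookup v \<gamma>"] unfolding lookup_add by blast
  then show ?thesis using assms unfolding untwisted_part_def by blast
qed

lemma untwisted_part_scale:
  assumes "u \<in> untwisted_part \<Lambda> n"
  shows "scale_state c u \<in> untwisted_part \<Lambda> n"
proof -
  have "m \<in> keys (lookup u \<gamma>)" if "m \<in> keys (lookup (scale_state c u) \<gamma>)" for m \<gamma>
    using that keys_const_fock_mult[of c "lookup u \<gamma>"] unfolding lookup_scale_state by blast
  then show ?thesis using assms unfolding untwisted_part_def by blast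
qed

lemma twisted_part_add:
  assumes "u \<in> twisted_part n" "v \<in> twisted_part n"
  shows "u + v \<in> twisted_part n"
proof -
  have "m \<in> keys (lookup u s) \<or> m \<in> keys (lookup v s)" if "m \<in> keys (lookup (u + v) s)" for m s
    using that Poly_Mapping.keys_add[of "lookup u s" "lookup v s"] unfolding lookup_add by blast
  then show ?thesis using assms unfolding twisted_part_def by blast
qed

lemma twisted_part_scale:
  assumes "u \<in> twisted_part n"
  shows "scale_state c u \<in> twisted_part n"
proof -
  have "m \<in> keys (lookup u s)" if "m \<in> keys (lookup (scale_state c u) s)" for m s
    using that keys_const_fock_mult[of c "lookup u s"] unfolding lookup_scale_state by blast
  then show ?thesis using assms unfolding twisted_part_def by blast
qed

lemma subspace_moonshine_graded: "mspace.subspace (moonshine_graded \<Lambda> n)"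
  unfolding moonshine_graded_eq
  by (rule mspace.subspaceI)
    (auto simp: scale_moonshine_def untwisted_part_add untwisted_part_scale twisted_part_add twisted_part_scale
      state_linear_add[OF state_linear_t_untwisted] state_linear_scale[OF state_linear_t_untwisted]
      state_linear_add[OF state_linear_t_twisted] state_linear_scale[OF state_linear_t_twisted]
      state_linear_0[OF state_linear_t_untwisted] state_linear_0[OF state_linear_t_twisted]
      untwisted_part_0 twisted_part_0 zero_prod_def)

lemma keys_lookup_single: "m \<in> keys (lookup (single l p) l') \<longleftrightarrow> l' = l \<and> m \<in> keys p"
  by (auto simp: lookup_single when_def split: if_splits)

lemma keys_Y_untwisted:
  assumes "m \<in> keys (lookup (Y_untwisted \<epsilon> \<alpha> r u) \<gamma>)"
  obtains \<beta> m0 where "m0 \<in> keys (lookup u \<beta>)" "\<gamma> = \<alpha> + \<beta>" "mono_weight m = mono_weight m0 + (r - \<alpha> \<bullet> \<beta>)"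
    "m0 \<in> mode_monos integer_modes \<Longrightarrow> m \<in> mode_monos integer_modes"
proof -
  obtain \<beta> where "m \<in> keys (lookup (single (\<alpha> + \<beta>)
     (const_fock (\<epsilon> \<alpha> \<beta>) * E_coeff integer_modes (complexify (-\<alpha>)) (r - \<alpha> \<bullet> \<beta>) (lookup u \<beta>))) \<gamma>)"
    using assms unfolding Y_untwisted_def lookup_sum by (rule in_keys_sumE)
  then have \<beta>: "\<gamma> = \<alpha> + \<beta>" and
    "m \<in> keys (E_coeff integer_modes (complexify (-\<alpha>)) (r - \<alpha> \<bullet> \<beta>) (lookup u \<beta>))"
    using keys_const_fock_mult unfolding keys_lookup_single by blast+
  then show ?thesis
    by (elim keys_E_coeff[OF modes_positive_half_integers(1)]) (rule that)
qed

lemma keys_Y_twisted: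
  assumes "m \<in> keys (lookup (Y_twisted \<rho> \<beta> r w) t)"
  obtains s m0 where "m0 \<in> keys (lookup w s)" "mono_weight m = mono_weight m0 + (r + (\<beta> \<bullet> \<beta>) / 2)"
    "m0 \<in> mode_monos half_modes \<Longrightarrow> m \<in> mode_monos half_modes"
proof -
  obtain s where "m \<in> keys (\<Sum>t'\<in>UNIV. lookup (single t'
     (const_fock (complex_of_real (2 powr (- (\<beta> \<bullet> \<beta>))) * \<rho> \<beta> $ t' $ s) *
        E_coeff half_modes (complexify (-\<beta>)) (r + (\<beta> \<bullet> \<beta>) / 2) (lookup w s))) t)"
    using assms unfolding Y_twisted_def lookup_sum by (rule in_keys_sumE)
  then obtain t' where "m \<in> keys (lookup (single t'
     (const_fock (complex_of_real (2 powr (- (\<beta> \<bullet> \<beta>))) * \<rho> \<beta> $ t' $ s) *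
        E_coeff half_modes (complexify (-\<beta>)) (r + (\<beta> \<bullet> \<beta>) / 2) (lookup w s))) t)"
    by (rule in_keys_sumE)
  then have "m \<in> keys (E_coeff half_modes (complexify (-\<beta>)) (r + (\<beta> \<bullet> \<beta>) / 2) (lookup w s))"
    using keys_const_fock_mult unfolding keys_lookup_single by blast
  then show ?thesis
    by (elim keys_E_coeff[OF modes_positive_half_integers(2)]) (rule that)
qed

text \<open>Passing from e^\<beta> to e^(\<alpha>+\<beta>) raises the degree by
  \<langle>\<alpha>,\<beta>\<rangle> + \<langle>\<alpha>,\<alpha>\<rangle>/2, exactly what the
  oscillator part loses at this power of z.\<close>

lemma Y_untwisted_part:
  assumes L: "leech_lattice \<Lambda>" and \<alpha>: "\<alpha> \<in> \<Lambda>" and u: "u \<in> untwisted_part \<Lambda> n"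
  shows "Y_untwisted \<epsilon> \<alpha> (- (\<alpha> \<bullet> \<alpha>) / 2) u \<in> untwisted_part \<Lambda> n"
  unfolding untwisted_part_def
proof (intro CollectI allI ballI)
  fix \<gamma> m assume "m \<in> keys (lookup (Y_untwisted \<epsilon> \<alpha> (- (\<alpha> \<bullet> \<alpha>) / 2) u) \<gamma>)"
  then obtain \<beta> m0 where m0: "m0 \<in> keys (lookup u \<beta>)" and \<gamma>: "\<gamma> = \<alpha> + \<beta>"
    and w: "mono_weight m = mono_weight m0 + (- (\<alpha> \<bullet> \<alpha>) / 2 - \<alpha> \<bullet> \<beta>)"
    and I: "m0 \<in> mode_monos integer_modes \<Longrightarrow> m \<in> mode_monos integer_modes"
    by (rule keys_Y_untwisted) (rule that)
  have "\<beta> \<in> \<Lambda>" "m0 \<in> mode_monos integer_modes" "mono_weight m0 + (\<beta> \<bullet> \<beta>) / 2 = real n"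
    using u m0 unfolding untwisted_part_def by blast+
  then show "\<gamma> \<in> \<Lambda> \<and> m \<in> mode_monos integer_modes \<and> mono_weight m + (\<gamma> \<bullet> \<gamma>) / 2 = real n"
    using leech_lattice_add[OF L \<alpha>] I w unfolding \<gamma>
    by (simp add: inner_add_left inner_add_right inner_commute add_divide_distrib)
qed

text \<open>The chosen power of z equals the prefactor of the twisted vertex operator, so the
  oscillator part has degree 0.\<close>

lemma Y_twisted_part:
  assumes u: "w \<in> twisted_part n"
  shows "Y_twisted \<rho> \<beta> (- (\<beta> \<bullet> \<beta>) / 2) w \<in> twisted_part n"
  unfolding twisted_part_def
proof (intro CollectI allI ballI)
  fix t m assume "m \<in> keys (lookup (Y_twisted \<rho> \<beta> (- (\<beta> \<bullet> \<beta>) / 2) w) t)"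
  then obtain s m0 where m0: "m0 \<in> keys (lookup w s)"
    and w: "mono_weight m = mono_weight m0 + (- (\<beta> \<bullet> \<beta>) / 2 + (\<beta> \<bullet> \<beta>) / 2)"
    and I: "m0 \<in> mode_monos half_modes \<Longrightarrow> m \<in> mode_monos half_modes"
    by (rule keys_Y_twisted) (rule that)
  have "m0 \<in> mode_monos half_modes" "mono_weight m0 + 3 / 2 = real n"
    using u m0 unfolding twisted_part_def by blast+
  then show "m \<in> mode_monos half_modes \<and> mono_weight m + 3 / 2 = real n"
    using I w by simp
qed

lemma complexify_uminus: "complexify (- \<alpha>) = - complexify \<alpha>"
  by (simp add: complexify_def vec_eq_iff)

text \<open>Conjugation by t carries the modes of e^\<alpha> to those of e^(-\<alpha>), which is why
  the zero mode of e^\<lambda> + e^(-\<lambda>) preserves the fixed points.\<close>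

lemma t_untwisted_Y_untwisted:
  assumes L: "leech_lattice \<Lambda>" and \<epsilon>: "bilinear_cocycle \<Lambda> \<epsilon>" and \<alpha>: "\<alpha> \<in> \<Lambda>" and u: "keys u \<subseteq> \<Lambda>"
  shows "t_untwisted (Y_untwisted \<epsilon> \<alpha> r u) = Y_untwisted \<epsilon> (- \<alpha>) r (t_untwisted u)"
proof (rule state_linear_eq[where L = "\<lambda>u. t_untwisted (Y_untwisted \<epsilon> \<alpha> r u)"
      and K = "\<lambda>u. Y_untwisted \<epsilon> (- \<alpha>) r (t_untwisted u)"])
  show "state_linear (\<lambda>u. t_untwisted (Y_untwisted \<epsilon> \<alpha> r u))"
    by (rule state_linear_compose[OF state_linear_t_untwisted state_linear_Y_untwisted])
  show "state_linear (\<lambda>u. Y_untwisted \<epsilon> (- \<alpha>) r (t_untwisted u))"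
    by (rule state_linear_compose[OF state_linear_Y_untwisted state_linear_t_untwisted])
  fix \<beta> p assume "\<beta> \<in> keys u"
  then have \<beta>: "\<beta> \<in> \<Lambda>" using u by blast
  have "\<epsilon> (- \<alpha>) (- \<beta>) = \<epsilon> \<alpha> \<beta>"
    using bilinear_cocycle_uminus[OF L \<epsilon>] \<alpha> \<beta> leech_lattice_uminus[OF L] by metis
  then show "t_untwisted (Y_untwisted \<epsilon> \<alpha> r (single \<beta> p)) = Y_untwisted \<epsilon> (- \<alpha>) r (t_untwisted (single \<beta> p))"
    by (simp add: Y_untwisted_single t_untwisted_single flinear_scale[OF flinear_sign_fock]
        sign_fock_E_coeff[OF modes_positive_half_integers(1)] complexify_uminus)
qed

lemma t_twisted_Y_twisted:
  assumes \<rho>: "\<rho> \<beta> = mat 1" "\<rho> (- \<beta>) = mat 1"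
  shows "t_twisted (Y_twisted \<rho> \<beta> r w) = Y_twisted \<rho> (- \<beta>) r (t_twisted w)"
proof (rule state_linear_eq[where L = "\<lambda>u. t_twisted (Y_twisted \<rho> \<beta> r u)"
      and K = "\<lambda>u. Y_twisted \<rho> (- \<beta>) r (t_twisted u)"])
  show "state_linear (\<lambda>u. t_twisted (Y_twisted \<rho> \<beta> r u))"
    by (rule state_linear_compose[OF state_linear_t_twisted state_linear_Y_twisted])
  show "state_linear (\<lambda>u. Y_twisted \<rho> (- \<beta>) r (t_twisted u))"
    by (rule state_linear_compose[OF state_linear_Y_twisted state_linear_t_twisted])
  fix s p
  have "E_coeff half_modes h r' (- q) = - E_coeff half_modes h r' q" for h r' q
    using flinear_add[OF flinear_E_coeff_half, of h r' q "- q"] flinear_0[OF flinear_E_coeff_half, of h r']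
    by (simp add: eq_neg_iff_add_eq_0 add.commute)
  then show "t_twisted (Y_twisted \<rho> \<beta> r (single s p)) = Y_twisted \<rho> (- \<beta>) r (t_twisted (single s p))"
    by (simp add: Y_twisted_single[of \<rho> \<beta>, OF \<rho>(1)] Y_twisted_single[of \<rho> "- \<beta>", OF \<rho>(2)] t_twisted_single
        flinear_scale[OF flinear_sign_fock] sign_fock_E_coeff[OF modes_positive_half_integers(2)] complexify_uminus)
qed

text \<open>The mode v(wt v - 1) is the coefficient of z to the power -wt v, here
  -\<langle>\<lambda>,\<lambda>\<rangle>/2.\<close>

definition untwisted_zero_mode ::
  "(real^24 \<Rightarrow> real^24 \<Rightarrow> complex) \<Rightarrow> real^24 \<Rightarrow> ((real^24) \<Rightarrow>\<^sub>0 fock) \<Rightarrow> ((real^24) \<Rightarrow>\<^sub>0 fock)" where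
  "untwisted_zero_mode \<epsilon> lam u =
     Y_untwisted \<epsilon> lam (- (lam \<bullet> lam) / 2) u + Y_untwisted \<epsilon> (- lam) (- (lam \<bullet> lam) / 2) u"

definition twisted_zero_mode ::
  "(real^24 \<Rightarrow> complex^4096^4096) \<Rightarrow> real^24 \<Rightarrow> (4096 \<Rightarrow>\<^sub>0 fock) \<Rightarrow> (4096 \<Rightarrow>\<^sub>0 fock)" where
  "twisted_zero_mode \<rho> lam w =
     Y_twisted \<rho> lam (- (lam \<bullet> lam) / 2) w + Y_twisted \<rho> (- lam) (- (lam \<bullet> lam) / 2) w"

lemma state_linear_untwisted_zero_mode: "state_linear (untwisted_zero_mode \<epsilon> lam)"
  unfolding untwisted_zero_mode_def[abs_def]
  by (intro state_linear_plus state_linear_Y_untwisted)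

lemma state_linear_twisted_zero_mode: "state_linear (twisted_zero_mode \<rho> lam)"
  unfolding twisted_zero_mode_def[abs_def]
  by (intro state_linear_plus state_linear_Y_twisted)

lemma untwisted_part_keys: "u \<in> untwisted_part \<Lambda> n \<Longrightarrow> keys u \<subseteq> \<Lambda>"
proof
  fix \<gamma> assume u: "u \<in> untwisted_part \<Lambda> n" and "\<gamma> \<in> keys u"
  then have "keys (lookup u \<gamma>) \<noteq> {}" by (simp add: in_keys_iff)
  then show "\<gamma> \<in> \<Lambda>" using u unfolding untwisted_part_def by blast
qed

lemma untwisted_zero_mode_part:
  assumes L: "leech_lattice \<Lambda>" and \<epsilon>: "bilinear_cocycle \<Lambda> \<epsilon>" and lam: "lam \<in> \<Lambda>"
    and u: "u \<in> {u \<in> untwisted_part \<Lambda> n. t_untwisted u = u}"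
  shows "untwisted_zero_mode \<epsilon> lam u \<in> {u \<in> untwisted_part \<Lambda> n. t_untwisted u = u}"
proof -
  have k: "keys u \<subseteq> \<Lambda>" using u untwisted_part_keys by blast
  note m = leech_lattice_uminus[OF L lam]
  have "untwisted_zero_mode \<epsilon> lam u \<in> untwisted_part \<Lambda> n"
    unfolding untwisted_zero_mode_def
    using u Y_untwisted_part[OF L lam] Y_untwisted_part[OF L m] by (intro untwisted_part_add) auto
  moreover have "t_untwisted (untwisted_zero_mode \<epsilon> lam u) = untwisted_zero_mode \<epsilon> lam u"
    using u by (simp add: untwisted_zero_mode_def state_linear_add[OF state_linear_t_untwisted]
        t_untwisted_Y_untwisted[OF L \<epsilon> lam k] t_untwisted_Y_untwisted[OF L \<epsilon> m k] add.commute)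
  ultimately show ?thesis by simp
qed

lemma twisted_zero_mode_part:
  assumes \<rho>: "\<rho> lam = mat 1" "\<rho> (- lam) = mat 1"
    and u: "w \<in> {w \<in> twisted_part n. t_twisted w = w}"
  shows "twisted_zero_mode \<rho> lam w \<in> {w \<in> twisted_part n. t_twisted w = w}"
proof -
  have \<rho>': "\<rho> (- (- lam)) = mat 1" using \<rho> by simp
  have "twisted_zero_mode \<rho> lam w \<in> twisted_part n"
    unfolding twisted_zero_mode_def
    using u Y_twisted_part[of w n \<rho> lam] Y_twisted_part[of w n \<rho> "- lam"] by (intro twisted_part_add) auto
  moreover have "t_twisted (twisted_zero_mode \<rho> lam w) = twisted_zero_mode \<rho> lam w"
    using u by (simp add: twisted_zero_mode_def state_linear_add[OF state_linear_t_twisted]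
        t_twisted_Y_twisted[of \<rho> lam, OF \<rho>] t_twisted_Y_twisted[of \<rho> "- lam", OF \<rho>(2) \<rho>'] add.commute)
  ultimately show ?thesis by simp
qed

definition v_state :: "real^24 \<Rightarrow> (real^24) \<Rightarrow>\<^sub>0 fock" where
  "v_state lam = single lam 1 + single (- lam) 1"

lemma lookup_v_state:
  "lookup (v_state lam) \<gamma> = const_fock (of_bool (\<gamma> = lam) + of_bool (\<gamma> = - lam))"
  by (auto simp: v_state_def lookup_add lookup_single when_def const_fock_add const_fock_1)

lemma to_moonshine_v_vec: "to_moonshine (v_vec lam) = (v_state lam, 0)"
proof -
  have "Poly_Mapping.map const_fock (v_vec lam) = v_state lam"
    by (rule poly_mapping_eqI)
      (auto simp: Poly_Mapping.map.rep_eq lookup_v_state v_vec_def lookup_add lookup_single when_def)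
  then show ?thesis by (simp add: to_moonshine_def)
qed

lemma t_untwisted_v_state: "t_untwisted (v_state lam) = v_state lam"
  by (simp add: v_state_def state_linear_add[OF state_linear_t_untwisted] t_untwisted_single add.commute)
    (simp add: sign_fock_single flip: single_one)

lemma v_state_moonshine_graded:
  assumes L: "leech_lattice \<Lambda>" and lam: "lam \<in> \<Lambda>"
  shows "(v_state lam, 0) \<in> moonshine_graded \<Lambda> n \<longleftrightarrow> (lam \<bullet> lam) / 2 = real n"
proof -
  have k: "keys (lookup (v_state lam) \<gamma>) = (if \<gamma> = lam \<or> \<gamma> = - lam then {0} else {})" for \<gamma>
    by (auto simp: lookup_v_state keys_const_fock)
  have "v_state lam \<in> untwisted_part \<Lambda> n \<longleftrightarrow> (lam \<bullet> lam) / 2 = real n"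
    unfolding untwisted_part_def using lam leech_lattice_uminus[OF L lam]
    by (auto simp: k mode_monos_def)
  moreover have "0 \<in> twisted_part n" by (simp add: twisted_part_def)
  ultimately show ?thesis
    by (simp add: moonshine_graded_eq t_untwisted_v_state state_linear_0[OF state_linear_t_twisted])
qed

lemma weight_v_vec:
  assumes L: "leech_lattice \<Lambda>" and lam: "lam \<in> \<Lambda>"
  shows "real (weight \<Lambda> (to_moonshine (v_vec lam))) = (lam \<bullet> lam) / 2"
proof -
  obtain k :: nat where k: "lam \<bullet> lam = 2 * real k" by (rule leech_lattice_norm[OF L lam])
  have "weight \<Lambda> (to_moonshine (v_vec lam)) = k"
    unfolding weight_def to_moonshine_v_vec v_state_moonshine_graded[OF L lam] k
    by (rule the_equality) auto
  then show ?thesis using k by simp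
qed

lemma zero_mode_v_vec:
  assumes L: "leech_lattice \<Lambda>" and lam: "lam \<in> \<Lambda>" "lam \<noteq> 0"
  shows "zero_mode \<Lambda> \<epsilon> \<rho> (v_vec lam) x = (untwisted_zero_mode \<epsilon> lam (fst x), twisted_zero_mode \<rho> lam (snd x))"
proof -
  \<comment> \<open>For \<lambda> = 0 the two summands of \<open>v_vec\<close> would merge into one
    key with coefficient 2.\<close>
  have ne: "lam \<noteq> - lam" using lam(2) by (metis eq_neg_iff_add_eq_0 add_cancel_left_left scaleR_2 scaleR_eq_0_iff zero_neq_numeral)
  have lk: "lookup (v_vec lam) lam = 1" "lookup (v_vec lam) (- lam) = 1"
    using ne by (auto simp: v_vec_def lookup_add lookup_single when_def)
  have "keys (v_vec lam) = {lam, - lam}"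
    using ne by (auto simp: v_vec_def in_keys_iff lookup_add lookup_single when_def split: if_splits)
  moreover have "- of_int (int (weight \<Lambda> (to_moonshine (v_vec lam))) - 1) - 1 = - (lam \<bullet> lam) / 2"
    using weight_v_vec[OF L lam(1)] by simp
  ultimately show ?thesis
    unfolding zero_mode_def vertex_mode_def
    by (simp only:) (use ne in \<open>simp add: lk untwisted_zero_mode_def twisted_zero_mode_def\<close>)
qed

section \<open>The graded trace\<close>

lemma neq_uminus: "x \<noteq> 0 \<Longrightarrow> x \<noteq> - x" for x :: "'a :: real_vector"
  by (metis eq_neg_iff_add_eq_0 scaleR_2 scaleR_eq_0_iff zero_neq_numeral)

text \<open>The image of a monomial vector under (1 + t)/2. Despite the name it yields only a
  spanning family: \<alpha> and -\<alpha> give the same vector up to sign.\<close>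

definition untwisted_basis :: "real^24 \<Rightarrow> monomial \<Rightarrow> (real^24) \<Rightarrow>\<^sub>0 fock" where
  "untwisted_basis \<alpha> m = scale_state (1 / 2) (single \<alpha> (single m 1) + t_untwisted (single \<alpha> (single m 1)))"

text \<open>Since t is -1 on T, this is the monomial vector itself for odd count and 0 for even
  count.\<close>

definition twisted_basis :: "4096 \<Rightarrow> monomial \<Rightarrow> 4096 \<Rightarrow>\<^sub>0 fock" where
  "twisted_basis s m = scale_state (1 / 2) (single s (single m 1) + t_twisted (single s (single m 1)))"

lemma lookup_lookup_scale_single:
  "lookup (lookup (scale_state c (single l (single m 1))) l') m' = (if l' = l \<and> m' = m then c else 0)"
  by (simp add: lookup_scale_state lookup_single when_def)

lemma state_expand:
  fixes u :: "'l \<Rightarrow>\<^sub>0 fock"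
  assumes "finite J" "\<And>l m. m \<in> keys (lookup u l) \<Longrightarrow> (l, m) \<in> J"
  shows "u = (\<Sum>(l, m)\<in>J. scale_state (lookup (lookup u l) m) (single l (single m 1)))"
proof (intro poly_mapping_eqI)
  fix l' m'
  have "lookup (lookup (\<Sum>(l, m)\<in>J. scale_state (lookup (lookup u l) m) (single l (single m 1))) l') m' =
      (\<Sum>x\<in>J. if x = (l', m') then lookup (lookup u l') m' else 0)"
    unfolding lookup_sum
    by (rule sum.cong) (auto simp: lookup_lookup_scale_single split: prod.splits)
  also have "\<dots> = lookup (lookup u l') m'"
    using assms by (auto simp: in_keys_iff)
  finally show "lookup (lookup u l') m' =
      lookup (lookup (\<Sum>(l, m)\<in>J. scale_state (lookup (lookup u l) m) (single l (single m 1))) l') m'" by simp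
qed

text \<open>Apply (1 + t)/2, which fixes \<open>u\<close>, to the expansion of \<open>u\<close> in
  monomials. The coordinates stay those of \<open>u\<close> itself, hence are linear in
  \<open>u\<close>.\<close>

lemma fixed_state_expand:
  fixes t :: "('l \<Rightarrow>\<^sub>0 fock) \<Rightarrow> ('l \<Rightarrow>\<^sub>0 fock)"
  assumes t: "state_linear t" "t u = u"
    and J: "finite J" "\<And>l m. m \<in> keys (lookup u l) \<Longrightarrow> (l, m) \<in> J"
  shows "u = (\<Sum>(l, m)\<in>J. scale_state (lookup (lookup u l) m)
    (scale_state (1 / 2) (single l (single m 1) + t (single l (single m 1)))))"
proof -
  let ?P = "\<lambda>u. scale_state (1 / 2) (u + t u)"
  have P: "state_linear ?P"
    by (intro state_linear_compose[OF state_linear_scale_state] state_linear_plus t(1))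
      (simp add: state_linear_def)
  have "?P u = u"
    by (intro poly_mapping_eqI)
      (simp only: t(2) lookup_scale_state lookup_add lookup_const_fock_mult, simp)
  moreover have "?P u = ?P (\<Sum>(l, m)\<in>J. scale_state (lookup (lookup u l) m) (single l (single m 1)))"
    using state_expand[OF J] by simp
  moreover have "\<dots> = (\<Sum>(l, m)\<in>J. scale_state (lookup (lookup u l) m) (?P (single l (single m 1))))"
    unfolding state_linear_sum[OF P] by (rule sum.cong) (auto simp: state_linear_scale[OF P] split: prod.splits)
  ultimately show ?thesis by simp
qed

lemma untwisted_basis_part:
  assumes L: "leech_lattice \<Lambda>" and "\<alpha> \<in> \<Lambda>" "m \<in> weight_monos integer_modes (real n - (\<alpha> \<bullet> \<alpha>) / 2)"
  shows "untwisted_basis \<alpha> m \<in> {u \<in> untwisted_part \<Lambda> n. t_untwisted u = u}"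
proof -
  let ?u = "single \<alpha> (single m (1 :: complex))"
  have "?u \<in> untwisted_part \<Lambda> n" "t_untwisted ?u \<in> untwisted_part \<Lambda> n"
    using assms leech_lattice_uminus[OF L]
    by (auto simp: untwisted_part_def t_untwisted_single sign_fock_single keys_lookup_single weight_monos_def
        split: if_splits)
  moreover have "t_untwisted (t_untwisted ?u) = ?u"
    by (simp add: t_untwisted_single sign_fock_single flip: power_mult_distrib)
  ultimately show ?thesis
    by (simp add: untwisted_basis_def untwisted_part_scale untwisted_part_add
        state_linear_scale[OF state_linear_t_untwisted] state_linear_add[OF state_linear_t_untwisted] add.commute)
qed

lemma twisted_basis_eq:
  "twisted_basis s m = scale_state ((1 - (-1) ^ mono_count m) / 2) (single s (single m 1))"
  unfolding twisted_basis_def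
  by (rule poly_mapping_eqI)
    (simp add: t_twisted_single sign_fock_single lookup_scale_state lookup_add lookup_single when_def
      const_fock_mult_single single_uminus[symmetric] single_add[symmetric])

lemma twisted_basis_part:
  assumes "m \<in> weight_monos half_modes (real n - 3 / 2)"
  shows "twisted_basis s m \<in> {w \<in> twisted_part n. t_twisted w = w}"
proof -
  let ?u = "single s (single m (1 :: complex))"
  have "?u \<in> twisted_part n"
    using assms
    by (auto simp: twisted_part_def keys_lookup_single weight_monos_def split: if_splits)
  moreover have "t_twisted (scale_state ((1 - (-1) ^ mono_count m) / 2) ?u) = scale_state ((1 - (-1) ^ mono_count m) / 2) ?u"
    by (cases "even (mono_count m)")
      (simp_all add: state_linear_scale[OF state_linear_t_twisted] t_twisted_single sign_fock_single
        flip: single_uminus, simp add: state_linear_0[OF state_linear_t_twisted])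
  ultimately show ?thesis by (simp add: twisted_basis_eq twisted_part_scale)
qed

text \<open>\<open>A\<close> is allowed to exceed the lattice vectors that occur in degree
  \<open>n\<close>, so that \<lambda>/2 and its negative can be included uniformly in
  \<open>n\<close>.\<close>

lemma graded_trace_sum:
  assumes L: "leech_lattice \<Lambda>" and \<epsilon>: "bilinear_cocycle \<Lambda> \<epsilon>" and lam: "lam \<in> \<Lambda>" "lam \<noteq> 0"
    and \<rho>: "\<rho> lam = mat 1" "\<rho> (- lam) = mat 1"
    and A: "finite A" "A \<subseteq> \<Lambda>" "{\<alpha> \<in> \<Lambda>. \<alpha> \<bullet> \<alpha> \<le> 2 * real n} \<subseteq> A"
  shows "graded_trace \<Lambda> \<epsilon> \<rho> (v_vec lam) n =
    (\<Sum>\<alpha>\<in>A. \<Sum>m\<in>weight_monos integer_modes (real n - (\<alpha> \<bullet> \<alpha>) / 2).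
       lookup (lookup (untwisted_zero_mode \<epsilon> lam (untwisted_basis \<alpha> m)) \<alpha>) m) +
    (\<Sum>s\<in>UNIV. \<Sum>m\<in>weight_monos half_modes (real n - 3 / 2).
       lookup (lookup (twisted_zero_mode \<rho> lam (twisted_basis s m)) s) m)"
proof -
  define J1 where "J1 = (SIGMA \<alpha>:A. weight_monos integer_modes (real n - (\<alpha> \<bullet> \<alpha>) / 2))"
  define J2 where "J2 = (UNIV :: 4096 set) \<times> weight_monos half_modes (real n - 3 / 2)"
  define e where "e = case_sum (\<lambda>(\<alpha>, m). (untwisted_basis \<alpha> m, 0 :: 4096 \<Rightarrow>\<^sub>0 fock))
      (\<lambda>(s, m). (0 :: (real^24) \<Rightarrow>\<^sub>0 fock, twisted_basis s m))"
  define \<phi> where "\<phi> = case_sum (\<lambda>(\<alpha>, m) (v :: moonshine). lookup (lookup (fst v) \<alpha>) m)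
      (\<lambda>(s, m) v. lookup (lookup (snd v) s) m)"
  let ?f = "zero_mode \<Lambda> \<epsilon> \<rho> (v_vec lam)"
  let ?F = "untwisted_zero_mode \<epsilon> lam" and ?G = "twisted_zero_mode \<rho> lam"
  note f = zero_mode_v_vec[OF L lam, of \<epsilon> \<rho>]
  note fin = finite_weight_monos[OF modes_positive_half_integers(1)] finite_weight_monos[OF modes_positive_half_integers(2)]
  have J: "finite J1" "finite J2" unfolding J1_def J2_def using A(1) fin by auto
  have F0: "?F 0 = 0" "?G 0 = 0"
    by (rule state_linear_0[OF state_linear_untwisted_zero_mode] state_linear_0[OF state_linear_twisted_zero_mode])+
  have eW: "e j \<in> moonshine_graded \<Lambda> n" if "j \<in> J1 <+> J2" for j
    using that A(2) untwisted_basis_part[OF L, of _ _ n] twisted_basis_part[of _ n]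
    by (auto simp: e_def moonshine_graded_eq J1_def J2_def untwisted_part_0 twisted_part_0
        state_linear_0[OF state_linear_t_untwisted] state_linear_0[OF state_linear_t_twisted])
  have "trace_on (moonshine_graded \<Lambda> n) ?f = (\<Sum>j\<in>J1 <+> J2. \<phi> j (?f (e j)))"
  proof (rule trace_on_spanning_family)
    show "finite (J1 <+> J2)" using J by simp
    show "mspace.subspace (moonshine_graded \<Lambda> n)" by (rule subspace_moonshine_graded)
    show "e j \<in> moonshine_graded \<Lambda> n" if "j \<in> J1 <+> J2" for j using eW[OF that] .
    show "\<phi> j (v + w) = \<phi> j v + \<phi> j w" for j v w
      by (cases j) (auto simp: \<phi>_def lookup_add split: prod.splits)
    show "\<phi> j (scale_moonshine c v) = c * \<phi> j v" for j c v
      by (cases j) (auto simp: \<phi>_def scale_moonshine_def lookup_scale_state split: prod.splits)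
    show "?f (v + w) = ?f v + ?f w" for v w
      by (simp add: f state_linear_add[OF state_linear_untwisted_zero_mode]
          state_linear_add[OF state_linear_twisted_zero_mode])
    show "?f (scale_moonshine c v) = scale_moonshine c (?f v)" for c v
      by (simp add: f scale_moonshine_def state_linear_scale[OF state_linear_untwisted_zero_mode]
          state_linear_scale[OF state_linear_twisted_zero_mode])
    show "?f (e j) \<in> moonshine_graded \<Lambda> n" if "j \<in> J1 <+> J2" for j
      using eW[OF that] untwisted_zero_mode_part[OF L \<epsilon> lam(1), of _ n] twisted_zero_mode_part[OF \<rho>, of _ n]
      unfolding f moonshine_graded_eq by (cases "e j") simp
    fix v :: moonshine assume "v \<in> moonshine_graded \<Lambda> n"
    then have u: "fst v \<in> untwisted_part \<Lambda> n" "t_untwisted (fst v) = fst v"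
      and w: "snd v \<in> twisted_part n" "t_twisted (snd v) = snd v"
      by (auto simp: moonshine_graded_eq)
    have "(l, m) \<in> J1" if "m \<in> keys (lookup (fst v) l)" for l m
    proof -
      have *: "l \<in> \<Lambda>" "m \<in> mode_monos integer_modes" "mono_weight m + (l \<bullet> l) / 2 = real n"
        using u(1) that unfolding untwisted_part_def by blast+
      \<comment> \<open>Weights are therefore nonnegative, which bounds the norm of a lattice vector
        occurring in degree \<open>n\<close>.\<close>
      have "real (mono_count m) \<le> 2 * mono_weight m"
        by (rule mono_count_le_weight[OF modes_positive_half_integers(1) *(2)])
      then have "mono_weight m \<ge> 0" using of_nat_0_le_iff[of "mono_count m"] by linarith
      then have "l \<bullet> l \<le> 2 * real n" using *(3) by linarith
      then have "l \<in> A" using A(3) *(1) by blast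
      then show ?thesis using * by (auto simp: J1_def weight_monos_def)
    qed
    from fixed_state_expand[OF state_linear_t_untwisted u(2) J(1) this]
    have 1: "fst v = (\<Sum>(l, m)\<in>J1. scale_state (lookup (lookup (fst v) l) m) (untwisted_basis l m))"
      unfolding untwisted_basis_def .
    have "(l, m) \<in> J2" if "m \<in> keys (lookup (snd v) l)" for l m
    proof -
      have *: "m \<in> mode_monos half_modes" "mono_weight m + 3 / 2 = real n"
        using w(1) that unfolding twisted_part_def by blast+
      then show ?thesis by (auto simp: J2_def weight_monos_def)
    qed
    from fixed_state_expand[OF state_linear_t_twisted w(2) J(2) this]
    have 2: "snd v = (\<Sum>(l, m)\<in>J2. scale_state (lookup (lookup (snd v) l) m) (twisted_basis l m))"
      unfolding twisted_basis_def .
    have "(\<Sum>j\<in>J1 <+> J2. scale_moonshine (\<phi> j v) (e j)) =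
        (\<Sum>(l, m)\<in>J1. (scale_state (lookup (lookup (fst v) l) m) (untwisted_basis l m), 0)) +
        (\<Sum>(l, m)\<in>J2. (0, scale_state (lookup (lookup (snd v) l) m) (twisted_basis l m)))"
      by (simp add: sum.Plus[OF J] \<phi>_def e_def scale_moonshine_def split_def)
    also have "\<dots> = v"
    proof (rule prod_eqI)
      show "fst ((\<Sum>(l, m)\<in>J1. (scale_state (lookup (lookup (fst v) l) m) (untwisted_basis l m), 0)) +
        (\<Sum>(l, m)\<in>J2. (0, scale_state (lookup (lookup (snd v) l) m) (twisted_basis l m)))) = fst v"
        by (rule trans[OF _ 1[symmetric]]) (simp add: fst_sum split_def)
      show "snd ((\<Sum>(l, m)\<in>J1. (scale_state (lookup (lookup (fst v) l) m) (untwisted_basis l m), 0)) +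
        (\<Sum>(l, m)\<in>J2. (0, scale_state (lookup (lookup (snd v) l) m) (twisted_basis l m)))) = snd v"
        by (rule trans[OF _ 2[symmetric]]) (simp add: snd_sum split_def)
    qed
    finally show "v = (\<Sum>j\<in>J1 <+> J2. scale_moonshine (\<phi> j v) (e j))" ..
  qed
  also have "\<dots> = (\<Sum>(\<alpha>, m)\<in>J1. lookup (lookup (?F (untwisted_basis \<alpha> m)) \<alpha>) m) +
      (\<Sum>(s, m)\<in>J2. lookup (lookup (?G (twisted_basis s m)) s) m)"
    by (simp add: sum.Plus[OF J] \<phi>_def e_def f split_def)
  also have "(\<Sum>(\<alpha>, m)\<in>J1. lookup (lookup (?F (untwisted_basis \<alpha> m)) \<alpha>) m) =
      (\<Sum>\<alpha>\<in>A. \<Sum>m\<in>weight_monos integer_modes (real n - (\<alpha> \<bullet> \<alpha>) / 2).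
        lookup (lookup (?F (untwisted_basis \<alpha> m)) \<alpha>) m)"
    unfolding J1_def by (rule sum.Sigma[symmetric]) (use A(1) fin in auto)
  also have "(\<Sum>(s, m)\<in>J2. lookup (lookup (?G (twisted_basis s m)) s) m) =
      (\<Sum>s\<in>UNIV. \<Sum>m\<in>weight_monos half_modes (real n - 3 / 2). lookup (lookup (?G (twisted_basis s m)) s) m)"
    unfolding J2_def by (rule sum.Sigma[symmetric]) (use fin in auto)
  finally show ?thesis by (simp add: graded_trace_def)
qed

lemma E_coeff_diagonal_uminus:
  assumes I: "I \<subseteq> positive_half_integers" and m: "m \<in> mode_monos I"
  shows "lookup (E_coeff I (- h) 0 (single m 1)) m = lookup (E_coeff I h 0 (single m 1)) m"
  by (simp add: E_coeff_diagonal[OF assms])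

text \<open>Without t the shift by \<lambda> or -\<lambda> never returns to \<alpha>. After t it
  does so when \<lambda> - \<alpha> = \<alpha> or -\<lambda> - \<alpha> = \<alpha>; the power of z
  left for the oscillators is then 0. The half is that of (1 + t)/2.\<close>

lemma untwisted_diagonal:
  assumes L: "leech_lattice \<Lambda>" and \<epsilon>: "bilinear_cocycle \<Lambda> \<epsilon>" and \<mu>: "\<mu> \<in> \<Lambda>" "\<mu> \<noteq> 0"
    and m: "m \<in> mode_monos integer_modes"
  shows "lookup (lookup (untwisted_zero_mode \<epsilon> (2 *\<^sub>R \<mu>) (untwisted_basis \<alpha> m)) \<alpha>) m =
    (if \<alpha> = \<mu> \<or> \<alpha> = - \<mu> then (-1) ^ mono_count m / 2 *
       lookup (E_coeff integer_modes (complexify (2 *\<^sub>R \<mu>)) 0 (single m 1)) m else 0)"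
proof -
  let ?lam = "2 *\<^sub>R \<mu>" and ?I = integer_modes
  let ?c = "(-1) ^ mono_count m :: complex"
  let ?D = "lookup (E_coeff ?I (complexify ?lam) 0 (single m 1)) m"
  note lin = flinear_E_coeff_integer
  have lam: "?lam \<noteq> 0" using \<mu>(2) by simp
  have half: "?lam - \<alpha> = \<alpha> \<longleftrightarrow> \<alpha> = \<mu>" "- ?lam - \<alpha> = \<alpha> \<longleftrightarrow> \<alpha> = - \<mu>"
  proof -
    have "- ?lam = 2 *\<^sub>R (- \<mu>)" by simp
    then show "?lam - \<alpha> = \<alpha> \<longleftrightarrow> \<alpha> = \<mu>" "- ?lam - \<alpha> = \<alpha> \<longleftrightarrow> \<alpha> = - \<mu>"
      by (simp_all only: diff_eq_eq scaleR_2[symmetric] scaleR_cancel_left) auto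
  qed
  \<comment> \<open>By bilinearity \<epsilon>(2\<mu>, \<mu>) = \<epsilon>(\<mu>, \<mu>)^2, a square
    of a sign.\<close>
  have \<epsilon>1: "\<epsilon> ?lam (- \<mu>) = 1" "\<epsilon> (- ?lam) \<mu> = 1"
  proof -
    note m\<mu> = leech_lattice_uminus[OF L \<mu>(1)]
    have lamL: "?lam \<in> \<Lambda>" using leech_lattice_add[OF L \<mu>(1) \<mu>(1)] by (simp add: scaleR_2)
    have "\<epsilon> ?lam \<mu> = \<epsilon> \<mu> \<mu> * \<epsilon> \<mu> \<mu>" and "\<epsilon> \<mu> \<mu> \<in> {1, -1}"
      using \<epsilon> \<mu>(1) unfolding bilinear_cocycle_def scaleR_2 by blast+
    then have "\<epsilon> ?lam \<mu> = 1" by auto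
    then show "\<epsilon> ?lam (- \<mu>) = 1" "\<epsilon> (- ?lam) \<mu> = 1"
      using bilinear_cocycle_uminus[OF L \<epsilon> lamL \<mu>(1)] by simp_all
  qed
  let ?r = "- (?lam \<bullet> ?lam) / 2"
  let ?U = "single \<alpha> (single m (1 :: complex))"
  have tU: "t_untwisted ?U = scale_state ?c (single (- \<alpha>) (single m 1))"
    by (simp add: t_untwisted_single sign_fock_single scale_state_single const_fock_mult_single)
  have "lookup (lookup (untwisted_zero_mode \<epsilon> ?lam ?U) \<alpha>) m = 0"
    using lam by (simp add: untwisted_zero_mode_def Y_untwisted_single lookup_add lookup_single_not_eq)
  moreover have "lookup (lookup (untwisted_zero_mode \<epsilon> ?lam (t_untwisted ?U)) \<alpha>) m =
      (if \<alpha> = \<mu> \<or> \<alpha> = - \<mu> then ?c * ?D else 0)"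
  proof -
    have e1: "lookup (lookup (Y_untwisted \<epsilon> ?lam ?r (single (- \<alpha>) (single m 1))) \<alpha>) m = (if \<alpha> = \<mu> then ?D else 0)"
    proof -
      have "?r - ?lam \<bullet> (- \<alpha>) = 0" if "\<alpha> = \<mu>" using that by simp
      then show ?thesis
        using half(1) by (auto simp: Y_untwisted_single lookup_single when_def \<epsilon>1 const_fock_1 complexify_uminus
            E_coeff_diagonal_uminus[OF modes_positive_half_integers(1) m])
    qed
    have e2: "lookup (lookup (Y_untwisted \<epsilon> (- ?lam) ?r (single (- \<alpha>) (single m 1))) \<alpha>) m = (if \<alpha> = - \<mu> then ?D else 0)"
    proof -
      have "?r - (- ?lam) \<bullet> (- \<alpha>) = 0" if "\<alpha> = - \<mu>" using that by simp
      then show ?thesis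
        using half(2) by (auto simp: Y_untwisted_single lookup_single when_def \<epsilon>1 const_fock_1)
    qed
    have "\<mu> \<noteq> - \<mu>" by (rule neq_uminus[OF \<mu>(2)])
    then show ?thesis
      unfolding tU untwisted_zero_mode_def state_linear_scale[OF state_linear_Y_untwisted]
        lookup_add lookup_scale_state lookup_const_fock_mult e1 e2 by auto
  qed
  ultimately show ?thesis
    by (simp add: untwisted_basis_def state_linear_scale[OF state_linear_untwisted_zero_mode]
        state_linear_add[OF state_linear_untwisted_zero_mode] lookup_scale_state lookup_add)
qed

text \<open>The summands for \<lambda> and -\<lambda> have equal diagonals, as these depend only on
  the squares of the coordinates; their sum cancels the half of the projection.\<close>

lemma twisted_diagonal:
  assumes \<rho>: "\<rho> lam = mat 1" "\<rho> (- lam) = mat 1" and m: "m \<in> mode_monos half_modes"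
  shows "lookup (lookup (twisted_zero_mode \<rho> lam (twisted_basis s m)) s) m =
    (1 - (-1) ^ mono_count m) * complex_of_real (2 powr (- (lam \<bullet> lam))) *
      lookup (E_coeff half_modes (complexify lam) 0 (single m 1)) m"
  by (simp add: twisted_basis_eq state_linear_scale[OF state_linear_Y_twisted] twisted_zero_mode_def
      Y_twisted_single[of \<rho> lam, OF \<rho>(1)] Y_twisted_single[of \<rho> "- lam", OF \<rho>(2)] lookup_scale_state lookup_add
      complexify_uminus E_coeff_diagonal_uminus[OF modes_positive_half_integers(2) m])

text \<open>\<alpha> = \<mu> and \<alpha> = -\<mu> each give half of the untwisted sum; 4096 is the
  trace of the identity on T.\<close>

lemma graded_trace_v_vec:
  assumes L: "leech_lattice \<Lambda>" and \<epsilon>: "bilinear_cocycle \<Lambda> \<epsilon>" and \<rho>: "projective_rep \<Lambda> \<epsilon> \<rho>"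
    and \<mu>: "\<mu> \<in> \<Lambda>" "\<mu> \<noteq> 0" and lam: "lam = 2 *\<^sub>R \<mu>"
  shows "graded_trace \<Lambda> \<epsilon> \<rho> (v_vec lam) n =
    (\<Sum>m\<in>weight_monos integer_modes (real n - (\<mu> \<bullet> \<mu>) / 2).
       (-1) ^ mono_count m * lookup (E_coeff integer_modes (complexify lam) 0 (single m 1)) m) +
    4096 * complex_of_real (2 powr (- (lam \<bullet> lam))) * (\<Sum>m\<in>weight_monos half_modes (real n - 3 / 2).
       (1 - (-1) ^ mono_count m) * lookup (E_coeff half_modes (complexify lam) 0 (single m 1)) m)"
proof -
  let ?A = "{\<alpha> \<in> \<Lambda>. \<alpha> \<bullet> \<alpha> \<le> 2 * real n} \<union> {\<mu>, - \<mu>}"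
  note m\<mu> = leech_lattice_uminus[OF L \<mu>(1)]
  have lamL: "lam \<in> \<Lambda>" using leech_lattice_add[OF L \<mu>(1) \<mu>(1)] by (simp add: lam scaleR_2)
  have \<rho>1: "\<rho> lam = mat 1" "\<rho> (- lam) = mat 1"
  proof -
    have "\<rho> (2 *\<^sub>R \<alpha>) = mat 1" if "\<alpha> \<in> \<Lambda>" for \<alpha> using \<rho> that unfolding projective_rep_def by blast
    from this[OF \<mu>(1)] this[OF m\<mu>] show "\<rho> lam = mat 1" "\<rho> (- lam) = mat 1" by (simp_all add: lam)
  qed
  have finA: "finite ?A" using finite_leech_lattice_ball[OF L] by simp
  have ne: "\<mu> \<noteq> - \<mu>" by (rule neq_uminus[OF \<mu>(2)])
  let ?T = "\<Sum>m\<in>weight_monos integer_modes (real n - (\<mu> \<bullet> \<mu>) / 2).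
       (-1) ^ mono_count m * lookup (E_coeff integer_modes (complexify lam) 0 (single m 1)) m"
  have "(\<Sum>\<alpha>\<in>?A. \<Sum>m\<in>weight_monos integer_modes (real n - (\<alpha> \<bullet> \<alpha>) / 2).
       lookup (lookup (untwisted_zero_mode \<epsilon> lam (untwisted_basis \<alpha> m)) \<alpha>) m) =
     (\<Sum>\<alpha>\<in>?A. if \<alpha> = \<mu> \<or> \<alpha> = - \<mu> then ?T / 2 else 0)"
  proof (rule sum.cong[OF refl])
    fix \<alpha>
    have "(\<Sum>m\<in>weight_monos integer_modes (real n - (\<alpha> \<bullet> \<alpha>) / 2).
       lookup (lookup (untwisted_zero_mode \<epsilon> lam (untwisted_basis \<alpha> m)) \<alpha>) m) =
      (\<Sum>m\<in>weight_monos integer_modes (real n - (\<alpha> \<bullet> \<alpha>) / 2).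
        (if \<alpha> = \<mu> \<or> \<alpha> = - \<mu> then (-1) ^ mono_count m / 2 *
       lookup (E_coeff integer_modes (complexify lam) 0 (single m 1)) m else 0))"
      unfolding lam by (rule sum.cong[OF refl], rule untwisted_diagonal[OF L \<epsilon> \<mu>]) (simp add: weight_monos_def)
    also have "\<dots> = (if \<alpha> = \<mu> \<or> \<alpha> = - \<mu> then ?T / 2 else 0)"
      by (auto simp: sum_divide_distrib)
    finally show "(\<Sum>m\<in>weight_monos integer_modes (real n - (\<alpha> \<bullet> \<alpha>) / 2).
       lookup (lookup (untwisted_zero_mode \<epsilon> lam (untwisted_basis \<alpha> m)) \<alpha>) m) =
      (if \<alpha> = \<mu> \<or> \<alpha> = - \<mu> then ?T / 2 else 0)" .
  qed
  also have "\<dots> = (\<Sum>\<alpha>\<in>{\<mu>, - \<mu>}. ?T / 2)"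
    by (rule sum.mono_neutral_cong_right) (use finA in auto)
  also have "\<dots> = ?T" using ne by simp
  finally have 1: "(\<Sum>\<alpha>\<in>?A. \<Sum>m\<in>weight_monos integer_modes (real n - (\<alpha> \<bullet> \<alpha>) / 2).
       lookup (lookup (untwisted_zero_mode \<epsilon> lam (untwisted_basis \<alpha> m)) \<alpha>) m) = ?T" .
  have "(\<Sum>s\<in>UNIV. \<Sum>m\<in>weight_monos half_modes (real n - 3 / 2).
       lookup (lookup (twisted_zero_mode \<rho> lam (twisted_basis s m)) s) m) =
     (\<Sum>s\<in>(UNIV :: 4096 set). \<Sum>m\<in>weight_monos half_modes (real n - 3 / 2).
       complex_of_real (2 powr (- (lam \<bullet> lam))) * ((1 - (-1) ^ mono_count m) *
      lookup (E_coeff half_modes (complexify lam) 0 (single m 1)) m))"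
    by (intro sum.cong refl) (simp add: twisted_diagonal[OF \<rho>1] weight_monos_def)
  also have "\<dots> = 4096 * complex_of_real (2 powr (- (lam \<bullet> lam))) * (\<Sum>m\<in>weight_monos half_modes (real n - 3 / 2).
       (1 - (-1) ^ mono_count m) * lookup (E_coeff half_modes (complexify lam) 0 (single m 1)) m)"
    by (simp add: sum_distrib_left[symmetric])
  finally have 2: "(\<Sum>s\<in>UNIV. \<Sum>m\<in>weight_monos half_modes (real n - 3 / 2).
       lookup (lookup (twisted_zero_mode \<rho> lam (twisted_basis s m)) s) m) =
    4096 * complex_of_real (2 powr (- (lam \<bullet> lam))) * (\<Sum>m\<in>weight_monos half_modes (real n - 3 / 2).
       (1 - (-1) ^ mono_count m) * lookup (E_coeff half_modes (complexify lam) 0 (single m 1)) m)" .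
  have "lam \<noteq> 0" using \<mu>(2) by (simp add: lam)
  from graded_trace_sum[OF L \<epsilon> lamL this \<rho>1 finA, of n] show ?thesis
    unfolding 1 2 using \<mu>(1) m\<mu> by auto
qed

section \<open>The highest weight property and the trace function\<close>

lemma pdiff_fock_const: "pdiff_fock x (const_fock c) = 0"
  by (simp add: pdiff_fock_def keys_const_fock)

lemma heis_pos_const: "r > 0 \<Longrightarrow> heis \<alpha> h r (const_fock c) = 0"
  by (simp add: heis_def pdiff_fock_const)

lemma heis_0: "heis \<alpha> h r 0 = 0"
  by (simp add: heis_def flinear_0[OF flinear_pdiff_fock])

text \<open>The larger of the two modes acts first; under the assumption it is positive and
  annihilates constants.\<close>

lemma normal_ordered_const:
  assumes "r + s > 0 \<or> r + s = 0 \<and> r \<noteq> 0"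
  shows "normal_ordered \<alpha> h r s (const_fock c) = 0"
  using assms by (auto simp: normal_ordered_def heis_pos_const heis_0)

lemma heis_axis_0: "heis \<alpha> (axis i 1) 0 p = const_fock (of_real (\<alpha> $ i)) * p"
proof -
  have "(\<Sum>j\<in>UNIV. axis i 1 $ j * complexify \<alpha> $ j) = (\<Sum>j\<in>UNIV. if j = i then of_real (\<alpha> $ i) else 0)"
    by (rule sum.cong) (auto simp: axis_def complexify_def)
  then show ?thesis by (simp add: heis_def)
qed

lemma sugawara_const_pos: "n > 0 \<Longrightarrow> sugawara \<alpha> 0 n (const_fock c) = 0"
  by (simp add: sugawara_def normal_ordered_const)

lemma sugawara_const_0: "sugawara \<alpha> 0 0 (const_fock c) = const_fock (of_real ((\<alpha> \<bullet> \<alpha>) / 2)) * const_fock c"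
proof -
  have "Sum_any (\<lambda>m::int. const_fock (1 / 2) *
      normal_ordered \<alpha> (axis i 1) (of_int m + 0) (of_int 0 - (of_int m + 0)) (const_fock c)) =
      const_fock (of_real (\<alpha> $ i * \<alpha> $ i) / 2 * c)" for i
  proof -
    let ?g = "\<lambda>m::int. const_fock (1 / 2) *
      normal_ordered \<alpha> (axis i 1) (of_int m + 0) (of_int 0 - (of_int m + 0)) (const_fock c)"
    have "?g m = 0" if "m \<noteq> 0" for m
      using that by (subst normal_ordered_const) auto
    then have "Sum_any ?g = (\<Sum>m\<in>{0}. ?g m)" by (intro Sum_any.expand_superset) auto
    also have "\<dots> = const_fock (1 / 2 * (of_real (\<alpha> $ i) * (of_real (\<alpha> $ i) * c)))"
      by (simp add: normal_ordered_def heis_axis_0 flip: const_fock_mult)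
    finally show ?thesis by (simp add: mult.assoc)
  qed
  then have "sugawara \<alpha> 0 0 (const_fock c) = const_fock (\<Sum>i\<in>UNIV. of_real (\<alpha> $ i * \<alpha> $ i) / 2 * c)"
    by (simp add: sugawara_def const_fock_sum)
  also have "(\<Sum>i\<in>UNIV. of_real (\<alpha> $ i * \<alpha> $ i) / 2 * c) = of_real ((\<alpha> \<bullet> \<alpha>) / 2) * c"
    by (simp add: inner_vec_def sum_divide_distrib sum_distrib_right)
  finally show ?thesis by (simp only: const_fock_mult)
qed

lemma highest_weight_vector_v_vec:
  assumes L: "leech_lattice \<Lambda>" and lam: "lam \<in> \<Lambda>"
  shows "highest_weight_vector \<Lambda> (complex_of_real ((lam \<bullet> lam) / 2)) (to_moonshine (v_vec lam))"
proof -
  obtain k :: nat where k: "lam \<bullet> lam = 2 * real k" by (rule leech_lattice_norm[OF L lam])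
  let ?v = "v_state lam"
  have "(?v, 0) \<in> moonshine_graded \<Lambda> k" using v_state_moonshine_graded[OF L lam] k by simp
  then have mem: "(?v, 0) \<in> moonshine_module \<Lambda>" by (auto simp: moonshine_graded_def)
  have pos: "virasoro n (?v, 0) = 0" if "n > 0" for n
    using that by (simp add: virasoro_def lookup_v_state sugawara_const_pos zero_prod_def)
  have "keys ?v \<subseteq> {lam, - lam}" by (auto simp: in_keys_iff lookup_v_state of_bool_def split: if_splits)
  then have n: "\<alpha> \<bullet> \<alpha> = lam \<bullet> lam" if "\<alpha> \<in> keys ?v" for \<alpha> using that by auto
  have "(\<Sum>\<alpha>\<in>keys ?v. single \<alpha> (sugawara \<alpha> 0 0 (lookup ?v \<alpha>))) =
      (\<Sum>\<alpha>\<in>keys ?v. scale_state (of_real ((lam \<bullet> lam) / 2)) (single \<alpha> (lookup ?v \<alpha>)))"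
  proof (rule sum.cong[OF refl])
    fix \<alpha> assume \<alpha>: "\<alpha> \<in> keys ?v"
    show "single \<alpha> (sugawara \<alpha> 0 0 (lookup ?v \<alpha>)) =
        scale_state (of_real ((lam \<bullet> lam) / 2)) (single \<alpha> (lookup ?v \<alpha>))"
      unfolding scale_state_single lookup_v_state sugawara_const_0 n[OF \<alpha>] ..
  qed
  also have "\<dots> = scale_state (of_real ((lam \<bullet> lam) / 2)) ?v"
    unfolding scale_state_sum[symmetric] poly_mapping_sum_single ..
  finally have "virasoro 0 (?v, 0) = scale_moonshine (of_real ((lam \<bullet> lam) / 2)) (?v, 0)"
    by (simp add: virasoro_def scale_moonshine_def)
  with mem pos show ?thesis
    unfolding highest_weight_vector_def to_moonshine_v_vec by blast
qed

text \<open>Regroups a sum over monomials into a series over degrees. Integrality of the shifted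
  weight is required only where \<open>f\<close> is nonzero, since twisted monomials of even count
  lie in no integral degree.\<close>

lemma has_sum_by_weight:
  fixes f :: "monomial \<Rightarrow> complex"
  assumes I: "I \<subseteq> positive_half_integers" and f: "(f has_sum S) (mode_monos I)"
    and d: "\<And>m. m \<in> mode_monos I \<Longrightarrow> f m \<noteq> 0 \<Longrightarrow> \<exists>n::nat. mono_weight m + d = real n"
  shows "((\<lambda>n. \<Sum>m\<in>weight_monos I (real n - d). f m) has_sum S) (UNIV :: nat set)"
proof -
  let ?M = "{m \<in> mode_monos I. \<exists>n::nat. mono_weight m + d = real n}"
  have "(f has_sum S) ?M"
    using f by (rule iffD1[OF has_sum_cong_neutral, rotated -1]) (use d in auto)
  moreover have "((\<lambda>(n, m). f m) has_sum S) (SIGMA n:UNIV. weight_monos I (real n - d)) \<longleftrightarrow> (f has_sum S) ?M"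
    by (rule has_sum_reindex_bij_witness[where i = "\<lambda>m. (nat \<lfloor>mono_weight m + d\<rfloor>, m)" and j = snd])
      (auto simp: weight_monos_def)
  ultimately have "((\<lambda>(n, m). f m) has_sum S) (SIGMA n:UNIV. weight_monos I (real n - d))" by simp
  then show ?thesis
    by (rule has_sum_SigmaD) (auto intro!: has_sum_finiteI finite_weight_monos[OF I])
qed

lemma mono_weight_integer_modes:
  assumes "m \<in> mode_monos integer_modes"
  obtains n :: nat where "mono_weight m = real n"
proof -
  have "\<forall>x\<in>keys m. \<exists>k::nat. snd x = real k"
  proof
    fix x assume "x \<in> keys m"
    then obtain j :: nat where "snd x = real j + 1"
      using assms by (auto simp: mode_monos_def integer_modes_def)
    then have "snd x = real (Suc j)" by simp
    then show "\<exists>k::nat. snd x = real k" by blast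
  qed
  then obtain k where k: "\<And>x. x \<in> keys m \<Longrightarrow> snd x = real (k x)" by metis
  have "mono_weight m = real (\<Sum>x\<in>keys m. k x * lookup m x)"
    unfolding mono_weight_def of_nat_sum by (rule sum.cong) (simp_all add: k)
  then show ?thesis by (rule that)
qed

text \<open>Each factor contributes 1/2 modulo integers; with the shift 3/2 the degree is integral
  exactly for odd count, matching the fixed points of t.\<close>

lemma mono_weight_half_modes:
  assumes "m \<in> mode_monos half_modes"
  obtains n :: nat where "mono_weight m = real n + real (mono_count m) / 2"
proof -
  have "\<forall>x\<in>keys m. \<exists>k::nat. snd x = real k + 1 / 2"
    using assms by (auto simp: mode_monos_def half_modes_def)
  then obtain k where k: "\<And>x. x \<in> keys m \<Longrightarrow> snd x = real (k x) + 1 / 2" by metis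
  have "mono_weight m = (\<Sum>x\<in>keys m. real (k x * lookup m x) + real (lookup m x) / 2)"
    unfolding mono_weight_def by (rule sum.cong) (simp_all add: k distrib_right)
  also have "\<dots> = real (\<Sum>x\<in>keys m. k x * lookup m x) + real (mono_count m) / 2"
    by (simp add: sum.distrib mono_count_def sum_divide_distrib)
  finally show ?thesis by (rule that)
qed

text \<open>The determinant factor of 24 oscillators absorbs twelve theta quotients, because (R^2/P)
  (P/R)^2 = P. It is used with P = P(q) and R one of P(q^2), P(q^(1/2)), P(-q^(1/2)).\<close>

lemma theta_power_identity:
  fixes P R :: complex
  assumes "P \<noteq> 0" "R \<noteq> 0"
  shows "(R\<^sup>2 / P) ^ (M + 12) * (P / R) ^ 24 = P ^ 12 * (R\<^sup>2 / P) ^ M"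
proof -
  have "(R\<^sup>2 / P) ^ 12 * (P / R) ^ 24 = ((R\<^sup>2 / P) * (P / R)\<^sup>2) ^ 12"
    by (simp only: power_mult_distrib power_mult[symmetric]) simp
  also have "(R\<^sup>2 / P) * (P / R)\<^sup>2 = P" using assms by (simp add: power2_eq_square)
  finally show ?thesis by (simp only: power_add mult_ac)
qed

lemma Z_v_vec:
  assumes L: "leech_lattice \<Lambda>" and \<epsilon>: "bilinear_cocycle \<Lambda> \<epsilon>" and \<rho>: "projective_rep \<Lambda> \<epsilon> \<rho>"
    and \<mu>: "\<mu> \<in> \<Lambda>" "\<mu> \<noteq> 0" and lam: "lam = 2 *\<^sub>R \<mu>" and \<tau>: "Im \<tau> > 0"
  shows "summable (\<lambda>n. graded_trace \<Lambda> \<epsilon> \<rho> (v_vec lam) n * q_pow (real n) \<tau>)"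
    "Z \<Lambda> \<epsilon> \<rho> (v_vec lam) \<tau> = eta \<tau> ^ 12 *
            ((Theta1 \<tau> / 2) powi (\<lfloor>lam \<bullet> lam\<rfloor> - 12)
             + (Theta2 \<tau> / 2) powi (\<lfloor>lam \<bullet> lam\<rfloor> - 12)
             - (Theta3 \<tau> / 2) powi (\<lfloor>lam \<bullet> lam\<rfloor> - 12))"
proof -
  obtain a :: nat where a: "\<mu> \<bullet> \<mu> = 2 * real a" by (rule leech_lattice_norm[OF L \<mu>(1)])
  have "\<mu> \<bullet> \<mu> \<noteq> 2" "\<mu> \<bullet> \<mu> \<noteq> 0" using L \<mu> by (auto simp: leech_lattice_def)
  \<comment> \<open>Absence of norm 2 vectors gives \<langle>\<lambda>,\<lambda>\<rangle> = 8a \<ge>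
    16, so the natural subtraction defining \<open>M\<close> does not truncate and the integer
    powers of the statement are ordinary ones.\<close>
  then have a2: "a \<ge> 2" using a by (cases a; cases "a - 1") auto
  define M where "M = 8 * a - 12"
  have N: "8 * a = M + 12" using a2 by (simp add: M_def)
  have lamN: "lam \<bullet> lam = real (M + 12)"
    unfolding N[symmetric] lam using a by simp
  have fl: "\<lfloor>lam \<bullet> lam\<rfloor> - 12 = int M" unfolding lamN by simp
  let ?h = "complexify lam"
  let ?q = "q_pow 1 \<tau>" and ?w = "q_pow (1 / 2) \<tau>"
  define DI where "DI m = lookup (E_coeff integer_modes ?h 0 (single m 1)) m" for m
  define DH where "DH m = lookup (E_coeff half_modes ?h 0 (single m 1)) m" for m
  have h: "(\<Sum>i\<in>UNIV. (?h $ i)\<^sup>2) = of_nat (M + 12)"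
  proof -
    have "(\<Sum>i\<in>UNIV. (?h $ i)\<^sup>2) = of_real (lam \<bullet> lam)"
      by (simp add: complexify_def inner_vec_def power2_eq_square)
    then show ?thesis using lamN by simp
  qed
  let ?P = "euler_prod ?q"
  let ?S1 = "?P ^ 12 * ((euler_prod (?q\<^sup>2))\<^sup>2 / ?P) ^ M"
  let ?S = "\<lambda>w. ?P ^ 12 * ((euler_prod w)\<^sup>2 / ?P) ^ M"
  have q: "norm ?q < 1" "norm (?q\<^sup>2) < 1" "norm ?w < 1" "norm (- ?w) < 1"
    using norm_q_pow_less_1[OF \<tau>, of 1] norm_q_pow_less_1[OF \<tau>, of "1 / 2"] norm_square_less_1 by auto
  note nz = euler_prod_nonzero[OF q(1)] euler_prod_nonzero[OF q(2)] euler_prod_nonzero[OF q(3)] euler_prod_nonzero[OF q(4)]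
  have s1: "((\<lambda>m. (-1) ^ mono_count m * DI m * q_pow (mono_weight m) \<tau>) has_sum ?S1) (mode_monos integer_modes)"
    using untwisted_series_has_sum[OF h \<tau>] unfolding theta_power_identity[OF nz(1,2)] DI_def .
  have s2: "((\<lambda>m. DH m * q_pow (mono_weight m) \<tau>) has_sum ?S ?w) (mode_monos half_modes)"
    using twisted_series_has_sum[OF h \<tau>, of 1] theta_power_identity[OF nz(1,3), of M]
    by (simp add: q_pow_half_square DH_def)
  have s3: "((\<lambda>m. (-1) ^ mono_count m * DH m * q_pow (mono_weight m) \<tau>) has_sum ?S (- ?w)) (mode_monos half_modes)"
    using twisted_series_has_sum[OF h \<tau>, of "-1"] theta_power_identity[OF nz(1,4), of M]
    by (simp add: q_pow_half_square DH_def)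
  \<comment> \<open>The factor \<open>1 - (-1) ^ mono_count m\<close> restricts to odd counts, the
    t-fixed part of the twisted sector; it produces the difference of the Theta2 and Theta3
    contributions.\<close>
  have s4: "((\<lambda>m. (1 - (-1) ^ mono_count m) * DH m * q_pow (mono_weight m) \<tau>) has_sum (?S ?w - ?S (- ?w))) (mode_monos half_modes)"
    using has_sum_add[OF s2 has_sum_uminusI[OF s3]] by (simp add: algebra_simps)
  let ?U = "\<lambda>n. \<Sum>m\<in>weight_monos integer_modes (real n - (\<mu> \<bullet> \<mu>) / 2). (-1) ^ mono_count m * DI m"
  let ?V = "\<lambda>n. \<Sum>m\<in>weight_monos half_modes (real n - 3 / 2). (1 - (-1) ^ mono_count m) * DH m"
  have shift: "q_pow (real n - d) \<tau> * q_pow d \<tau> = q_pow (real n) \<tau>" for n d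
    unfolding q_pow_add[symmetric] by simp
  have u: "((\<lambda>n. ?U n * q_pow (real n) \<tau>) has_sum (?S1 * q_pow (real a) \<tau>)) UNIV"
  proof -
    have "((\<lambda>n. \<Sum>m\<in>weight_monos integer_modes (real n - real a). (-1) ^ mono_count m * DI m * q_pow (mono_weight m) \<tau>)
      has_sum ?S1) UNIV"
    proof (rule has_sum_by_weight[OF modes_positive_half_integers(1) s1])
      fix m assume "m \<in> mode_monos integer_modes"
      then obtain j :: nat where "mono_weight m = real j" by (rule mono_weight_integer_modes)
      then have "mono_weight m + real a = real (j + a)" by simp
      then show "\<exists>n::nat. mono_weight m + real a = real n" by blast
    qed
    moreover have "(\<Sum>m\<in>weight_monos integer_modes (real n - real a). (-1) ^ mono_count m * DI m * q_pow (mono_weight m) \<tau>) =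
        ?U n * q_pow (real n - real a) \<tau>" for n
      using a by (simp add: sum_distrib_right weight_monos_def)
    ultimately have "((\<lambda>n. ?U n * q_pow (real n - real a) \<tau>) has_sum ?S1) UNIV" by simp
    from has_sum_cmult_left[OF this, of "q_pow (real a) \<tau>"] show ?thesis
      by (simp only: mult.assoc shift)
  qed
  have v: "((\<lambda>n. ?V n * q_pow (real n) \<tau>) has_sum ((?S ?w - ?S (- ?w)) * q_pow (3 / 2) \<tau>)) UNIV"
  proof -
    have "((\<lambda>n. \<Sum>m\<in>weight_monos half_modes (real n - 3 / 2). (1 - (-1) ^ mono_count m) * DH m * q_pow (mono_weight m) \<tau>)
      has_sum (?S ?w - ?S (- ?w))) UNIV"
    proof (rule has_sum_by_weight[OF modes_positive_half_integers(2) s4])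
      fix m assume m: "m \<in> mode_monos half_modes"
        and "(1 - (-1) ^ mono_count m) * DH m * q_pow (mono_weight m) \<tau> \<noteq> 0"
      then have "odd (mono_count m)" by auto
      then obtain c where c: "mono_count m = 2 * c + 1" by (rule oddE)
      obtain j :: nat where "mono_weight m = real j + real (mono_count m) / 2"
        using m by (rule mono_weight_half_modes)
      then have "mono_weight m + 3 / 2 = real (j + c + 2)" using c by (simp add: add_divide_distrib)
      then show "\<exists>n::nat. mono_weight m + 3 / 2 = real n" by blast
    qed
    moreover have "(\<Sum>m\<in>weight_monos half_modes (real n - 3 / 2). (1 - (-1) ^ mono_count m) * DH m * q_pow (mono_weight m) \<tau>) =
        ?V n * q_pow (real n - 3 / 2) \<tau>" for n
      by (simp add: sum_distrib_right weight_monos_def)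
    ultimately have "((\<lambda>n. ?V n * q_pow (real n - 3 / 2) \<tau>) has_sum (?S ?w - ?S (- ?w))) UNIV" by simp
    from has_sum_cmult_left[OF this, of "q_pow (3 / 2) \<tau>"] show ?thesis
      by (simp only: mult.assoc shift)
  qed
  \<comment> \<open>The dimension 2^12 of T lowers the exponent from \<open>M + 12\<close> to
    \<open>M\<close>, leaving one factor 1/2 per theta function.\<close>
  have c: "4096 * complex_of_real (2 powr (- (lam \<bullet> lam))) = (1 / 2) ^ M"
  proof -
    have "2 powr (- (lam \<bullet> lam)) = 1 / 2 ^ (M + 12)"
      unfolding lamN powr_minus by (subst powr_realpow) (simp_all add: inverse_eq_divide)
    then show ?thesis by (simp add: power_add power_divide)
  qed
  have "((\<lambda>n. ?U n * q_pow (real n) \<tau> + (1 / 2) ^ M * (?V n * q_pow (real n) \<tau>)) has_sum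
      (?S1 * q_pow (real a) \<tau> + (1 / 2) ^ M * ((?S ?w - ?S (- ?w)) * q_pow (3 / 2) \<tau>))) UNIV"
    by (intro has_sum_add u has_sum_cmult_right v)
  moreover have "graded_trace \<Lambda> \<epsilon> \<rho> (v_vec lam) n = ?U n + (1 / 2) ^ M * ?V n" for n
    using graded_trace_v_vec[OF L \<epsilon> \<rho> \<mu> lam, of n] unfolding c DI_def DH_def .
  ultimately have "((\<lambda>n. graded_trace \<Lambda> \<epsilon> \<rho> (v_vec lam) n * q_pow (real n) \<tau>) has_sum
      (?S1 * q_pow (real a) \<tau> + (1 / 2) ^ M * ((?S ?w - ?S (- ?w)) * q_pow (3 / 2) \<tau>))) UNIV"
    by (simp only: distrib_right mult.assoc)
  then have sums: "(\<lambda>n. graded_trace \<Lambda> \<epsilon> \<rho> (v_vec lam) n * q_pow (real n) \<tau>) sums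
      (?S1 * q_pow (real a) \<tau> + (1 / 2) ^ M * ((?S ?w - ?S (- ?w)) * q_pow (3 / 2) \<tau>))"
    by (rule has_sum_imp_sums)
  then show "summable (\<lambda>n. graded_trace \<Lambda> \<epsilon> \<rho> (v_vec lam) n * q_pow (real n) \<tau>)" by (rule sums_summable)
  have eta: "eta \<tau> ^ 12 = q_pow (1 / 2) \<tau> * ?P ^ 12"
    unfolding eta_eq power_mult_distrib q_pow_power by simp
  \<comment> \<open>From 8a = M + 12: a - 1 = 1/2 + M/8, where 1/2 is the exponent of q in eta^12
    and 1/8 that in Theta1.\<close>
  have e1: "q_pow (- 1) \<tau> * q_pow (real a) \<tau> = q_pow (1 / 2) \<tau> * q_pow (1 / 8) \<tau> ^ M"
  proof -
    have "real a = real M / 8 + 3 / 2" using arg_cong[OF N, of real] by simp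
    then show ?thesis unfolding q_pow_power q_pow_add[symmetric] by simp
  qed
  \<comment> \<open>The vacuum shift 3/2 less 1 is again the exponent 1/2 of eta^12; Theta2 and
    Theta3 carry no fractional prefactor.\<close>
  have e2: "q_pow (- 1) \<tau> * q_pow (3 / 2) \<tau> = q_pow (1 / 2) \<tau>"
    unfolding q_pow_add[symmetric] by simp
  have "Z \<Lambda> \<epsilon> \<rho> (v_vec lam) \<tau> = q_pow (- 1) \<tau> *
      (?S1 * q_pow (real a) \<tau> + (1 / 2) ^ M * ((?S ?w - ?S (- ?w)) * q_pow (3 / 2) \<tau>))"
    unfolding Z_def sums_unique[OF sums] ..
  also have "\<dots> = (q_pow (- 1) \<tau> * q_pow (real a) \<tau>) * ?S1 +
      (q_pow (- 1) \<tau> * q_pow (3 / 2) \<tau>) * ((1 / 2) ^ M * (?S ?w - ?S (- ?w)))"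
    by (simp only: distrib_left mult_ac)
  also have "\<dots> = eta \<tau> ^ 12 * ((Theta1 \<tau> / 2) ^ M + (Theta2 \<tau> / 2) ^ M - (Theta3 \<tau> / 2) ^ M)"
  proof -
    have t1: "(Theta1 \<tau> / 2) ^ M = q_pow (1 / 8) \<tau> ^ M * ((euler_prod (?q\<^sup>2))\<^sup>2 / ?P) ^ M"
      unfolding Theta1_eq[OF \<tau>] power_mult_distrib ..
    have t23: "(Theta2 \<tau> / 2) ^ M = (1 / 2) ^ M * ((euler_prod ?w)\<^sup>2 / ?P) ^ M"
      "(Theta3 \<tau> / 2) ^ M = (1 / 2) ^ M * ((euler_prod (- ?w))\<^sup>2 / ?P) ^ M"
      unfolding Theta23_eq[OF \<tau>] power_mult_distrib[symmetric] by (simp_all add: mult.commute)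
    show ?thesis unfolding e1 e2 eta t1 t23 by (simp only: algebra_simps)
  qed
  finally show "Z \<Lambda> \<epsilon> \<rho> (v_vec lam) \<tau> = eta \<tau> ^ 12 *
            ((Theta1 \<tau> / 2) powi (\<lfloor>lam \<bullet> lam\<rfloor> - 12)
             + (Theta2 \<tau> / 2) powi (\<lfloor>lam \<bullet> lam\<rfloor> - 12)
             - (Theta3 \<tau> / 2) powi (\<lfloor>lam \<bullet> lam\<rfloor> - 12))"
    unfolding fl power_int_of_nat .
qed

theorem theorem3:
  fixes \<Lambda> :: "(real^24) set"
    and \<epsilon> :: "real^24 \<Rightarrow> real^24 \<Rightarrow> complex"
    and \<rho> :: "real^24 \<Rightarrow> complex^4096^4096"
    and lam :: "real^24"
  assumes "leech_lattice \<Lambda>"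
    and "bilinear_cocycle \<Lambda> \<epsilon>"
    and "projective_rep \<Lambda> \<epsilon> \<rho>"
    and "lam \<in> \<Lambda>"
  shows "highest_weight_vector \<Lambda> (complex_of_real ((lam \<bullet> lam) / 2)) (to_moonshine (v_vec lam)) \<and>
    (lam \<noteq> 0 \<and> lam \<in> (*\<^sub>R) 2 ` \<Lambda> \<longrightarrow>
      (\<forall>\<tau>. Im \<tau> > 0 \<longrightarrow>
        summable (\<lambda>n. graded_trace \<Lambda> \<epsilon> \<rho> (v_vec lam) n * q_pow (real n) \<tau>) \<and>
        Z \<Lambda> \<epsilon> \<rho> (v_vec lam) \<tau> =
          eta \<tau> ^ 12 *
            ((Theta1 \<tau> / 2) powi (\<lfloor>lam \<bullet> lam\<rfloor> - 12)
             + (Theta2 \<tau> / 2) powi (\<lfloor>lam \<bullet> lam\<rfloor> - 12)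
             - (Theta3 \<tau> / 2) powi (\<lfloor>lam \<bullet> lam\<rfloor> - 12))))"
proof (intro conjI impI allI, goal_cases)
  case 1
  show ?case by (rule highest_weight_vector_v_vec) (use assms in auto)
next
  case (2 \<tau>)
  then obtain \<mu> where "\<mu> \<in> \<Lambda>" "lam = 2 *\<^sub>R \<mu>" by blast
  then show ?case using Z_v_vec(1)[OF assms(1-3) _ _ _ 2(2), of \<mu> lam] 2(1) by auto
next
  case (3 \<tau>)
  then obtain \<mu> where "\<mu> \<in> \<Lambda>" "lam = 2 *\<^sub>R \<mu>" by blast
  then show ?case using Z_v_vec(2)[OF assms(1-3) _ _ _ 3(2), of \<mu> lam] 3(1) by auto
qed

end
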